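(* Let $F$ be an irreducible finite-dimensional $\mathfrak g_0$-module with highest weight $\mu$ (with respect to $(h_x,h_y,t,C)$), extended to $\mathfrak g_{\ge 0}$ by letting $\mathfrak g_{>0}$ act trivially. A vector $\vec m\in \mathrm{Ind}(F)$ is a nontrivial highest weight singular vector of degree $2$ if and only if $\vec m$ is, up to a (nonzero) scalar, one of the following vectors: (a) $\mu=\left(0,n,1-\frac n2,-1-\frac n2\right)$ with $n\in\mathbb Z_{\ge0}$, and $\vec m=w_{11}w_{21}\otimes y_1^n$; (b) $\mu=\left(m,0,1-\frac m2,1+\frac m2\right)$ with $m\in\mathbb Z_{\ge0}$, and $\vec m=w_{11}w_{12}\otimes x_1^m$; (c) $\mu=\left(m,0,2+\frac m2,-\frac m2\right)$ with $m\in\mathbb Z_{>1}$, and $\vec m=w_{22}w_{21}\otimes x_1^m+(w_{11}w_{22}+w_{21}w_{12})\otimes x_1^{m-1}x_2-w_{11}w_{12}\otimes x_1^{m-2}x_2^2$; (d) $\mu=\left(0,n,2+\frac n2,\frac n2\right)$ with $n\in\mathbb Z_{>1}$, and $\vec m=w_{22}w_{12}\otimes y_1^n-(w_{22}w_{11}+w_{21}w_{12})\otimes y_1^{n-1}y_2-w_{11}w_{21}\otimes y_1^{n-2}y_2^2$.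
   Context: Everything is over $\mathbb C$. Let $\Lambda(4)$ be the Grassmann superalgebra in the odd variables $\xi_1,\xi_2,\xi_3,\xi_4$, let $t$ be an even variable, $\partial_i=\partial/\partial\xi_i$ (left derivative), $p$ the parity. $K(1,4)_+$ is the space $\mathbb C[t]\otimes\Lambda(4)$ with Lie superbracket $$[f,g]=\Big(2f-\sum_{i}\xi_i\partial_i f\Big)\partial_t g-\partial_t f\Big(2g-\sum_i\xi_i\partial_i g\Big)+(-1)^{p(f)}\sum_{i}\partial_i f\,\partial_i g .$$ Write $\xi_{i_1\cdots i_r}=\xi_{i_1}\cdots\xi_{i_r}$. Let $\mathfrak g=K(1,4)_+\oplus\mathbb C C$ be the central extension (with $C$ even and central) with bracket $[a,b]_{\mathfrak g}=[a,b]+\psi(a,b)C$, where $\psi$ is the bilinear form with $\psi(a,b)=-(-1)^{p(a)p(b)}\psi(b,a)$ determined by $\psi(1,\xi_{1234})=-2$, $\psi(\xi_i,\partial_i\xi_{1234})=-1$ for $i=1,\dots,4$, all other values on pairs of basis monomials $t^m\xi_{i_1\cdots i_r}$ ($i_1<\dots<i_r$) being zero up to skew-symmetry. ($\mathfrak g$ is the annihilation superalgebra of the conformal superalgebra $K'_4$.) $\mathfrak g$ is $\mathbb Z$-graded by $\deg(t^m\xi_{i_1\cdots i_r})=2m+r-2$, $\deg C=0$; $\mathfrak g_{>0}$, $\mathfrak g_{\ge0}$, $\mathfrak g_{<0}$ denote the sums of the corresponding components. So $\mathfrak g_{-2}=\langle 1\rangle$, $\mathfrak g_{-1}=\langle\xi_1,\dots,\xi_4\rangle$,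 $\mathfrak g_0=\langle C,t,\xi_{ij}\rangle\cong\mathfrak{so}(4)\oplus\mathbb Ct\oplus\mathbb CC$. In $\mathfrak g_0$ put $h_x=-i\xi_{12}+i\xi_{34}$, $h_y=-i\xi_{12}-i\xi_{34}$, $e_x=\frac12(-\xi_{13}-\xi_{24}-i\xi_{14}+i\xi_{23})$, $f_x=\frac12(\xi_{13}+\xi_{24}-i\xi_{14}+i\xi_{23})$, $e_y=\frac12(-\xi_{13}+\xi_{24}+i\xi_{14}+i\xi_{23})$, $f_y=\frac12(\xi_{13}-\xi_{24}+i\xi_{14}+i\xi_{23})$; $\{e_x,h_x,f_x\}$ and $\{e_y,h_y,f_y\}$ are two commuting $\mathfrak{sl}_2$-triples. Weights are written $\mu=(m,n,\mu_t,\mu_C)$ with respect to $h_x,h_y,t,C$. The irreducible $\mathfrak g_0$-module of highest weight $(m,n,\mu_t,\mu_C)$ is realized as the space of polynomials in $x_1,x_2,y_1,y_2$ homogeneous of degree $m$ in $x_1,x_2$ and of degree $n$ in $y_1,y_2$, with $e_x=x_1\partial_{x_2}$, $f_x=x_2\partial_{x_1}$, $h_x=x_1\partial_{x_1}-x_2\partial_{x_2}$, $e_y=y_1\partial_{y_2}$, $f_y=y_2\partial_{y_1}$, $h_y=y_1\partial_{y_1}-y_2\partial_{y_2}$, and $t,C$ acting by the scalars $\mu_t,\mu_C$. $\mathrm{Ind}(F)=U(\mathfrak g)\otimes_{U(\mathfrak g_{\ge0})}F\cong U(\mathfrak g_{<0})\otimes F$ as a vector space, graded by $\mathbb Z_{\ge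 0}$ via minus the degree of $U(\mathfrak g_{<0})$. Let $\eta_i$ be the image of $\xi_i$ in $U(\mathfrak g_{<0})$ and $w_{11}=\eta_2+i\eta_1$, $w_{22}=\eta_2-i\eta_1$, $w_{12}=-\eta_4+i\eta_3$, $w_{21}=\eta_4+i\eta_3$ (products are taken in $U(\mathfrak g_{<0})$). A singular vector is a vector annihilated by $\mathfrak g_{>0}$; it is nontrivial if it is nonzero of positive degree; it is a highest weight singular vector if moreover it is annihilated by $e_x$ and $e_y$. *)

theory Defs
  imports Complex_Main "HOL-Library.Poly_Mapping"
begin

section \<open>Finitely supported functions as complex vector spaces\<close>

text \<open>
  A complex vector space with basis \<open>B\<close> is represented by the type of finitely supported
  functions from \<open>B\<close> to the complex numbers; \<open>Poly_Mapping.single b 1\<close> is the basis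
  vector \<open>b\<close>.
\<close>

abbreviation "lookup \<equiv> Poly_Mapping.lookup"
abbreviation "keys \<equiv> Poly_Mapping.keys"

abbreviation bas :: "'a \<Rightarrow> ('a \<Rightarrow>\<^sub>0 complex)" where
  "bas b \<equiv> Poly_Mapping.single b 1"

definition cscale :: "complex \<Rightarrow> ('a \<Rightarrow>\<^sub>0 complex) \<Rightarrow> ('a \<Rightarrow>\<^sub>0 complex)"  (infixr \<open>\<cdot>\<close> 75) where
  "c \<cdot> v = Poly_Mapping.map ((*) c) v"

lemma lookup_cscale [simp]: "lookup (c \<cdot> v) k = c * lookup v k"
  unfolding cscale_def by (transfer) (auto simp: when_def)

interpretation cs: vector_space "cscale :: complex \<Rightarrow> ('a \<Rightarrow>\<^sub>0 complex) \<Rightarrow> _"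
  by unfold_locales (auto intro!: poly_mapping_eqI simp: lookup_add algebra_simps)

definition lin_ext :: "('a \<Rightarrow> ('b \<Rightarrow>\<^sub>0 complex)) \<Rightarrow> ('a \<Rightarrow>\<^sub>0 complex) \<Rightarrow> ('b \<Rightarrow>\<^sub>0 complex)" where
  "lin_ext \<phi> v = (\<Sum>a\<in>keys v. lookup v a \<cdot> \<phi> a)"

definition bilin_ext ::
  "('a \<Rightarrow> 'b \<Rightarrow> ('c \<Rightarrow>\<^sub>0 complex)) \<Rightarrow> ('a \<Rightarrow>\<^sub>0 complex) \<Rightarrow> ('b \<Rightarrow>\<^sub>0 complex) \<Rightarrow> ('c \<Rightarrow>\<^sub>0 complex)" where
  "bilin_ext \<beta> v w = (\<Sum>a\<in>keys v. \<Sum>b\<in>keys w. (lookup v a * lookup w b) \<cdot> \<beta> a b)"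

lemma lin_ext_superset:
  assumes "finite S" "keys v \<subseteq> S"
  shows "lin_ext \<phi> v = (\<Sum>a\<in>S. lookup v a \<cdot> \<phi> a)"
  unfolding lin_ext_def
  by (rule sum.mono_neutral_left) (use assms in \<open>auto simp: in_keys_iff\<close>)

lemma lin_ext_add: "lin_ext \<phi> (v + w) = lin_ext \<phi> v + lin_ext \<phi> w"
proof -
  let ?S = "keys v \<union> keys w"
  have "keys (v + w) \<subseteq> ?S" by (rule Poly_Mapping.keys_add)
  then show ?thesis
    by (simp add: lin_ext_superset[of ?S] lookup_add cs.scale_left_distrib sum.distrib)
qed

lemma lin_ext_scale: "lin_ext \<phi> (c \<cdot> v) = c \<cdot> lin_ext \<phi> v"
proof -
  have "keys (c \<cdot> v) \<subseteq> keys v" by (auto simp: in_keys_iff)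
  then show ?thesis
    by (simp add: lin_ext_superset[of "keys v"] cs.scale_sum_right)
qed

lemma lin_ext_bas [simp]: "lin_ext \<phi> (bas a) = \<phi> a"
  by (simp add: lin_ext_def)

lemma lin_ext_zero [simp]: "lin_ext \<phi> 0 = 0"
  by (simp add: lin_ext_def)

lemma lin_ext_diff: "lin_ext \<phi> (v - w) = lin_ext \<phi> v - lin_ext \<phi> w"
  using lin_ext_add[of \<phi> "v - w" w] by simp


section \<open>The Lie superalgebra $K(1,4)_+$\<close>

datatype ix = I1 | I2 | I3 | I4

lemma UNIV_ix: "UNIV = {I1, I2, I3, I4}"
  by (auto intro: ix.exhaust)

instance ix :: finite
  by standard (simp add: UNIV_ix)

primrec ix_pos :: "ix \<Rightarrow> nat" where
  "ix_pos I1 = 1" | "ix_pos I2 = 2" | "ix_pos I3 = 3" | "ix_pos I4 = 4"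

instantiation ix :: linorder
begin
definition less_eq_ix :: "ix \<Rightarrow> ix \<Rightarrow> bool" where "i \<le> j \<longleftrightarrow> ix_pos i \<le> ix_pos j"
definition less_ix :: "ix \<Rightarrow> ix \<Rightarrow> bool" where "i < j \<longleftrightarrow> ix_pos i < ix_pos j"
instance
proof
  fix x y :: ix
  assume "x \<le> y" "y \<le> x"
  then show "x = y" by (cases x; cases y) (auto simp: less_eq_ix_def)
qed (auto simp: less_eq_ix_def less_ix_def)
end

text \<open>
  The pair \<^term>\<open>(m, S)\<close> stands for the monomial $t^m \xi_{i_1\cdots i_r}$, where
  $i_1 < \dots < i_r$ are the elements of \<^term>\<open>S\<close>.
\<close>

type_synonym kmon = "nat \<times> ix set"
type_synonym kalg = "kmon \<Rightarrow>\<^sub>0 complex"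

definition kmul :: "kalg \<Rightarrow> kalg \<Rightarrow> kalg" where
  "kmul = bilin_ext (\<lambda>(m, S) (n, T).
     if S \<inter> T = {} then (- 1) ^ card {(i, j). i \<in> S \<and> j \<in> T \<and> j < i} \<cdot> bas (m + n, S \<union> T) else 0)"

definition xi :: "ix \<Rightarrow> kalg" where
  "xi i = bas (0, {i})"

definition d_xi :: "ix \<Rightarrow> kalg \<Rightarrow> kalg" where
  "d_xi i = lin_ext (\<lambda>(m, S). if i \<in> S then (- 1) ^ card {j \<in> S. j < i} \<cdot> bas (m, S - {i}) else 0)"

definition d_t :: "kalg \<Rightarrow> kalg" where
  "d_t = lin_ext (\<lambda>(m, S). of_nat m \<cdot> bas (m - 1, S))"

text \<open>
  The bracket formula contains the sign $(-1)^{p(f)}$ and is meant for homogeneous $f$;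
  \<^term>\<open>parity_inv f\<close> is the linear map that is $(-1)^{p(f)} f$ on homogeneous $f$.
\<close>

definition parity_inv :: "kalg \<Rightarrow> kalg" where
  "parity_inv = lin_ext (\<lambda>(m, S). (- 1) ^ card S \<cdot> bas (m, S))"

definition k_bracket :: "kalg \<Rightarrow> kalg \<Rightarrow> kalg" where
  "k_bracket f g =
     kmul (2 \<cdot> f - (\<Sum>i\<in>UNIV. kmul (xi i) (d_xi i f))) (d_t g)
     - kmul (d_t f) (2 \<cdot> g - (\<Sum>i\<in>UNIV. kmul (xi i) (d_xi i g)))
     + (\<Sum>i\<in>UNIV. kmul (d_xi i (parity_inv f)) (d_xi i g))"


section \<open>The central extension and its enveloping algebra\<close>

datatype gbas = Mon kmon | Cen

type_synonym galg = "gbas \<Rightarrow>\<^sub>0 complex"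

fun gpar :: "gbas \<Rightarrow> nat" where
  "gpar (Mon (m, S)) = card S mod 2"
| "gpar Cen = 0"

fun gdeg :: "gbas \<Rightarrow> int" where
  "gdeg (Mon (m, S)) = 2 * int m + int (card S) - 2"
| "gdeg Cen = 0"

text \<open>
  \<open>psi0\<close> records the two given families of values. The value $-1$ is prescribed on
  $(\xi_i, \partial_i \xi_{1234})$, and $\partial_i\xi_{1234}$ is
  $(-1)^{|\{j : j < i\}|}$ times the basis monomial of the complement of $i$.
\<close>

fun psi0 :: "kmon \<Rightarrow> kmon \<Rightarrow> complex" where
  "psi0 (m, S) (n, T) =
     (if m = 0 \<and> n = 0 \<and> S = {} \<and> T = UNIV then - 2
      else if m = 0 \<and> n = 0 \<and> (\<exists>i. S = {i} \<and> T = - {i})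
        then - ((- 1) ^ card {j. j < (THE i. S = {i})})
      else 0)"

definition psi :: "kmon \<Rightarrow> kmon \<Rightarrow> complex" where
  "psi a b = psi0 a b - (- 1) ^ (card (snd a) * card (snd b)) * psi0 b a"

definition psi_ext :: "kalg \<Rightarrow> kalg \<Rightarrow> complex" where
  "psi_ext f g = (\<Sum>a\<in>keys f. \<Sum>b\<in>keys g. lookup f a * lookup g b * psi a b)"

definition k_part :: "galg \<Rightarrow> kalg" where
  "k_part = lin_ext (\<lambda>b. case b of Mon a \<Rightarrow> bas a | Cen \<Rightarrow> 0)"

definition of_kalg :: "kalg \<Rightarrow> galg" where
  "of_kalg = lin_ext (\<lambda>a. bas (Mon a))"

definition g_bracket :: "galg \<Rightarrow> galg \<Rightarrow> galg" where
  "g_bracket x y = of_kalg (k_bracket (k_part x) (k_part y)) + psi_ext (k_part x) (k_part y) \<cdot> bas Cen"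

lemma psi_skew: "psi a b = - ((- 1) ^ (card (snd a) * card (snd b)) * psi b a)"
proof -
  have "(- 1) ^ k * ((- 1) ^ k * z) = (z :: complex)" for k z
    by (simp add: power_mult_distrib[symmetric] mult.assoc[symmetric])
  then show ?thesis by (simp add: psi_def algebra_simps)
qed

lemma psi_values:
  "psi (0, {}) (0, UNIV) = - 2"
  "psi_ext (xi i) (d_xi i (bas (0, UNIV))) = - 1"
proof -
  have ne0: "UNIV \<noteq> {i}" for i :: ix
    by (cases i) (auto simp: set_eq_iff intro: ix.exhaust)
  then show "psi (0, {}) (0, UNIV) = - 2"
    by (auto simp: psi_def)
  have ne: "- {i} \<noteq> {k}" for k
    by (cases i; cases k) (auto simp: set_eq_iff split: ix.splits intro: ix.exhaust)
  have ne2: "- {i} \<noteq> {}" using ne0[of i] by auto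
  have p: "psi (0, {i}) (0, - {i}) = - ((- 1) ^ card {j. j < i})"
    using ne ne2 by (auto simp: psi_def)
  have sq: "(- 1 :: complex) ^ k * (- 1) ^ k = 1" for k
    by (simp add: power_mult_distrib[symmetric])
  have keys: "keys (c \<cdot> bas b) = {b}" if "c \<noteq> 0" for c and b :: kmon
    using that by (auto simp: in_keys_iff lookup_single when_def split: if_splits)
  show "psi_ext (xi i) (d_xi i (bas (0, UNIV))) = - 1"
    by (simp add: psi_ext_def xi_def d_xi_def keys p sq Compl_eq_Diff_UNIV[symmetric])
qed

text \<open>
  The tensor algebra of $\mathfrak g$ is the free algebra on its basis: the space with
  basis the words in \<^typ>\<open>gbas\<close>, with the convolution product of
  \<^typ>\<open>'a \<Rightarrow>\<^sub>0 complex\<close> induced by concatenation of words.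
\<close>

datatype 'a fword = FWord (letters: "'a list")

instantiation fword :: (type) monoid_add
begin
definition zero_fword :: "'a fword" where "0 = FWord []"
definition plus_fword :: "'a fword \<Rightarrow> 'a fword \<Rightarrow> 'a fword" where
  "v + w = FWord (letters v @ letters w)"
instance by standard (auto simp: zero_fword_def plus_fword_def)
end

type_synonym tens_alg = "gbas fword \<Rightarrow>\<^sub>0 complex"

definition g_to_tens :: "galg \<Rightarrow> tens_alg" where
  "g_to_tens = lin_ext (\<lambda>b. bas (FWord [b]))"

definition U_rels :: "tens_alg set" where
  "U_rels = {g_to_tens (bas a) * g_to_tens (bas b)
             - (- 1) ^ (gpar a * gpar b) \<cdot> (g_to_tens (bas b) * g_to_tens (bas a))
             - g_to_tens (g_bracket (bas a) (bas b)) | a b. True}"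

definition U_ideal :: "tens_alg set" where
  "U_ideal = cs.span {p * r * q | p r q. r \<in> U_rels}"

definition U_cong :: "tens_alg \<Rightarrow> tens_alg \<Rightarrow> bool" where
  "U_cong p q \<longleftrightarrow> p - q \<in> U_ideal"

lemma cscale_conv_mult:
  fixes p :: "'a :: monoid_add \<Rightarrow>\<^sub>0 complex"
  shows "c \<cdot> p = Poly_Mapping.single 0 c * p" "c \<cdot> p = p * Poly_Mapping.single 0 c"
proof -
  have p: "p = (\<Sum>k\<in>keys p. Poly_Mapping.single k (lookup p k))"
    by (rule poly_mapping_eqI) (auto simp: lookup_sum lookup_single when_def in_keys_iff sum.delta)
  have sg: "c \<cdot> Poly_Mapping.single k x = Poly_Mapping.single k (c * x)" for k :: 'a and x
    by (rule poly_mapping_eqI) (auto simp: lookup_single when_def)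
  have cp: "c \<cdot> p = (\<Sum>k\<in>keys p. Poly_Mapping.single k (c * lookup p k))"
    by (subst p, subst cs.scale_sum_right) (simp add: sg)
  have "Poly_Mapping.single 0 c * p = (\<Sum>k\<in>keys p. Poly_Mapping.single k (c * lookup p k))"
    by (subst p, subst sum_distrib_left) (simp add: mult_single)
  then show "c \<cdot> p = Poly_Mapping.single 0 c * p" using cp by simp
  have "p * Poly_Mapping.single 0 c = (\<Sum>k\<in>keys p. Poly_Mapping.single k (c * lookup p k))"
    by (subst p, subst sum_distrib_right) (simp add: mult_single mult.commute)
  then show "c \<cdot> p = p * Poly_Mapping.single 0 c" using cp by simp
qed

lemma cscale_mult_left:
  fixes p q :: "'a :: monoid_add \<Rightarrow>\<^sub>0 complex"
  shows "(c \<cdot> p) * q = c \<cdot> (p * q)"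
  by (simp add: cscale_conv_mult(1) mult.assoc)

lemma cscale_mult_right:
  fixes p q :: "'a :: monoid_add \<Rightarrow>\<^sub>0 complex"
  shows "p * (c \<cdot> q) = c \<cdot> (p * q)"
  by (simp add: cscale_conv_mult(2) mult.assoc)

lemma U_ideal_mult_left: "p \<in> U_ideal \<Longrightarrow> q * p \<in> U_ideal"
  unfolding U_ideal_def
proof (induction rule: cs.span_induct_alt)
  case (step c x y)
  then obtain p' r q' where x: "x = p' * r * q'" and r: "r \<in> U_rels" by blast
  have "q * x = (q * p') * r * q'" by (simp add: x mult.assoc)
  then have "q * x \<in> cs.span {p * r * q | p r q. r \<in> U_rels}"
    using r by (blast intro: cs.span_base)
  with step show ?case
    by (simp add: distrib_left cscale_mult_right cs.span_add cs.span_scale)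
qed (simp add: cs.span_zero)

lemma U_ideal_mult_right: "p \<in> U_ideal \<Longrightarrow> p * q \<in> U_ideal"
  unfolding U_ideal_def
proof (induction rule: cs.span_induct_alt)
  case (step c x y)
  then obtain p' r q' where x: "x = p' * r * q'" and r: "r \<in> U_rels" by blast
  have "x * q = p' * r * (q' * q)" by (simp add: x mult.assoc)
  then have "x * q \<in> cs.span {p * r * q | p r q. r \<in> U_rels}"
    using r by (blast intro: cs.span_base)
  with step show ?case
    by (simp add: distrib_right cscale_mult_left cs.span_add cs.span_scale)
qed (simp add: cs.span_zero)

lemma U_ideal_add: "p \<in> U_ideal \<Longrightarrow> q \<in> U_ideal \<Longrightarrow> p + q \<in> U_ideal"
  by (simp add: U_ideal_def cs.span_add)

lemma U_ideal_neg: "p \<in> U_ideal \<Longrightarrow> - p \<in> U_ideal"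
  by (simp add: U_ideal_def cs.span_neg)

quotient_type ualg = tens_alg / U_cong
proof (rule equivpI)
  show "reflp U_cong"
    by (simp add: reflp_def U_cong_def U_ideal_def cs.span_zero)
  show "symp U_cong"
    using U_ideal_neg by (fastforce simp: symp_def U_cong_def)
  show "transp U_cong"
    using U_ideal_add by (fastforce simp: transp_def U_cong_def)
qed

instantiation ualg :: "{ring, monoid_mult}"
begin
lift_definition zero_ualg :: ualg is 0 .
lift_definition one_ualg :: ualg is 1 .
lift_definition plus_ualg :: "ualg \<Rightarrow> ualg \<Rightarrow> ualg" is "(+)"
  using U_ideal_add by (fastforce simp: U_cong_def algebra_simps)
lift_definition uminus_ualg :: "ualg \<Rightarrow> ualg" is uminus
  using U_ideal_neg by (fastforce simp: U_cong_def algebra_simps)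
lift_definition minus_ualg :: "ualg \<Rightarrow> ualg \<Rightarrow> ualg" is "(-)"
  using U_ideal_add[OF _ U_ideal_neg] by (fastforce simp: U_cong_def algebra_simps)
lift_definition times_ualg :: "ualg \<Rightarrow> ualg \<Rightarrow> ualg" is "(*)"
proof -
  fix p p' q q' assume "U_cong p p'" "U_cong q q'"
  then have "(p - p') * q + p' * (q - q') \<in> U_ideal"
    by (auto simp: U_cong_def intro: U_ideal_add U_ideal_mult_left U_ideal_mult_right)
  then show "U_cong (p * q) (p' * q')" by (simp add: U_cong_def algebra_simps)
qed
instance
  by standard (transfer, simp add: U_cong_def U_ideal_def cs.span_zero algebra_simps)+
end

lift_definition uscale :: "complex \<Rightarrow> ualg \<Rightarrow> ualg" is cscale
  unfolding U_cong_def U_ideal_def cs.scale_right_diff_distrib[symmetric] by (rule cs.span_scale)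

interpretation us: vector_space uscale
  by unfold_locales (transfer, simp add: U_cong_def U_ideal_def cs.span_zero
    cs.scale_right_distrib cs.scale_left_distrib)+

definition gU :: "galg \<Rightarrow> ualg" where
  "gU x = abs_ualg (g_to_tens x)"


section \<open>The modules \<open>F\<close>\<close>

datatype pvar = X1 | X2 | Y1 | Y2

type_synonym poly4 = "(pvar \<Rightarrow>\<^sub>0 nat) \<Rightarrow>\<^sub>0 complex"

definition pv :: "pvar \<Rightarrow> poly4" where
  "pv v = bas (Poly_Mapping.single v 1)"

definition pdiff :: "pvar \<Rightarrow> poly4 \<Rightarrow> poly4" where
  "pdiff v = lin_ext (\<lambda>e. of_nat (lookup e v) \<cdot> bas (e - Poly_Mapping.single v 1))"

text \<open>
  A weight \<open>(m, n, \<mu>\<^sub>t, \<mu>\<^sub>C)\<close> is taken with respect to $h_x, h_y, t, C$. The irreducible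
  finite-dimensional $\mathfrak g_0$-modules are those with $m, n \in \mathbb N$; they are realized
  on bihomogeneous polynomials.
\<close>

type_synonym weight = "nat \<times> nat \<times> complex \<times> complex"

fun F_space :: "weight \<Rightarrow> poly4 set" where
  "F_space (m, n, \<mu>\<^sub>t, \<mu>\<^sub>C) =
     {p. \<forall>e\<in>keys p. lookup e X1 + lookup e X2 = m \<and> lookup e Y1 + lookup e Y2 = n}"

definition mon :: "ix set \<Rightarrow> galg" where
  "mon S = bas (Mon (0, S))"

definition h_x :: galg where "h_x = - \<i> \<cdot> mon {I1, I2} + \<i> \<cdot> mon {I3, I4}"
definition h_y :: galg where "h_y = - \<i> \<cdot> mon {I1, I2} - \<i> \<cdot> mon {I3, I4}"
definition e_x :: galg where
  "e_x = (1/2) \<cdot> (- mon {I1, I3} - mon {I2, I4} - \<i> \<cdot> mon {I1, I4} + \<i> \<cdot> mon {I2, I3})"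
definition f_x :: galg where
  "f_x = (1/2) \<cdot> (mon {I1, I3} + mon {I2, I4} - \<i> \<cdot> mon {I1, I4} + \<i> \<cdot> mon {I2, I3})"
definition e_y :: galg where
  "e_y = (1/2) \<cdot> (- mon {I1, I3} + mon {I2, I4} + \<i> \<cdot> mon {I1, I4} + \<i> \<cdot> mon {I2, I3})"
definition f_y :: galg where
  "f_y = (1/2) \<cdot> (mon {I1, I3} - mon {I2, I4} + \<i> \<cdot> mon {I1, I4} + \<i> \<cdot> mon {I2, I3})"

text \<open>
  The action of $\mathfrak g_{\ge 0}$ on $F$. For the basis elements $\xi_{ij}$ it is obtained
  by solving the definitions of $h_x, \dots, f_y$ for $\xi_{ij}$; lemma \<open>F_act_generators\<close>
  recovers the prescribed action. Basis elements of positive degree act as zero (the value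
  on basis elements of negative degree is irrelevant).
\<close>

fun F_act_bas :: "weight \<Rightarrow> gbas \<Rightarrow> poly4 \<Rightarrow> poly4" where
  "F_act_bas (m, n, \<mu>\<^sub>t, \<mu>\<^sub>C) b p =
    (let ex = pv X1 * pdiff X2 p; fx = pv X2 * pdiff X1 p;
         hx = pv X1 * pdiff X1 p - pv X2 * pdiff X2 p;
         ey = pv Y1 * pdiff Y2 p; fy = pv Y2 * pdiff Y1 p;
         hy = pv Y1 * pdiff Y1 p - pv Y2 * pdiff Y2 p
     in if b = Cen then \<mu>\<^sub>C \<cdot> p
        else if b = Mon (1, {}) then \<mu>\<^sub>t \<cdot> p
        else if b = Mon (0, {I1, I2}) then (\<i>/2) \<cdot> (hx + hy)
        else if b = Mon (0, {I3, I4}) then (\<i>/2) \<cdot> (hy - hx)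
        else if b = Mon (0, {I1, I3}) then (1/2) \<cdot> (fx - ex + fy - ey)
        else if b = Mon (0, {I2, I4}) then (1/2) \<cdot> (fx - ex - fy + ey)
        else if b = Mon (0, {I1, I4}) then (\<i>/2) \<cdot> (ex + fx - ey - fy)
        else if b = Mon (0, {I2, I3}) then (- \<i>/2) \<cdot> (ex + fx + ey + fy)
        else 0)"

definition F_act :: "weight \<Rightarrow> galg \<Rightarrow> poly4 \<Rightarrow> poly4" where
  "F_act \<mu> x p = lin_ext (\<lambda>b. F_act_bas \<mu> b p) x"

lemma F_act_generators:
  "F_act \<mu> h_x p = pv X1 * pdiff X1 p - pv X2 * pdiff X2 p"
  "F_act \<mu> e_x p = pv X1 * pdiff X2 p"
  "F_act \<mu> f_x p = pv X2 * pdiff X1 p"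
  "F_act \<mu> h_y p = pv Y1 * pdiff Y1 p - pv Y2 * pdiff Y2 p"
  "F_act \<mu> e_y p = pv Y1 * pdiff Y2 p"
  "F_act \<mu> f_y p = pv Y2 * pdiff Y1 p"
proof -
  obtain m n t c where \<mu>: "\<mu> = (m, n, t, c)" by (metis prod_cases4)
  have uminus: "lin_ext \<phi> (- v) = - lin_ext \<phi> v" for \<phi> :: "gbas \<Rightarrow> poly4" and v
    using lin_ext_diff[of \<phi> 0 v] by simp
  define ex where "ex = pv X1 * pdiff X2 p"
  define fx where "fx = pv X2 * pdiff X1 p"
  define ax where "ax = pv X1 * pdiff X1 p"
  define bx where "bx = pv X2 * pdiff X2 p"
  define ey where "ey = pv Y1 * pdiff Y2 p"
  define fy where "fy = pv Y2 * pdiff Y1 p"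
  define ay where "ay = pv Y1 * pdiff Y1 p"
  define bY where "bY = pv Y2 * pdiff Y2 p"
  note folds = ex_def[symmetric] fx_def[symmetric] ax_def[symmetric] bx_def[symmetric]
    ey_def[symmetric] fy_def[symmetric] ay_def[symmetric] bY_def[symmetric]
  have neq: "{I3, I4} \<noteq> {I1, I2}" "{I1, I3} \<noteq> {I1, I2}" "{I1, I3} \<noteq> {I3, I4}"
    "{I2, I4} \<noteq> {I1, I2}" "{I2, I4} \<noteq> {I3, I4}" "{I2, I4} \<noteq> {I1, I3}"
    "{I1, I4} \<noteq> {I1, I2}" "{I1, I4} \<noteq> {I3, I4}" "{I1, I4} \<noteq> {I1, I3}" "{I1, I4} \<noteq> {I2, I4}"
    "{I2, I3} \<noteq> {I1, I2}" "{I2, I3} \<noteq> {I3, I4}" "{I2, I3} \<noteq> {I1, I3}" "{I2, I3} \<noteq> {I2, I4}"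
    "{I2, I3} \<noteq> {I1, I4}"
    by auto
  have act:
    "F_act \<mu> (mon {I1, I2}) p = (\<i>/2) \<cdot> ((ax - bx) + (ay - bY))"
    "F_act \<mu> (mon {I3, I4}) p = (\<i>/2) \<cdot> ((ay - bY) - (ax - bx))"
    "F_act \<mu> (mon {I1, I3}) p = (1/2) \<cdot> (fx - ex + fy - ey)"
    "F_act \<mu> (mon {I2, I4}) p = (1/2) \<cdot> (fx - ex - fy + ey)"
    "F_act \<mu> (mon {I1, I4}) p = (\<i>/2) \<cdot> (ex + fx - ey - fy)"
    "F_act \<mu> (mon {I2, I3}) p = (- \<i>/2) \<cdot> (ex + fx + ey + fy)"
    unfolding \<mu> F_act_def mon_def lin_ext_bas F_act_bas.simps folds Let_def
    by (simp_all only: neq gbas.inject gbas.distinct prod.inject if_False if_True simp_thms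
        insert_not_empty zero_neq_one)
  have F_lin: "F_act \<mu> (v + w) p = F_act \<mu> v p + F_act \<mu> w p"
    "F_act \<mu> (v - w) p = F_act \<mu> v p - F_act \<mu> w p"
    "F_act \<mu> (- v) p = - F_act \<mu> v p" "F_act \<mu> (a \<cdot> v) p = a \<cdot> F_act \<mu> v p" for v w a
    by (simp_all add: F_act_def uminus lin_ext_add lin_ext_diff lin_ext_scale)
  have i2: "\<i> * (\<i> * z) = - z" for z by (simp add: mult.assoc[symmetric])
  note defs = h_x_def h_y_def e_x_def f_x_def e_y_def f_y_def F_lin act
  note lookups = lookup_add lookup_minus lookup_uminus lookup_cscale
  show "F_act \<mu> h_x p = pv X1 * pdiff X1 p - pv X2 * pdiff X2 p"
    unfolding folds defs
    by (rule poly_mapping_eqI, simp only: lookups) (simp add: field_simps i2)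
  show "F_act \<mu> e_x p = pv X1 * pdiff X2 p"
    unfolding folds defs
    by (rule poly_mapping_eqI, simp only: lookups) (simp add: field_simps i2)
  show "F_act \<mu> f_x p = pv X2 * pdiff X1 p"
    unfolding folds defs
    by (rule poly_mapping_eqI, simp only: lookups) (simp add: field_simps i2)
  show "F_act \<mu> h_y p = pv Y1 * pdiff Y1 p - pv Y2 * pdiff Y2 p"
    unfolding folds defs
    by (rule poly_mapping_eqI, simp only: lookups) (simp add: field_simps i2)
  show "F_act \<mu> e_y p = pv Y1 * pdiff Y2 p"
    unfolding folds defs
    by (rule poly_mapping_eqI, simp only: lookups) (simp add: field_simps i2)
  show "F_act \<mu> f_y p = pv Y2 * pdiff Y1 p"
    unfolding folds defs
    by (rule poly_mapping_eqI, simp only: lookups) (simp add: field_simps i2)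
qed


section \<open>Induced modules\<close>

definition g_ge0 :: "galg set" where "g_ge0 = {x. \<forall>b\<in>keys x. gdeg b \<ge> 0}"
definition g_gt0 :: "galg set" where "g_gt0 = {x. \<forall>b\<in>keys x. gdeg b > 0}"

text \<open>
  $U(\mathfrak g)\otimes_{U(\mathfrak g_{\ge0})} F$ is the quotient of the free vector space on the
  pairs $(u, f)$ by the span of the usual relations. It suffices to balance over the generators
  $\mathfrak g_{\ge 0}$ of $U(\mathfrak g_{\ge 0})$. The quotient depends on the weight, so its elements
  are represented as cosets, and \<^term>\<open>pre_tens u f\<close> is a representative of $u \otimes f$.
\<close>

type_synonym preind = "(ualg \<times> poly4) \<Rightarrow>\<^sub>0 complex"

definition pre_tens :: "ualg \<Rightarrow> poly4 \<Rightarrow> preind"  (infix \<open>\<otimes>\<close> 76) where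
  "u \<otimes> f = bas (u, f)"

definition pre_space :: "weight \<Rightarrow> preind set" where
  "pre_space \<mu> = cs.span {u \<otimes> f | u f. f \<in> F_space \<mu>}"

definition ind_rels :: "weight \<Rightarrow> preind set" where
  "ind_rels \<mu> =
     {(u + u') \<otimes> f - u \<otimes> f - u' \<otimes> f | u u' f. f \<in> F_space \<mu>}
   \<union> {u \<otimes> (f + f') - u \<otimes> f - u \<otimes> f' | u f f'. f \<in> F_space \<mu> \<and> f' \<in> F_space \<mu>}
   \<union> {uscale c u \<otimes> f - c \<cdot> (u \<otimes> f) | c u f. f \<in> F_space \<mu>}
   \<union> {u \<otimes> (c \<cdot> f) - c \<cdot> (u \<otimes> f) | c u f. f \<in> F_space \<mu>}
   \<union> {(u * gU x) \<otimes> f - u \<otimes> F_act \<mu> x f | u x f. x \<in> g_ge0 \<and> f \<in> F_space \<mu>}"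

type_synonym indvec = "preind set"

definition ind_cls :: "weight \<Rightarrow> preind \<Rightarrow> indvec" where
  "ind_cls \<mu> v = {w. w - v \<in> cs.span (ind_rels \<mu>)}"

definition Ind :: "weight \<Rightarrow> indvec set" where
  "Ind \<mu> = ind_cls \<mu> ` pre_space \<mu>"

definition pre_act :: "ualg \<Rightarrow> preind \<Rightarrow> preind" where
  "pre_act u = lin_ext (\<lambda>(u', f). (u * u') \<otimes> f)"

definition ind_act :: "weight \<Rightarrow> ualg \<Rightarrow> indvec \<Rightarrow> indvec" where
  "ind_act \<mu> u A = (\<Union>v\<in>A. ind_cls \<mu> (pre_act u v))"

lemma pre_act_tens [simp]: "pre_act u (u' \<otimes> f) = (u * u') \<otimes> f"
  by (simp add: pre_act_def pre_tens_def)

lemma uscale_mult_right: "u * uscale c u' = uscale c (u * u')"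
  by transfer (simp add: cscale_mult_right U_cong_def U_ideal_def cs.span_zero)

lemma pre_act_rels:
  assumes "r \<in> ind_rels \<mu>"
  shows "pre_act u r \<in> ind_rels \<mu>"
proof -
  have d: "pre_act u (v - w) = pre_act u v - pre_act u w"
    "pre_act u (c \<cdot> v) = c \<cdot> pre_act u v" for v w c
    by (simp_all add: pre_act_def lin_ext_diff lin_ext_scale)
  from assms consider
      (1) u1 u2 f where "r = (u1 + u2) \<otimes> f - u1 \<otimes> f - u2 \<otimes> f" "f \<in> F_space \<mu>"
    | (2) u1 f f' where "r = u1 \<otimes> (f + f') - u1 \<otimes> f - u1 \<otimes> f'" "f \<in> F_space \<mu>" "f' \<in> F_space \<mu>"
    | (3) c u1 f where "r = uscale c u1 \<otimes> f - c \<cdot> (u1 \<otimes> f)" "f \<in> F_space \<mu>"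
    | (4) c u1 f where "r = u1 \<otimes> (c \<cdot> f) - c \<cdot> (u1 \<otimes> f)" "f \<in> F_space \<mu>"
    | (5) u1 x f where "r = (u1 * gU x) \<otimes> f - u1 \<otimes> F_act \<mu> x f" "x \<in> g_ge0" "f \<in> F_space \<mu>"
    unfolding ind_rels_def by blast
  then show ?thesis
  proof cases
    case 1
    then have "pre_act u r = (u * u1 + u * u2) \<otimes> f - (u * u1) \<otimes> f - (u * u2) \<otimes> f"
      by (simp add: d distrib_left)
    with 1 show ?thesis unfolding ind_rels_def by blast
  next
    case 2
    then have "pre_act u r = (u * u1) \<otimes> (f + f') - (u * u1) \<otimes> f - (u * u1) \<otimes> f'"
      by (simp add: d)
    with 2 show ?thesis unfolding ind_rels_def by blast
  next
    case 3
    then have "pre_act u r = uscale c (u * u1) \<otimes> f - c \<cdot> ((u * u1) \<otimes> f)"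
      by (simp add: d uscale_mult_right)
    with 3 show ?thesis unfolding ind_rels_def by blast
  next
    case 4
    then have "pre_act u r = (u * u1) \<otimes> (c \<cdot> f) - c \<cdot> ((u * u1) \<otimes> f)"
      by (simp add: d)
    with 4 show ?thesis unfolding ind_rels_def by blast
  next
    case 5
    then have "pre_act u r = (u * u1 * gU x) \<otimes> f - (u * u1) \<otimes> F_act \<mu> x f"
      by (simp add: d mult.assoc)
    with 5 show ?thesis unfolding ind_rels_def by blast
  qed
qed

lemma ind_cls_eqI:
  assumes "w - v \<in> cs.span (ind_rels \<mu>)"
  shows "ind_cls \<mu> w = ind_cls \<mu> v"
proof -
  have "z - w \<in> cs.span (ind_rels \<mu>) \<longleftrightarrow> z - v \<in> cs.span (ind_rels \<mu>)" for z
    using cs.span_add_eq[OF assms, of "z - w"] by simp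
  then show ?thesis by (simp add: ind_cls_def)
qed

lemma ind_act_cls: "ind_act \<mu> u (ind_cls \<mu> v) = ind_cls \<mu> (pre_act u v)"
proof -
  let ?R = "cs.span (ind_rels \<mu>)"
  have R: "pre_act u r \<in> ?R" if "r \<in> ?R" for r
    using that
  proof (induction rule: cs.span_induct_alt)
    case base
    show ?case by (simp add: pre_act_def cs.span_zero)
  next
    case (step c x y)
    have "pre_act u (c \<cdot> x + y) = c \<cdot> pre_act u x + pre_act u y"
      by (simp add: pre_act_def lin_ext_add lin_ext_scale)
    moreover have "pre_act u x \<in> ?R"
      by (rule cs.span_base) (rule pre_act_rels[OF step(1)])
    ultimately show ?case
      using step by (simp add: cs.span_add cs.span_scale)
  qed
  have "ind_cls \<mu> (pre_act u w) = ind_cls \<mu> (pre_act u v)" if "w \<in> ind_cls \<mu> v" for w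
    using R[of "w - v"] that
    by (intro ind_cls_eqI) (simp add: ind_cls_def pre_act_def lin_ext_diff)
  moreover have "v \<in> ind_cls \<mu> v" by (simp add: ind_cls_def cs.span_zero)
  ultimately show ?thesis unfolding ind_act_def by blast
qed

text \<open>
  \<^term>\<open>U_neg d\<close> is the component of $U(\mathfrak g_{<0})$ of degree \<open>-d\<close>, inside the whole
  enveloping algebra.
\<close>

definition U_neg :: "nat \<Rightarrow> ualg set" where
  "U_neg d = us.span {prod_list (map (gU \<circ> bas) bs) | bs.
      (\<forall>b\<in>set bs. gdeg b < 0) \<and> sum_list (map gdeg bs) = - int d}"

definition Ind_deg :: "weight \<Rightarrow> nat \<Rightarrow> indvec set" where
  "Ind_deg \<mu> d = ind_cls \<mu> ` cs.span {u \<otimes> f | u f. u \<in> U_neg d \<and> f \<in> F_space \<mu>}"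

definition singular :: "weight \<Rightarrow> indvec \<Rightarrow> bool" where
  "singular \<mu> A \<longleftrightarrow> A \<in> Ind \<mu> \<and> (\<forall>x\<in>g_gt0. ind_act \<mu> (gU x) A = ind_cls \<mu> 0)"

definition hw_singular :: "weight \<Rightarrow> indvec \<Rightarrow> bool" where
  "hw_singular \<mu> A \<longleftrightarrow> singular \<mu> A \<and>
     ind_act \<mu> (gU e_x) A = ind_cls \<mu> 0 \<and> ind_act \<mu> (gU e_y) A = ind_cls \<mu> 0"

definition nontrivial_hw_singular :: "weight \<Rightarrow> nat \<Rightarrow> indvec \<Rightarrow> bool" where
  "nontrivial_hw_singular \<mu> d A \<longleftrightarrow>
     hw_singular \<mu> A \<and> A \<noteq> ind_cls \<mu> 0 \<and> d > 0 \<and> A \<in> Ind_deg \<mu> d"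

definition \<eta> :: "ix \<Rightarrow> ualg" where
  "\<eta> i = gU (mon {i})"

definition w11 :: ualg where "w11 = \<eta> I2 + uscale \<i> (\<eta> I1)"
definition w22 :: ualg where "w22 = \<eta> I2 - uscale \<i> (\<eta> I1)"
definition w12 :: ualg where "w12 = - \<eta> I4 + uscale \<i> (\<eta> I3)"
definition w21 :: ualg where "w21 = \<eta> I4 + uscale \<i> (\<eta> I3)"

abbreviation "x1 \<equiv> pv X1"
abbreviation "x2 \<equiv> pv X2"
abbreviation "y1 \<equiv> pv Y1"
abbreviation "y2 \<equiv> pv Y2"

end

theory Submission
  imports Defs
begin

text \<open>
  Ordering words by the Poincare-Birkhoff-Witt argument for the Heisenberg-Clifford algebra
  $\mathfrak g_{<0}$ shows that $\mathrm{Ind}(F)$ is free over $U(\mathfrak g_{<0})$ in low degrees, so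
  vanishing in $\mathrm{Ind}(F)$ can be tested on coefficients in \<open>F\<close>. A vector of degree 2 is
  $\Theta\otimes c + A + B$ with $A$ in $S^2V_x\otimes F$ and $B$ in $S^2V_y\otimes F$, where $V_x, V_y$ are the
  standard modules of the two copies of $\mathfrak{sl}_2$. The elements $t w_{ij} + w_{ij}^*$ and
  $t w_{ij} - w_{ij}^*$ of $\mathfrak g_1$ bracket $\mathfrak g_{-1}$ into $\mathfrak{sl}_2^y$, respectively $\mathfrak{sl}_2^x$, plus
  scalars. Hence annihilation by $\mathfrak g_1$ forces $A$ to be $\mathfrak{sl}_2^y$-invariant with
  $\mu_t + \mu_C = 2$ unless $A = 0$, and $B$ to be $\mathfrak{sl}_2^x$-invariant with $\mu_t - \mu_C = 2$ unless $B = 0$;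
  not both survive, so $c = 0$. What remains are equations for highest weight vectors in
  $S^2V\otimes S^mV$: the top component gives (a) and (b), the bottom one (c) and (d), and the
  middle one is impossible. The component $\mathfrak g_2$ is spanned by brackets of $\mathfrak g_1$, and higher components
  kill degree 2 for degree reasons.
\<close>

text \<open>U(g) and Ind(F) are given by generators and relations. Identities in them follow from
  the relations, but independence has to be seen in a concrete module: words over a basis of g_{<0}
  with coefficients in F, modulo the commutation relations of letters. In low degrees these
  relations satisfy a few linear conditions on coefficients, and that suffices. As an so(4)-module
  g_{-1} is V_x \<otimes> V_y, and \<Lambda>^2(V_x \<otimes> V_y) = S^2V_x + S^2V_y; this is the
  origin of A and B. Each half imposes two kinds of equations. Invariance under the other copy of
  sl_2 makes one of \<mu>_t + \<mu>_C, \<mu>_t - \<mu>_C equal to 2; the highest weight equations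
  for its own copy make the remaining one equal to -m (top component) or m + 2 (bottom component),
  with n in place of m for B. Solving these two linear equations yields the weights of the four
  families. The coefficient c links the halves: it is the right-hand side of both systems, and a
  half that vanishes forces c = 0.\<close>

lemma pm_expand: "v = (\<Sum>a\<in>keys v. lookup v a \<cdot> bas a)"
proof (rule poly_mapping_eqI)
  fix k
  have "lookup v a * (if a = k then 1 else 0) = (if a = k then lookup v k else 0)" for a by simp
  then show "lookup v k = lookup (\<Sum>a\<in>keys v. lookup v a \<cdot> bas a) k"
    by (simp add: lookup_sum lookup_single when_def in_keys_iff)
qed

lemma pm_induct [case_names zero add scale basis]:
  assumes "P 0" "\<And>v w. P v \<Longrightarrow> P w \<Longrightarrow> P (v + w)" "\<And>c v. P v \<Longrightarrow> P (c \<cdot> v)" "\<And>a. P (bas a)"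
  shows "P v"
proof -
  have "P (\<Sum>a\<in>A. lookup v a \<cdot> bas a)" if "finite A" for A
    using that by (induction A rule: finite_induct) (auto intro: assms)
  then show ?thesis by (subst pm_expand) simp
qed

lemma lin_ext_fun_zero: "lin_ext (\<lambda>a. 0) v = 0"
  by (simp add: lin_ext_def)

lemma lin_ext_fun_add: "lin_ext (\<lambda>a. \<phi> a + \<psi> a) v = lin_ext \<phi> v + lin_ext \<psi> v"
  by (simp add: lin_ext_def cs.scale_right_distrib sum.distrib)

lemma lin_ext_fun_scale: "lin_ext (\<lambda>a. c \<cdot> \<phi> a) v = c \<cdot> lin_ext \<phi> v"
  by (simp add: lin_ext_def cs.scale_sum_right mult.commute)

lemma lin_ext_uminus: "lin_ext \<phi> (- v) = - lin_ext \<phi> v"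
  using lin_ext_diff[of \<phi> 0 v] by simp

lemma lin_ext_sum: "lin_ext \<phi> (\<Sum>a\<in>A. f a) = (\<Sum>a\<in>A. lin_ext \<phi> (f a))"
  by (induction A rule: infinite_finite_induct) (auto simp: lin_ext_add)

lemma bilin_ext_lin_ext: "bilin_ext \<beta> v w = lin_ext (\<lambda>a. lin_ext (\<beta> a) w) v"
  by (simp add: bilin_ext_def lin_ext_def cs.scale_sum_right)

lemma bilin_ext_bas: "bilin_ext \<beta> (bas a) (bas b) = \<beta> a b"
  by (simp add: bilin_ext_lin_ext)

lemma bilin_ext_linear:
  "bilin_ext \<beta> (v + v') w = bilin_ext \<beta> v w + bilin_ext \<beta> v' w"
  "bilin_ext \<beta> v (w + w') = bilin_ext \<beta> v w + bilin_ext \<beta> v w'"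
  "bilin_ext \<beta> (c \<cdot> v) w = c \<cdot> bilin_ext \<beta> v w"
  "bilin_ext \<beta> v (c \<cdot> w) = c \<cdot> bilin_ext \<beta> v w"
  "bilin_ext \<beta> 0 w = 0" "bilin_ext \<beta> v 0 = 0"
  by (simp_all add: bilin_ext_lin_ext lin_ext_add lin_ext_scale lin_ext_fun_add lin_ext_fun_scale
      lin_ext_fun_zero)

lemma bilin_ext_diff:
  "bilin_ext \<beta> (v - v') w = bilin_ext \<beta> v w - bilin_ext \<beta> v' w"
  "bilin_ext \<beta> v (w - w') = bilin_ext \<beta> v w - bilin_ext \<beta> v w'"
  by (simp_all add: eq_diff_eq bilin_ext_linear(1,2)[symmetric])

lemma cscale_minus_one: "(- 1) \<cdot> v = - v"
  by (rule poly_mapping_eqI) simp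

lemma cscale_two: "2 \<cdot> v = v + v" "(c * 2) \<cdot> v = c \<cdot> v + c \<cdot> v"
  by (rule poly_mapping_eqI, simp add: lookup_add algebra_simps)+

lemma bas_neq_zero [simp]: "bas a \<noteq> 0"
  by (metis lookup_single_eq lookup_zero zero_neq_one)

section \<open>Grassmann calculus\<close>

text \<open>The sign both of multiplying \<xi>_S by \<xi>_i from the left and of differentiating it
  by \<xi>_i: in either case \<xi>_i passes exactly the smaller indices.\<close>

definition sg :: "ix \<Rightarrow> ix set \<Rightarrow> complex" where
  "sg i S = (- 1) ^ card {j \<in> S. j < i}"

text \<open>The sign that sorts the product \<xi>_S \<xi>_T, given by its number of
  inversions.\<close>

definition eps :: "ix set \<Rightarrow> ix set \<Rightarrow> complex" where
  "eps S T = (- 1) ^ card {(i, j). i \<in> S \<and> j \<in> T \<and> j < i}"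

text \<open>The operator 2 - E of the contact bracket, with E the Euler field of the odd variables;
  it is 2 - |S| on monomials with support S.\<close>

definition euler :: "kalg \<Rightarrow> kalg" where
  "euler f = 2 \<cdot> f - (\<Sum>i\<in>UNIV. kmul (xi i) (d_xi i f))"

lemma neg_one_sq: "(- 1 :: complex) ^ k * (- 1) ^ k = 1"
  by (simp add: power_mult_distrib[symmetric])

lemma sg_sq [simp]: "sg i S * sg i S = 1" "sg i S * (sg i S * z) = z"
proof -
  show "sg i S * sg i S = 1" by (simp add: sg_def neg_one_sq)
  then show "sg i S * (sg i S * z) = z" by (simp add: mult.assoc[symmetric])
qed

lemma sg_insert: "j \<notin> S \<Longrightarrow> sg i (insert j S) = (if j < i then - sg i S else sg i S)"
proof -
  assume "j \<notin> S"
  moreover have "{k \<in> insert j S. k < i} = (if j < i then insert j {k \<in> S. k < i} else {k \<in> S. k < i})"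
    by auto
  ultimately show ?thesis by (auto simp: sg_def)
qed

lemma sg_remove: "j \<in> S \<Longrightarrow> sg i (S - {j}) = (if j < i then - sg i S else sg i S)"
  using sg_insert[of j "S - {j}" i] by (auto simp: insert_absorb)

lemma sg_Un: "S \<inter> T = {} \<Longrightarrow> sg i (S \<union> T) = sg i S * sg i T"
proof -
  assume "S \<inter> T = {}"
  have "{j \<in> S \<union> T. j < i} = {j \<in> S. j < i} \<union> {j \<in> T. j < i}" by auto
  moreover have "{j \<in> S. j < i} \<inter> {j \<in> T. j < i} = {}" using \<open>S \<inter> T = {}\<close> by auto
  ultimately have "card {j \<in> S \<union> T. j < i} = card {j \<in> S. j < i} + card {j \<in> T. j < i}"
    by (simp add: card_Un_disjoint)
  then show ?thesis by (simp add: sg_def power_add)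
qed

lemma eps_insert_left: "i \<notin> S \<Longrightarrow> eps (insert i S) T = sg i T * eps S T"
proof -
  assume i: "i \<notin> S"
  let ?C = "{(k, j). k \<in> S \<and> j \<in> T \<and> j < k}" and ?B = "{j \<in> T. j < i}"
  have "{(k, j). k \<in> insert i S \<and> j \<in> T \<and> j < k} = Pair i ` ?B \<union> ?C" by auto
  moreover have "Pair i ` ?B \<inter> ?C = {}"
    using i by auto
  moreover have "card (Pair i ` ?B) = card ?B"
    by (rule card_image) (auto simp: inj_on_def)
  ultimately have "card {(k, j). k \<in> insert i S \<and> j \<in> T \<and> j < k} = card ?B + card ?C"
    by (simp only: card_Un_disjoint[OF finite finite])
  then show ?thesis
    by (simp only: eps_def sg_def power_add)
qed

text \<open>The new inversions come from the elements of S above i, whereas \<open>sg\<close> counts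
  those below; since i is not in S the two counts add up to \<open>card S\<close>.\<close>

lemma eps_insert_right: "i \<notin> T \<Longrightarrow> i \<notin> S \<Longrightarrow> eps S (insert i T) = (- 1) ^ card S * sg i S * eps S T"
proof -
  assume i: "i \<notin> T" "i \<notin> S"
  let ?A = "{j \<in> S. i < j}" and ?B = "{j \<in> S. j < i}" and ?C = "{(k, j). k \<in> S \<and> j \<in> T \<and> j < k}"
  have "{(k, j). k \<in> S \<and> j \<in> insert i T \<and> j < k} = (\<lambda>k. (k, i)) ` ?A \<union> ?C" by auto
  moreover have "(\<lambda>k. (k, i)) ` ?A \<inter> ?C = {}"
    using i by auto
  moreover have "card ((\<lambda>k. (k, i)) ` ?A) = card ?A"
    by (rule card_image) (auto simp: inj_on_def)
  ultimately have "card {(k, j). k \<in> S \<and> j \<in> insert i T \<and> j < k} = card ?A + card ?C"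
    by (simp only: card_Un_disjoint[OF finite finite])
  then have e: "eps S (insert i T) = (- 1) ^ card ?A * eps S T"
    by (simp only: eps_def power_add)
  have "x < i \<or> i < x" if "x \<in> S" for x using i that by (metis neqE)
  then have "S = ?A \<union> ?B" by auto
  moreover have "?A \<inter> ?B = {}" by auto
  ultimately have "card S = card ?A + card ?B"
    using card_Un_disjoint[of ?A ?B] by (metis finite)
  then have "(- 1) ^ card S * sg i S = ((- 1) ^ card ?A :: complex)"
    by (simp only: power_add sg_def mult.assoc neg_one_sq mult_1_right)
  with e show ?thesis by simp
qed

lemma eps_empty [simp]: "eps {} T = 1" "eps S {} = 1"
  by (simp_all add: eps_def)

lemma kmul_bas: "kmul (bas (m, S)) (bas (n, T)) = (if S \<inter> T = {} then eps S T \<cdot> bas (m + n, S \<union> T) else 0)"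
  by (simp add: kmul_def bilin_ext_bas eps_def)

lemma xi_bas: "kmul (xi i) (bas (m, S)) = (if i \<in> S then 0 else sg i S \<cdot> bas (m, insert i S))"
  using eps_insert_left[of i "{}" S] by (simp add: xi_def kmul_bas)

lemma d_xi_bas: "d_xi i (bas (m, S)) = (if i \<in> S then sg i S \<cdot> bas (m, S - {i}) else 0)"
  by (simp add: d_xi_def sg_def)

lemma d_t_bas: "d_t (bas (m, S)) = of_nat m \<cdot> bas (m - 1, S)"
  by (simp add: d_t_def)

lemma parity_inv_bas: "parity_inv (bas (m, S)) = (- 1) ^ card S \<cdot> bas (m, S)"
  by (simp add: parity_inv_def)

lemma kmul_linear:
  "kmul (v + v') w = kmul v w + kmul v' w"
  "kmul v (w + w') = kmul v w + kmul v w'"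
  "kmul (c \<cdot> v) w = c \<cdot> kmul v w"
  "kmul v (c \<cdot> w) = c \<cdot> kmul v w"
  "kmul 0 w = 0" "kmul v 0 = 0"
  "kmul (v - v') w = kmul v w - kmul v' w"
  "kmul v (w - w') = kmul v w - kmul v w'"
  by (simp_all only: kmul_def bilin_ext_linear bilin_ext_diff)

lemma kmul_uminus: "kmul (- v) w = - kmul v w" "kmul v (- w) = - kmul v w"
  using kmul_linear(7)[of 0 v w] kmul_linear(8)[of v 0 w] by (simp_all add: kmul_linear)

lemma kmul_sum: "kmul (\<Sum>a\<in>A. f a) w = (\<Sum>a\<in>A. kmul (f a) w)" "kmul v (\<Sum>a\<in>A. f a) = (\<Sum>a\<in>A. kmul v (f a))"
  by (induction A rule: infinite_finite_induct) (auto simp: kmul_linear)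

lemma unary_linear:
  "d_xi i (v + w) = d_xi i v + d_xi i w" "d_xi i (c \<cdot> v) = c \<cdot> d_xi i v" "d_xi i 0 = 0"
  "d_xi i (v - w) = d_xi i v - d_xi i w" "d_xi i (- v) = - d_xi i v"
  "d_xi i (\<Sum>a\<in>A. f a) = (\<Sum>a\<in>A. d_xi i (f a))"
  "d_t (v + w) = d_t v + d_t w" "d_t (c \<cdot> v) = c \<cdot> d_t v" "d_t 0 = 0"
  "d_t (v - w) = d_t v - d_t w" "d_t (- v) = - d_t v"
  "d_t (\<Sum>a\<in>A. f a) = (\<Sum>a\<in>A. d_t (f a))"
  "parity_inv (v + w) = parity_inv v + parity_inv w" "parity_inv (c \<cdot> v) = c \<cdot> parity_inv v"
  "parity_inv 0 = 0" "parity_inv (v - w) = parity_inv v - parity_inv w"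
  "parity_inv (- v) = - parity_inv v"
  "parity_inv (\<Sum>a\<in>A. f a) = (\<Sum>a\<in>A. parity_inv (f a))"
  by (simp_all add: d_xi_def d_t_def parity_inv_def lin_ext_add lin_ext_scale lin_ext_diff
      lin_ext_uminus lin_ext_sum)

lemma euler_linear:
  "euler (v + w) = euler v + euler w" "euler (c \<cdot> v) = c \<cdot> euler v" "euler 0 = 0"
  "euler (v - w) = euler v - euler w" "euler (- v) = - euler v"
proof -
  show a: "euler (v + w) = euler v + euler w" for v w
    by (simp add: euler_def unary_linear kmul_linear sum.distrib cs.scale_right_distrib)
  show s: "euler (c \<cdot> v) = c \<cdot> euler v" for c v
    by (simp add: euler_def unary_linear kmul_linear cs.scale_sum_right[symmetric]
        cs.scale_right_diff_distrib mult.commute)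
  show "euler 0 = 0" by (simp add: euler_def unary_linear kmul_linear)
  show "euler (v - w) = euler v - euler w" using a[of "v - w" w] by simp
  show "euler (- v) = - euler v" using s[of "- 1" v] by (simp add: cscale_minus_one)
qed

lemmas k_lin = kmul_linear kmul_uminus unary_linear euler_linear

lemma euler_bas: "euler (bas (m, S)) = (2 - of_nat (card S)) \<cdot> bas (m, S)"
proof -
  have "kmul (xi i) (d_xi i (bas (m, S))) = (if i \<in> S then bas (m, S) else 0)" for i
    by (auto simp: d_xi_bas k_lin xi_bas sg_remove insert_absorb)
  then have "(\<Sum>i\<in>UNIV. kmul (xi i) (d_xi i (bas (m, S)))) = of_nat (card S) \<cdot> bas (m, S)"
    by (intro poly_mapping_eqI) (simp add: lookup_sum if_distrib[of "\<lambda>f. lookup f _"] sum.If_cases)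
  then show ?thesis by (simp add: euler_def cs.scale_left_diff_distrib)
qed

text \<open>On monomials the two sides carry the signs \<open>sg i S * eps (insert i S) T\<close>
  and \<open>eps S T * sg i (S \<union> T)\<close>, which agree by \<open>eps_insert_left\<close>
  and \<open>sg_Un\<close>.\<close>

lemma xi_kmul: "kmul (kmul (xi i) f) g = kmul (xi i) (kmul f g)"
proof (induction f rule: pm_induct)
  case (basis a)
  obtain m S where a: "a = (m, S)" by force
  show ?case
  proof (induction g rule: pm_induct)
    case (basis b)
    obtain n T where b: "b = (n, T)" by force
    show ?case
      by (auto simp: a b xi_bas kmul_bas k_lin eps_insert_left sg_Un mult.commute)
  qed (simp_all add: k_lin)
qed (simp_all add: k_lin)

text \<open>Moving \<xi>_i to the left past f costs the parity of f, which \<open>parity_inv\<close>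
  has put in beforehand. Phrasing sign rules through \<open>parity_inv\<close> makes them linear,
  hence valid for f of mixed parity.\<close>

lemma kmul_xi: "kmul (parity_inv f) (kmul (xi i) g) = kmul (xi i) (kmul f g)"
proof (induction f rule: pm_induct)
  case (basis a)
  obtain m S where a: "a = (m, S)" by force
  show ?case
  proof (induction g rule: pm_induct)
    case (basis b)
    obtain n T where b: "b = (n, T)" by force
    have "(- 1 :: complex) ^ card S * ((- 1) ^ card S * z) = z" for z
      by (simp add: mult.assoc[symmetric] neg_one_sq)
    then show ?case
      by (auto simp: a b xi_bas kmul_bas k_lin parity_inv_bas eps_insert_right sg_Un mult_ac)
  qed (simp_all add: k_lin)
qed (simp_all add: k_lin)

text \<open>For distinct i and j exactly one of the signs \<open>sg i\<close> and
  \<open>sg j\<close> changes when the other index is inserted or removed, hence the minus. Which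
  one changes depends on the order of i and j, hence the case split.\<close>

lemma d_xi_xi: "d_xi j (kmul (xi i) f) = (if i = j then f else 0) - kmul (xi i) (d_xi j f)"
proof (induction f rule: pm_induct)
  case (basis a)
  obtain m S where a: "a = (m, S)" by force
  consider "i = j" | "i < j" | "j < i" by force
  then show ?case
    by cases (auto simp: a xi_bas d_xi_bas k_lin sg_insert sg_remove insert_absorb mult.commute insert_Diff_if)
qed (auto simp add: k_lin cs.scale_right_diff_distrib)

lemma d_xi_d_xi: "d_xi i (d_xi j f) = - d_xi j (d_xi i f)"
proof (induction f rule: pm_induct)
  case (basis a)
  obtain m S where a: "a = (m, S)" by force
  consider "i = j" | "i < j" | "j < i" by force
  then show ?case
    by cases (auto simp: a d_xi_bas k_lin sg_remove mult.commute insert_commute Diff_insert[symmetric])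
qed (simp_all add: k_lin)

lemma parity_rules:
  "parity_inv (parity_inv f) = f"
  "parity_inv (kmul (xi i) f) = - kmul (xi i) (parity_inv f)"
  "parity_inv (d_xi i f) = - d_xi i (parity_inv f)"
  "parity_inv (d_t f) = d_t (parity_inv f)"
  "parity_inv (euler f) = euler (parity_inv f)"
proof -
  have [simp]: "(- 1 :: complex) ^ card S * ((- 1) ^ card S * z) = z" for z and S :: "ix set"
    by (simp add: mult.assoc[symmetric] neg_one_sq)
  have *: "- ((- 1 :: complex) ^ (card S - Suc 0)) = (- 1) ^ card S" if "i \<in> S" for S and i :: ix
    using that by (cases "card S") auto
  show "parity_inv (parity_inv f) = f"
    by (induction f rule: pm_induct) (auto simp: k_lin parity_inv_bas split_paired_all neg_one_sq)
  show "parity_inv (kmul (xi i) f) = - kmul (xi i) (parity_inv f)"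
  proof (induction f rule: pm_induct)
    case (basis a) then show ?case by (cases a) (auto simp: k_lin parity_inv_bas xi_bas mult.commute)
  qed (simp_all add: k_lin)
  show "parity_inv (d_xi i f) = - d_xi i (parity_inv f)"
  proof (induction f rule: pm_induct)
    case (basis a) then show ?case
      by (cases a) (auto simp: k_lin parity_inv_bas d_xi_bas mult.commute *[symmetric])
  qed (simp_all add: k_lin)
  show "parity_inv (d_t f) = d_t (parity_inv f)"
  proof (induction f rule: pm_induct)
    case (basis a) then show ?case by (cases a) (auto simp: k_lin parity_inv_bas d_t_bas mult.commute)
  qed (simp_all add: k_lin)
  show "parity_inv (euler f) = euler (parity_inv f)"
  proof (induction f rule: pm_induct)
    case (basis a) then show ?case by (cases a) (auto simp: k_lin parity_inv_bas euler_bas mult.commute)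
  qed (simp_all add: k_lin)
qed

lemma d_t_rules:
  "d_t (kmul (xi i) f) = kmul (xi i) (d_t f)"
  "d_t (d_xi i f) = d_xi i (d_t f)"
  "d_t (euler f) = euler (d_t f)"
proof -
  show "d_t (kmul (xi i) f) = kmul (xi i) (d_t f)"
  proof (induction f rule: pm_induct)
    case (basis a) then show ?case by (cases a) (auto simp: k_lin d_t_bas xi_bas mult.commute)
  qed (simp_all add: k_lin)
  show "d_t (d_xi i f) = d_xi i (d_t f)"
  proof (induction f rule: pm_induct)
    case (basis a) then show ?case by (cases a) (auto simp: k_lin d_t_bas d_xi_bas mult.commute)
  qed (simp_all add: k_lin)
  show "d_t (euler f) = euler (d_t f)"
  proof (induction f rule: pm_induct)
    case (basis a) then show ?case by (cases a) (auto simp: k_lin d_t_bas euler_bas mult.commute)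
  qed (simp_all add: k_lin)
qed

lemma euler_rules:
  "euler (kmul (xi i) f) = kmul (xi i) (euler f) - kmul (xi i) f"
  "euler (d_xi i f) = d_xi i (euler f) + d_xi i f"
proof -
  show "euler (kmul (xi i) f) = kmul (xi i) (euler f) - kmul (xi i) f"
  proof (induction f rule: pm_induct)
    case (basis a) then show ?case
      by (cases a) (auto simp: k_lin euler_bas xi_bas cs.scale_left_diff_distrib cs.scale_left_distrib cscale_two algebra_simps)
  next
    case (scale c v) then show ?case by (simp add: k_lin cs.scale_right_diff_distrib)
  qed (simp_all add: k_lin algebra_simps)
  have card: "complex_of_nat (card S - Suc 0) = of_nat (card S) - 1" if "i \<in> S" for S
    using that by (cases "card S") auto
  show "euler (d_xi i f) = d_xi i (euler f) + d_xi i f"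
  proof (induction f rule: pm_induct)
    case (basis a)
    obtain m S where a: "a = (m, S)" by force
    have "(sg i S * (3 - of_nat (card S))) \<cdot> v = (sg i S * (2 - of_nat (card S))) \<cdot> v + sg i S \<cdot> v" for v :: kalg
      by (simp add: cs.scale_left_distrib[symmetric] algebra_simps)
    then show ?case
      by (simp add: a k_lin euler_bas d_xi_bas card mult.commute)
  qed (simp_all add: k_lin algebra_simps)
qed

lemma d_t_kmul: "d_t (kmul f g) = kmul (d_t f) g + kmul f (d_t g)"
proof (induction f rule: pm_induct)
  case (basis a)
  obtain m S where a: "a = (m, S)" by force
  show ?case
  proof (induction g rule: pm_induct)
    case (basis b)
    obtain n T where b: "b = (n, T)" by force
    show ?case
      by (cases m; cases n) (auto simp: a b kmul_bas k_lin d_t_bas cs.scale_left_distrib cscale_two algebra_simps)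
  qed (simp_all add: k_lin algebra_simps)
qed (simp_all add: k_lin algebra_simps)

text \<open>E is a derivation, 2 - E is not: the constant 2 is counted twice in the first two terms
  on the right.\<close>

lemma euler_kmul: "euler (kmul f g) = kmul (euler f) g + kmul f (euler g) - 2 \<cdot> kmul f g"
proof (induction f rule: pm_induct)
  case (basis a)
  obtain m S where a: "a = (m, S)" by force
  show ?case
  proof (induction g rule: pm_induct)
    case (basis b)
    obtain n T where b: "b = (n, T)" by force
    show ?case
      by (auto simp: a b kmul_bas k_lin euler_bas card_Un_disjoint algebra_simps intro!: poly_mapping_eqI
          simp: lookup_add lookup_minus)
  next
    case (scale c v) then show ?case
      by (simp add: k_lin cs.scale_right_diff_distrib cs.scale_right_distrib mult.commute)
  qed (simp_all add: k_lin cscale_two algebra_simps)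
next
  case (scale c v) then show ?case
    by (simp add: k_lin cs.scale_right_diff_distrib cs.scale_right_distrib mult.commute)
qed (simp_all add: k_lin cscale_two algebra_simps)

text \<open>Used to reduce the Leibniz rule for \<partial>_i to a first factor annihilated by
  \<partial>_i.\<close>

lemma bas_split:
  obtains "d_xi i (bas (m, S)) = 0"
  | c T where "d_xi i (bas (m, T)) = 0" "bas (m, S) = c \<cdot> kmul (xi i) (bas (m, T))"
proof (cases "i \<in> S")
  case False
  then show ?thesis using that(1) by (simp add: d_xi_bas)
next
  case True
  then have "bas (m, S) = sg i S \<cdot> kmul (xi i) (bas (m, S - {i}))"
    by (simp add: xi_bas sg_remove insert_absorb)
  then show ?thesis using that(2)[of "S - {i}" "sg i S"] by (simp add: d_xi_bas)
qed

text \<open>Split both factors according to whether they contain \<xi>_i. What is left is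
  \<open>d_xi_xi\<close> and the passage of \<xi>_i through the first factor.\<close>

lemma d_xi_kmul: "d_xi i (kmul f g) = kmul (d_xi i f) g + kmul (parity_inv f) (d_xi i g)"
proof -
  have 0: "kmul (parity_inv (bas (m, S))) (d_xi i g) = d_xi i (kmul (bas (m, S)) g)"
    if S: "d_xi i (bas (m, S)) = 0" for m S g
  proof (induction g rule: pm_induct)
    case (basis b)
    obtain n T where b: "b = (n, T)" by force
    have S': "i \<notin> S"
      using S neg_one_sq[of "card {j \<in> S. j < i}"] by (auto simp: d_xi_bas sg_def split: if_splits)
    have dd: "d_xi i (kmul (bas (m, S)) (bas (n, T))) = 0" if "i \<notin> T" for T
      using S' that by (simp add: kmul_bas k_lin d_xi_bas)
    have P: "kmul (bas (m, S)) (kmul (xi i) g) = kmul (xi i) (kmul (parity_inv (bas (m, S))) g)" for g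
      using kmul_xi[of "parity_inv (bas (m, S))" i g] by (simp add: parity_rules)
    show ?case
    proof (cases "i \<in> T")
      case False
      then show ?thesis using dd by (simp add: b d_xi_bas k_lin)
    next
      case True
      then have T: "bas (n, T) = sg i T \<cdot> kmul (xi i) (bas (n, T - {i}))"
        by (simp add: xi_bas sg_remove insert_absorb)
      have z: "d_xi i (bas (n, T - {i})) = 0" by (simp add: d_xi_bas)
      show ?thesis
        by (simp add: b T k_lin P d_xi_xi z) (simp add: parity_inv_bas k_lin dd)
    qed
  qed (simp_all add: k_lin)
  show ?thesis
  proof (induction f rule: pm_induct)
    case (basis a)
    obtain m S where a: "a = (m, S)" by force
    show ?case
    proof (cases rule: bas_split[of i m S])
      case 1
      then show ?thesis by (simp add: a k_lin 0)
    next
      case (2 c T)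
      have "d_xi i (kmul (kmul (xi i) (bas (m, T))) g) =
          kmul (bas (m, T)) g - kmul (xi i) (kmul (parity_inv (bas (m, T))) (d_xi i g))"
        using 2(1) by (simp add: xi_kmul d_xi_xi 0)
      then show ?thesis
        using 2(1) by (simp add: a 2(2) k_lin d_xi_xi parity_rules xi_kmul cs.scale_right_diff_distrib)
    qed
  qed (simp_all add: k_lin algebra_simps)
qed

section \<open>The Jacobi identity with one entry of negative degree\<close>

text \<open>The operator ad \<xi>_i, as \<open>k_bracket_xi\<close> shows.\<close>

definition kD :: "ix \<Rightarrow> kalg \<Rightarrow> kalg" where
  "kD i f = kmul (xi i) (d_t f) - d_xi i f"

text \<open>The Berezin integral over the odd variables, evaluated at t = 0.\<close>

definition ber :: "kalg \<Rightarrow> complex" where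
  "ber f = lookup f (0, UNIV)"

lemma k_bracket_eq: "k_bracket f g =
    kmul (euler f) (d_t g) - kmul (d_t f) (euler g) + (\<Sum>i\<in>UNIV. kmul (d_xi i (parity_inv f)) (d_xi i g))"
  by (simp add: k_bracket_def euler_def)

lemma k_bracket_linear:
  "k_bracket (f + f') g = k_bracket f g + k_bracket f' g"
  "k_bracket f (g + g') = k_bracket f g + k_bracket f g'"
  "k_bracket (c \<cdot> f) g = c \<cdot> k_bracket f g"
  "k_bracket f (c \<cdot> g) = c \<cdot> k_bracket f g"
  "k_bracket 0 g = 0" "k_bracket f 0 = 0"
  by (simp_all add: k_bracket_eq k_lin sum.distrib cs.scale_right_diff_distrib cs.scale_right_distrib
      cs.scale_sum_right)

lemma kmul_one: "kmul (bas (0, {})) f = f" "kmul f (bas (0, {})) = f"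
  by (induction f rule: pm_induct) (auto simp: k_lin kmul_bas split_paired_all)

lemma sg_empty [simp]: "sg i {} = 1"
  by (simp add: sg_def)

lemma xi_facts:
  "euler (xi i) = xi i" "d_t (xi i) = 0" "parity_inv (xi i) = - xi i"
  "d_xi j (xi i) = (if i = j then bas (0, {}) else 0)"
  by (auto simp: xi_def euler_bas d_t_bas parity_inv_bas d_xi_bas sg_insert cscale_minus_one)

lemma one_facts:
  "euler (bas (0, {})) = 2 \<cdot> bas (0, {})" "d_t (bas (0, {})) = 0"
  "parity_inv (bas (0, {})) = bas (0, {})" "d_xi j (bas (0, {})) = 0"
  by (simp_all add: euler_bas d_t_bas parity_inv_bas d_xi_bas)

lemma kmul_by_xi: "kmul f (xi i) = kmul (xi i) (parity_inv f)"
  using kmul_xi[of "parity_inv f" i "bas (0, {})"] by (simp add: kmul_one parity_rules)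

lemma k_bracket_xi: "k_bracket (xi i) g = kD i g"
proof -
  have "kmul (d_xi j (- xi i)) (d_xi j g) = (if i = j then - d_xi i g else 0)" for j
    by (simp add: k_lin xi_facts kmul_one)
  then show ?thesis by (simp add: k_bracket_eq kD_def xi_facts k_lin)
qed

lemma k_bracket_by_xi: "k_bracket f (xi i) = - kD i (parity_inv f)"
proof -
  have "kmul (d_xi j (parity_inv f)) (d_xi j (xi i)) = (if i = j then d_xi i (parity_inv f) else 0)" for j
    by (simp add: k_lin xi_facts kmul_one)
  then show ?thesis by (simp add: k_bracket_eq kD_def xi_facts k_lin kmul_by_xi parity_rules)
qed

lemma k_bracket_one: "k_bracket (bas (0, {})) g = 2 \<cdot> d_t g" "k_bracket g (bas (0, {})) = - (2 \<cdot> d_t g)"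
  by (simp_all add: k_bracket_eq one_facts k_lin kmul_one)

lemma kD_rules:
  "kD i (kmul f g) = kmul (kD i f) g + kmul (parity_inv f) (kD i g)"
  "d_t (kD i f) = kD i (d_t f)"
  "parity_inv (kD i f) = - kD i (parity_inv f)"
  "euler (kD i f) = kD i (euler f) - (kmul (xi i) (d_t f) + d_xi i f)"
  "d_xi j (kD i f) = (if i = j then d_t f else 0) - kD i (d_xi j f)"
proof -
  show "kD i (kmul f g) = kmul (kD i f) g + kmul (parity_inv f) (kD i g)"
    by (simp add: kD_def k_lin d_t_kmul d_xi_kmul xi_kmul kmul_xi algebra_simps)
qed (auto simp: kD_def k_lin d_t_rules parity_rules euler_rules d_xi_xi d_xi_d_xi[of j i] algebra_simps)

lemma kD_linear:
  "kD i (f + g) = kD i f + kD i g" "kD i (f - g) = kD i f - kD i g" "kD i (- f) = - kD i f" 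
  "kD i (\<Sum>a\<in>A. h a) = (\<Sum>a\<in>A. kD i (h a))" "kD i (c \<cdot> f) = c \<cdot> kD i f"
  by (simp_all add: kD_def k_lin kmul_sum sum_subtractf cs.scale_right_diff_distrib algebra_simps)

text \<open>
  Both identities hold because $\partial_t$ and $\xi_i\partial_t - \partial_i$ are (anti)derivations
  of the associative product; the defect of their commutation with \<^const>\<open>euler\<close> and
  \<^const>\<open>d_xi\<close> cancels.
\<close>

lemma k_jacobi_xi:
  "kD i (k_bracket f g) = k_bracket (kD i f) g + k_bracket (parity_inv f) (kD i g)"
proof -
  let ?S = "\<lambda>h. (\<Sum>j\<in>UNIV. h j) :: kalg"
  have d: "?S (\<lambda>j. if i = j then h j else 0) = h i" for h
    by simp
  have m: "kmul (if b then u else 0) v = (if b then kmul u v else 0)"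
    "kmul v (if b then u else 0) = (if b then kmul v u else 0)" for b u v
    by (simp_all add: k_lin)
  \<comment> \<open>The defects of \<open>euler\<close> on the two arguments each produce a term
    with \<xi>_i and two t-derivatives; they cancel once \<xi>_i is moved across f.\<close>
  have x: "kmul (kmul (xi i) (d_t f)) (d_t g) = kmul (d_t (parity_inv f)) (kmul (xi i) (d_t g))"
    using kmul_xi[of "d_t f" i "d_t g"] by (simp add: xi_kmul parity_rules)
  show ?thesis
    by (simp add: k_bracket_eq kD_rules kD_linear k_lin sum.distrib sum_subtractf sum_negf m d parity_rules x)
qed

lemma k_jacobi_one:
  "d_t (k_bracket f g) = k_bracket (d_t f) g + k_bracket f (d_t g)"
  by (simp add: k_bracket_eq k_lin d_t_kmul d_t_rules parity_rules sum.distrib algebra_simps)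

section \<open>The cocycle as a Berezin integral\<close>

lemma ber_linear:
  "ber (f + g) = ber f + ber g" "ber (f - g) = ber f - ber g" "ber (- f) = - ber f" "ber 0 = 0"
  "ber (c \<cdot> f) = c * ber f" "ber (\<Sum>a\<in>A. h a) = (\<Sum>a\<in>A. ber (h a))"
  by (simp_all add: ber_def lookup_add lookup_minus lookup_sum)

text \<open>A derivative by \<xi>_i has no term containing \<xi>_i, so the top monomial is absent.
  This is what permits integration by parts.\<close>

lemma ber_d_xi: "ber (d_xi i f) = 0"
proof (induction f rule: pm_induct)
  case (basis a)
  have "S - {i} \<noteq> UNIV" for S by auto
  then show ?case by (cases a) (auto simp: d_xi_bas ber_def lookup_single when_def)
qed (simp_all add: k_lin ber_linear)

lemma card_ix: "card (UNIV :: ix set) = 4"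
  by (simp add: UNIV_ix)

lemma ber_euler: "ber (euler f) = - 2 * ber f"
proof (induction f rule: pm_induct)
  case (basis a)
  show ?case by (cases a) (auto simp: euler_bas ber_def lookup_single when_def card_ix)
qed (simp_all add: k_lin ber_linear algebra_simps)

lemma UNIV_ix_eq: "S = UNIV \<longleftrightarrow> I1 \<in> S \<and> I2 \<in> S \<and> I3 \<in> S \<and> I4 \<in> S" for S :: "ix set"
  by (auto simp: UNIV_ix set_eq_iff) (metis ix.exhaust)+

lemma psi0_eq:
  "psi0 (m, S) (n, T) = (if m = 0 \<and> n = 0 \<and> T = - S then
     (if S = {} then - 2 else if card S = 1 then - sg (the_elem S) UNIV else 0) else 0)"
proof -
  have "UNIV \<noteq> - {i}" for i :: ix by auto
  moreover have "S = {} \<Longrightarrow> T = UNIV \<longleftrightarrow> T = - S" by auto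
  ultimately show ?thesis
    by (auto simp: card_1_singleton_iff sg_def)
qed

lemma ix_less: "I1 < I2" "I1 < I3" "I1 < I4" "I2 < I3" "I2 < I4" "I3 < I4"
    "\<not> I2 < I1" "\<not> I3 < I1" "\<not> I4 < I1" "\<not> I3 < I2" "\<not> I4 < I2" "\<not> I4 < I3"
  by (simp_all add: less_ix_def)

text \<open>The two prescribed families have |S| = 0 and 1, and skew-symmetry extends them to |S| =
  4 and 3. The factor 2 - |S| fits all four cases and vanishes for |S| = 2; the signs are checked on
  the sixteen subsets.\<close>

lemma psi_eq:
  "psi (m, S) (n, T) = (if m = 0 \<and> n = 0 \<and> T = - S then - (2 - of_nat (card S)) * eps S T else 0)"
proof (cases "m = 0 \<and> n = 0 \<and> T = - S")
  case False
  then show ?thesis by (auto simp: psi_def psi0_eq)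
next
  case True
  have "S \<in> Pow {I1, I2, I3, I4}" by (simp add: UNIV_ix[symmetric])
  then have "psi (0, S) (0, UNIV - S) = - (2 - of_nat (card S)) * eps S (UNIV - S)"
    unfolding psi_def psi0_eq UNIV_ix Compl_eq_Diff_UNIV
    by (simp add: Pow_insert)
      (elim disjE; simp add: insert_Diff_if sg_insert eps_insert_left ix_less eq_commute[of "{}"])
  with True show ?thesis by (simp add: Compl_eq_Diff_UNIV)
qed

lemma psi_ext_bilin: "psi_ext f g = lookup (bilin_ext (\<lambda>a b. psi a b \<cdot> bas ()) f g) ()"
  by (simp add: psi_ext_def bilin_ext_def lookup_sum)

lemma psi_ext_linear:
  "psi_ext (f + f') g = psi_ext f g + psi_ext f' g"
  "psi_ext f (g + g') = psi_ext f g + psi_ext f g'"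
  "psi_ext (c \<cdot> f) g = c * psi_ext f g" "psi_ext f (c \<cdot> g) = c * psi_ext f g"
  "psi_ext 0 g = 0" "psi_ext f 0 = 0"
  by (simp_all add: psi_ext_bilin bilin_ext_linear lookup_add)

lemma psi_ext_bas: "psi_ext (bas a) (bas b) = psi a b"
  by (simp add: psi_ext_bilin bilin_ext_bas)

text \<open>In \<open>psi_eq\<close> the factor 2 - |S| is the eigenvalue of \<open>euler\<close>
  and \<open>eps\<close> the sign of the product. With the cocycle written as an integral, its
  Jacobi identity becomes integration by parts.\<close>

lemma psi_ext_eq: "psi_ext f g = - ber (kmul (euler f) g)"
proof (induction f rule: pm_induct)
  case (basis a)
  obtain m S where a: "a = (m, S)" by force
  show ?case
  proof (induction g rule: pm_induct)
    case (basis b)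
    obtain n T where b: "b = (n, T)" by force
    have T: "T = - S \<longleftrightarrow> S \<inter> T = {} \<and> S \<union> T = UNIV" by auto
    have "ber (kmul (euler (bas (m, S))) (bas (n, T))) =
        (if m = 0 \<and> n = 0 \<and> T = - S then (2 - of_nat (card S)) * eps S T else 0)"
      unfolding T by (simp add: euler_bas k_lin kmul_bas ber_linear)
        (auto simp: ber_def lookup_single when_def)
    then show ?case by (simp add: a b psi_ext_bas psi_eq left_diff_distrib)
  qed (simp_all add: psi_ext_linear k_lin ber_linear)
qed (simp_all add: psi_ext_linear k_lin ber_linear)

lemma d_xi_sq: "d_xi i (d_xi i f) = 0"
proof (rule poly_mapping_eqI)
  fix k
  have "lookup (d_xi i (d_xi i f)) k = - lookup (d_xi i (d_xi i f)) k"
    by (metis d_xi_d_xi lookup_uminus)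
  then show "lookup (d_xi i (d_xi i f)) k = lookup 0 k" by simp
qed

text \<open>The C-component of the Jacobi identity for \<xi>_i, f, g. Under the integral with the
  extra factor \<xi>_i, the sum over j collapses to j = i.\<close>

lemma psi_jacobi_xi:
  "psi_ext (xi i) (k_bracket f g) = psi_ext (kD i f) g + psi_ext (parity_inv f) (kD i g)"
proof -
  \<comment> \<open>integration by parts\<close>
  have parts: "ber (kmul (xi i) (kmul (d_xi j (parity_inv f)) (d_xi j g))) =
      (if i = j then - ber (kmul (d_xi i f) g) else 0)" for j
    using ber_d_xi[of j "kmul (xi i) (kmul (d_xi j f) g)", unfolded d_xi_xi]
    by (auto simp: d_xi_kmul d_xi_sq k_lin parity_rules ber_linear eq_neg_iff_add_eq_0 add.commute
        split: if_splits)
  \<comment> \<open>Under the integral \<open>euler\<close> is multiplication by -2; commuting it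
    past \<xi>_i changes this to -1.\<close>
  have E: "ber (kmul (xi i) (euler h)) = - ber (kmul (xi i) h)" for h
  proof -
    have "ber (kmul (xi i) h) + ber (kmul (xi i) (euler h)) = 0"
      using ber_euler[of "kmul (xi i) h"] by (simp add: euler_rules ber_linear)
    then show ?thesis by (simp only: add_eq_0_iff)
  qed
  have "ber (kmul (xi i) (kmul (euler (d_t f)) g)) + ber (kmul (xi i) (kmul (d_t f) (euler g))) =
      ber (kmul (xi i) (kmul (d_t f) g))"
    using E[of "kmul (d_t f) g"] by (simp add: euler_kmul k_lin ber_linear)
  moreover have "ber (kD i (kmul (euler f) g)) = ber (kmul (xi i) (d_t (kmul (euler f) g)))"
    by (simp add: kD_def ber_linear ber_d_xi)
  ultimately show ?thesis
    by (simp add: psi_ext_eq xi_facts kD_rules k_bracket_eq k_lin kmul_sum ber_linear parts parity_rules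
       d_t_kmul d_t_rules xi_kmul algebra_simps)
qed

text \<open>For the integral of products \<open>euler\<close> is skew-adjoint, because its value -2
  on the top monomial cancels the defect -2 in \<open>euler_kmul\<close>. The sum over j integrates
  to zero.\<close>

lemma psi_jacobi_one:
  "psi_ext (bas (0, {})) (k_bracket f g) = 2 * psi_ext (d_t f) g + 2 * psi_ext f (d_t g)"
proof -
  have parts: "ber (kmul (d_xi j (parity_inv f)) (d_xi j g)) = 0" for j
    using ber_d_xi[of j "kmul (d_xi j f) g"]
    by (simp add: d_xi_kmul d_xi_sq k_lin parity_rules ber_linear)
  have "ber (kmul (d_t f) (euler g)) = - ber (kmul (euler (d_t f)) g)"
    using ber_euler[of "kmul (d_t f) g"] by (simp add: euler_kmul k_lin ber_linear eq_neg_iff_add_eq_0 add.commute)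
  then show ?thesis
    by (simp add: psi_ext_eq one_facts k_bracket_eq k_lin kmul_one kmul_sum ber_linear parts
       d_t_kmul d_t_rules algebra_simps)
qed

section \<open>The brackets of \<open>g\<close>\<close>

lemma k_part_linear:
  "k_part (x + y) = k_part x + k_part y" "k_part (c \<cdot> x) = c \<cdot> k_part x" "k_part 0 = 0"
  by (simp_all add: k_part_def lin_ext_add lin_ext_scale)

lemma of_kalg_linear:
  "of_kalg (x + y) = of_kalg x + of_kalg y" "of_kalg (c \<cdot> x) = c \<cdot> of_kalg x" "of_kalg 0 = 0"
  "of_kalg (x - y) = of_kalg x - of_kalg y" "of_kalg (- x) = - of_kalg x"
  by (simp_all add: of_kalg_def lin_ext_add lin_ext_scale lin_ext_diff lin_ext_uminus)

lemma k_part_bas: "k_part (bas (Mon a)) = bas a" "k_part (bas Cen) = 0"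
  by (simp_all add: k_part_def)

lemma k_part_of_kalg: "k_part (of_kalg f) = f"
  by (induction f rule: pm_induct) (simp_all add: of_kalg_linear k_part_linear, simp add: of_kalg_def k_part_bas)

lemma g_bracket_linear:
  "g_bracket (x + x') y = g_bracket x y + g_bracket x' y"
  "g_bracket x (y + y') = g_bracket x y + g_bracket x y'"
  "g_bracket (c \<cdot> x) y = c \<cdot> g_bracket x y" "g_bracket x (c \<cdot> y) = c \<cdot> g_bracket x y"
  "g_bracket 0 y = 0" "g_bracket x 0 = 0"
  by (simp_all add: g_bracket_def k_part_linear of_kalg_linear k_bracket_linear psi_ext_linear
      cs.scale_left_distrib cs.scale_right_distrib algebra_simps)

text \<open>A basis of g_{<0}: \<open>Th\<close> stands for the element 1, whose image in U(g) is
  \<Theta>, and \<open>Et i\<close> for \<xi>_i. Elements of U(g_{<0}) will be represented by words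
  in these letters.\<close>

datatype neg = Th | Et ix

fun lt :: "neg \<Rightarrow> gbas" where
  "lt Th = Mon (0, {})"
| "lt (Et i) = Mon (0, {i})"

abbreviation br :: "gbas \<Rightarrow> gbas \<Rightarrow> galg" where
  "br a b \<equiv> g_bracket (bas a) (bas b)"

abbreviation ksgn :: "gbas \<Rightarrow> gbas \<Rightarrow> complex" where
  "ksgn a b \<equiv> (- 1) ^ (gpar a * gpar b)"

lemma power_mod_2: "(- 1 :: complex) ^ (n mod 2) = (- 1) ^ n"
  by (cases "even n") (simp_all add: odd_iff_mod_2_eq_one)

lemma ksgn_lt: "ksgn (lt (Et i)) (Mon a) = (- 1) ^ card (snd a)" "ksgn (lt Th) b = 1"
  by (cases a) (simp_all add: power_mod_2)

text \<open>The component in K(1,4)_+ is \<open>k_jacobi_one\<close> or \<open>k_jacobi_xi\<close>,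
  the component in C is \<open>psi_jacobi_one\<close> or \<open>psi_jacobi_xi\<close>.\<close>

lemma g_jacobi:
  "g_bracket (bas (lt y)) (br a b) = g_bracket (br (lt y) a) (bas b) + ksgn (lt y) a \<cdot> g_bracket (bas a) (br (lt y) b)"
proof (cases a)
  case Cen
  then show ?thesis by (simp add: g_bracket_def k_part_bas k_bracket_linear psi_ext_linear of_kalg_linear k_part_linear)
next
  case a: (Mon f)
  show ?thesis
  proof (cases b)
    case Cen
    then show ?thesis by (simp add: g_bracket_def k_part_bas k_bracket_linear psi_ext_linear of_kalg_linear k_part_linear)
  next
    case b: (Mon g)
    have P: "parity_inv (bas f) = (- 1) ^ card (snd f) \<cdot> bas f"
      by (cases f) (simp add: parity_inv_bas)
    show ?thesis
    proof (cases y)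
      case Th
      then show ?thesis
        by (simp add: a b g_bracket_def k_part_bas k_part_linear k_part_of_kalg k_bracket_one k_jacobi_one
            psi_jacobi_one k_bracket_linear of_kalg_linear psi_ext_linear cs.scale_right_distrib
            cs.scale_left_distrib algebra_simps)
    next
      case (Et i)
      show ?thesis
        unfolding a b Et ksgn_lt
        using k_jacobi_xi[of i "bas f" "bas g"] psi_jacobi_xi[of i "bas f" "bas g"]
        by (simp add: g_bracket_def k_part_bas k_part_linear k_part_of_kalg
            xi_def[symmetric] k_bracket_xi P k_bracket_linear of_kalg_linear psi_ext_linear cs.scale_right_distrib
            cs.scale_left_distrib algebra_simps)
    qed
  qed
qed

lemma g_skew: "br a (lt y) = - (ksgn (lt y) a \<cdot> br (lt y) a)"
proof (cases a)
  case Cen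
  then show ?thesis by (simp add: g_bracket_def k_part_bas k_bracket_linear psi_ext_linear of_kalg_linear k_part_linear)
next
  case a: (Mon f)
  obtain m S where f: "f = (m, S)" by force
  have "psi (m, S) (0, {}) = - psi (0, {}) (m, S)"
    "psi (m, S) (0, {i}) = - ((- 1) ^ card S * psi (0, {i}) (m, S))" for i
    using psi_skew[of "(m, S)" "(0, {})"] psi_skew[of "(m, S)" "(0, {i})"] by simp_all
  moreover have "parity_inv (bas f) = (- 1) ^ card S \<cdot> bas f"
    by (simp add: parity_inv_bas f)
  moreover have "psi_ext (xi i) (bas (m, S)) = psi (0, {i}) (m, S)"
    "psi_ext (bas (m, S)) (xi i) = psi (m, S) (0, {i})" for i
    by (simp_all add: xi_def psi_ext_bas)
  ultimately show ?thesis
    unfolding a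
    by (cases y; simp only: ksgn_lt f snd_conv)
      (simp_all add: g_bracket_def k_part_bas k_bracket_one psi_ext_bas
        k_bracket_xi k_bracket_by_xi kD_linear of_kalg_linear f
        xi_def[symmetric] cs.scale_right_distrib)
qed

section \<open>Degrees and parities of brackets\<close>

fun kdeg :: "kmon \<Rightarrow> int" where
  "kdeg (m, S) = 2 * int m + int (card S)"

definition khom :: "int \<Rightarrow> kalg \<Rightarrow> bool" where
  "khom d f \<longleftrightarrow> (\<forall>a\<in>keys f. kdeg a = d)"

lemma keys_cscale: "keys (c \<cdot> v) \<subseteq> keys v"
  by (auto simp: in_keys_iff)

lemma keys_diff: "keys (v - w :: 'a \<Rightarrow>\<^sub>0 complex) \<subseteq> keys v \<union> keys w"
  by (auto simp: in_keys_iff lookup_minus)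

lemma keys_lin_ext: "keys (lin_ext \<phi> v) \<subseteq> (\<Union>a\<in>keys v. keys (\<phi> a))"
proof
  fix k
  assume "k \<in> keys (lin_ext \<phi> v)"
  then have "(\<Sum>a\<in>keys v. lookup v a * lookup (\<phi> a) k) \<noteq> 0"
    by (simp add: lin_ext_def in_keys_iff lookup_sum)
  then obtain a where "a \<in> keys v" "lookup v a * lookup (\<phi> a) k \<noteq> 0"
    by (metis (no_types, lifting) sum.neutral)
  then show "k \<in> (\<Union>a\<in>keys v. keys (\<phi> a))" by (auto simp: in_keys_iff)
qed

lemma khom_linear:
  "khom d f \<Longrightarrow> khom d g \<Longrightarrow> khom d (f + g)" "khom d f \<Longrightarrow> khom d g \<Longrightarrow> khom d (f - g)"
  "khom d f \<Longrightarrow> khom d (c \<cdot> f)" "khom d 0"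
  using keys_cscale[of c f] keys_diff[of f g] Poly_Mapping.keys_add[of f g] by (auto simp: khom_def)

lemma khom_sum: "(\<And>a. a \<in> A \<Longrightarrow> khom d (h a)) \<Longrightarrow> khom d (\<Sum>a\<in>A. h a)"
  by (induction A rule: infinite_finite_induct) (auto intro: khom_linear)

lemma khom_lin_ext: "khom d f \<Longrightarrow> (\<And>a. kdeg a = d \<Longrightarrow> khom e (\<phi> a)) \<Longrightarrow> khom e (lin_ext \<phi> f)"
  using keys_lin_ext[of \<phi> f] by (fastforce simp: khom_def)

lemma khom_bas: "kdeg a = d \<Longrightarrow> khom d (bas a)"
  by (simp add: khom_def)

lemma khom_ops:
  assumes "khom d f"
  shows "khom (d - 1) (d_xi i f)" "khom (d - 2) (d_t f)" "khom d (parity_inv f)" "khom d (euler f)"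
    "khom e g \<Longrightarrow> khom (d + e) (kmul f g)"
proof -
  have card: "int (card S - Suc 0) = int (card S) - 1" if "i \<in> S" for S and i :: ix
    using that by (cases "card S") auto
  show 1: "khom (d - 1) (d_xi i f)" for i
    unfolding d_xi_def
    by (rule khom_lin_ext[OF assms])
      (auto intro!: khom_linear khom_bas simp: card)
  show "khom (d - 2) (d_t f)"
    unfolding d_t_def
  proof (rule khom_lin_ext[OF assms])
    fix a assume "kdeg a = d"
    then show "khom (d - 2) (case a of (m, S) \<Rightarrow> of_nat m \<cdot> bas (m - 1, S))"
      by (cases a; cases "fst a") (auto intro!: khom_linear khom_bas)
  qed
  show "khom d (parity_inv f)"
    unfolding parity_inv_def by (rule khom_lin_ext[OF assms]) (auto intro!: khom_linear khom_bas)
  have mul: "khom (d + e) (kmul f g)" if "khom d f" "khom e g" for d e f g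
    unfolding kmul_def bilin_ext_lin_ext
    by (rule khom_lin_ext[OF that(1)], rule khom_lin_ext[OF that(2)])
      (auto intro!: khom_linear khom_bas simp: card_Un_disjoint)
  have "khom (1 + (d - 1)) (kmul (xi i) (d_xi i f))" for i
    by (rule mul[OF _ 1]) (simp add: xi_def khom_bas)
  then show "khom d (euler f)"
    unfolding euler_def by (auto intro!: khom_linear khom_sum assms)
  show "khom (d + e) (kmul f g)" if "khom e g" by (rule mul[OF assms that])
qed

text \<open>Every term of the bracket contains one \<partial>_t or two \<partial>_i and thus lowers
  the degree of the associative product by 2. The shift by 2 in \<open>gdeg\<close> compensates for
  this.\<close>

lemma khom_k_bracket: "khom d f \<Longrightarrow> khom e g \<Longrightarrow> khom (d + e - 2) (k_bracket f g)"
proof -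
  assume f: "khom d f" and g: "khom e g"
  have "khom (d + (e - 2)) (kmul (euler f) (d_t g))" "khom ((d - 2) + e) (kmul (d_t f) (euler g))"
    "khom ((d - 1) + (e - 1)) (kmul (d_xi i (parity_inv f)) (d_xi i g))" for i
    by (intro khom_ops f g)+
  then show ?thesis
    unfolding k_bracket_eq by (intro khom_linear khom_sum) (simp_all add: algebra_simps)
qed

lemma gdeg_kdeg: "gdeg (Mon a) = kdeg a - 2"
  by (cases a) simp

text \<open>The term C occurs only for complementary supports without powers of t; there the degrees
  |S| - 2 and 2 - |S| cancel, in agreement with the degree of C.\<close>

lemma gdeg_br: "c \<in> keys (br a b) \<Longrightarrow> gdeg c = gdeg a + gdeg b"
proof -
  assume c: "c \<in> keys (br a b)"
  show ?thesis
  proof (cases "a = Cen \<or> b = Cen")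
    case True
    then have "br a b = 0"
      by (auto simp: g_bracket_def k_part_bas k_bracket_linear psi_ext_linear of_kalg_linear k_part_linear)
    with c show ?thesis by simp
  next
    case False
    then obtain f g where ab: "a = Mon f" "b = Mon g" by (meson gbas.exhaust)
    have "c \<in> keys (of_kalg (k_bracket (bas f) (bas g))) \<or> c = Cen \<and> psi f g \<noteq> 0"
      using c Poly_Mapping.keys_add by (fastforce simp: ab g_bracket_def k_part_bas psi_ext_bas in_keys_iff lookup_add lookup_single when_def split: if_splits)
    then show ?thesis
    proof
      assume "c \<in> keys (of_kalg (k_bracket (bas f) (bas g)))"
      then obtain h where "h \<in> keys (k_bracket (bas f) (bas g))" "c = Mon h"
        using keys_lin_ext unfolding of_kalg_def by fastforce
      then show ?thesis
        using khom_k_bracket[OF khom_bas[OF refl] khom_bas[OF refl], of f g]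
        by (simp add: khom_def ab gdeg_kdeg)
    next
      assume "c = Cen \<and> psi f g \<noteq> 0"
      moreover have "card S + card (- S) = 4" for S :: "ix set"
        using card_Un_disjoint[of S "- S"] by (simp add: card_ix)
      ultimately show ?thesis
        by (cases f; cases g) (force simp: ab psi_eq split: if_splits simp flip: of_nat_add)
    qed
  qed
qed

text \<open>The power of t contributes an even degree, so parity is read off from the degree, and
  \<open>gpar_br\<close> follows from \<open>gdeg_br\<close>.\<close>

lemma gpar_gdeg: "gpar a = nat (gdeg a mod 2)"
proof (cases a)
  case (Mon f)
  obtain m S where f: "f = (m, S)" by force
  have "(2 * int m + int (card S) - 2) mod 2 = int (card S) mod 2" by presburger
  then show ?thesis by (simp add: Mon f nat_mod_distrib)
qed simp

lemma gpar_br: "c \<in> keys (br a b) \<Longrightarrow> gpar c = (gpar a + gpar b) mod 2"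
proof -
  assume "c \<in> keys (br a b)"
  then have "gdeg c = gdeg a + gdeg b" by (rule gdeg_br)
  then have "int (gpar c) = (int (gpar a) + int (gpar b)) mod 2"
    by (simp add: gpar_gdeg mod_add_eq)
  then show ?thesis by presburger
qed

abbreviation "sngl \<equiv> Poly_Mapping.single"

section \<open>The action of the zero part on polynomials\<close>

definition pD :: "pvar \<Rightarrow> pvar \<Rightarrow> poly4 \<Rightarrow> poly4" where
  "pD u v p = pv u * pdiff v p"

lemma pdiff_linear:
  "pdiff v (p + q) = pdiff v p + pdiff v q" "pdiff v (c \<cdot> p) = c \<cdot> pdiff v p" "pdiff v 0 = 0"
  "pdiff v (p - q) = pdiff v p - pdiff v q" "pdiff v (- p) = - pdiff v p"
  by (simp_all add: pdiff_def lin_ext_add lin_ext_scale lin_ext_diff lin_ext_uminus)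

lemma pD_linear:
  "pD u v (p + q) = pD u v p + pD u v q" "pD u v (c \<cdot> p) = c \<cdot> pD u v p" "pD u v 0 = 0"
  "pD u v (p - q) = pD u v p - pD u v q" "pD u v (- p) = - pD u v p"
  by (simp_all add: pD_def pdiff_linear cscale_mult_right algebra_simps)

lemma pv_bas: "pv u * bas e = bas (e + sngl u 1)"
  by (simp add: pv_def mult_single add.commute)

lemma pdiff_bas: "pdiff v (bas e) = of_nat (lookup e v) \<cdot> bas (e - sngl v 1)"
  by (simp add: pdiff_def)

lemma pdiff_pv: "pdiff v (pv u * p) = (if u = v then p else 0) + pv u * pdiff v p"
proof (induction p rule: pm_induct)
  case (basis e)
  have "e + sngl v 1 - sngl v 1 = e" by simp
  moreover have "e - sngl v 1 + sngl v 1 = e" if "lookup e v \<noteq> 0"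
    using that by (intro poly_mapping_eqI) (auto simp: lookup_add lookup_minus lookup_single when_def)
  moreover have "e + sngl u 1 - sngl v 1 =
      e - sngl v 1 + sngl u 1" if "u \<noteq> v" 
    using that by (intro poly_mapping_eqI) (auto simp: lookup_add lookup_minus lookup_single when_def)
  ultimately show ?case
    by (cases "lookup e v = 0")
      (auto simp: pv_bas pdiff_bas cscale_mult_right lookup_add lookup_single when_def cs.scale_left_distrib)
qed (auto simp: pdiff_linear cscale_mult_right algebra_simps)

lemma pdiff_pdiff: "pdiff u (pdiff v p) = pdiff v (pdiff u p)"
proof (induction p rule: pm_induct)
  case (basis e)
  have "e - sngl u (Suc 0) - sngl v (Suc 0) =
      e - sngl v (Suc 0) - sngl u (Suc 0)"
    by (intro poly_mapping_eqI) (auto simp: lookup_add lookup_minus lookup_single when_def)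
  then show ?case
    by (cases "u = v") (auto simp: pdiff_bas pdiff_linear lookup_minus lookup_single when_def mult.commute)
qed (auto simp: pdiff_linear)

text \<open>Normal ordering. The last term is symmetric under exchange of (a, b) and (c, d), so it
  cancels in commutators and leaves the relations of gl.\<close>

lemma pD_pD: "pD a b (pD c d p) = (if b = c then pD a d p else 0) + pv a * (pv c * pdiff b (pdiff d p))"
  by (auto simp: pD_def pdiff_pv algebra_simps)

lemma F_act_bas_pD: "F_act_bas \<mu> b p =
    (if b = Cen then snd (snd (snd \<mu>)) \<cdot> p
     else if b = Mon (1, {}) then fst (snd (snd \<mu>)) \<cdot> p
     else if b = Mon (0, {I1, I2}) then (\<i>/2) \<cdot> (pD X1 X1 p - pD X2 X2 p + (pD Y1 Y1 p - pD Y2 Y2 p))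
     else if b = Mon (0, {I3, I4}) then (\<i>/2) \<cdot> (pD Y1 Y1 p - pD Y2 Y2 p - (pD X1 X1 p - pD X2 X2 p))
     else if b = Mon (0, {I1, I3}) then (1/2) \<cdot> (pD X2 X1 p - pD X1 X2 p + pD Y2 Y1 p - pD Y1 Y2 p)
     else if b = Mon (0, {I2, I4}) then (1/2) \<cdot> (pD X2 X1 p - pD X1 X2 p - pD Y2 Y1 p + pD Y1 Y2 p)
     else if b = Mon (0, {I1, I4}) then (\<i>/2) \<cdot> (pD X1 X2 p + pD X2 X1 p - pD Y1 Y2 p - pD Y2 Y1 p)
     else if b = Mon (0, {I2, I3}) then (- \<i>/2) \<cdot> (pD X1 X2 p + pD X2 X1 p + pD Y1 Y2 p + pD Y2 Y1 p)
     else 0)"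
proof -
  obtain m n t c where \<mu>: "\<mu> = (m, n, t, c)" by (metis prod_cases4)
  show ?thesis by (simp only: \<mu> F_act_bas.simps Let_def pD_def fst_conv snd_conv)
qed

declare F_act_bas.simps [simp del]

lemma ix_sets_neq:
  "{I1, I2} \<noteq> {I3, I4}" "{I1, I2} \<noteq> {I1, I3}" "{I1, I2} \<noteq> {I2, I4}" "{I1, I2} \<noteq> {I1, I4}"
  "{I1, I2} \<noteq> {I2, I3}" "{I3, I4} \<noteq> {I1, I3}" "{I3, I4} \<noteq> {I2, I4}" "{I3, I4} \<noteq> {I1, I4}"
  "{I3, I4} \<noteq> {I2, I3}" "{I1, I3} \<noteq> {I2, I4}" "{I1, I3} \<noteq> {I1, I4}" "{I1, I3} \<noteq> {I2, I3}"
  "{I2, I4} \<noteq> {I1, I4}" "{I2, I4} \<noteq> {I2, I3}" "{I1, I4} \<noteq> {I2, I3}"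
  by auto

lemma F_act_bas_values:
  "F_act_bas \<mu> Cen p = snd (snd (snd \<mu>)) \<cdot> p"
  "F_act_bas \<mu> (Mon (Suc 0, {})) p = fst (snd (snd \<mu>)) \<cdot> p"
  "F_act_bas \<mu> (Mon (0, {I1, I2})) p = (\<i>/2) \<cdot> (pD X1 X1 p - pD X2 X2 p + (pD Y1 Y1 p - pD Y2 Y2 p))"
  "F_act_bas \<mu> (Mon (0, {I3, I4})) p = (\<i>/2) \<cdot> (pD Y1 Y1 p - pD Y2 Y2 p - (pD X1 X1 p - pD X2 X2 p))"
  "F_act_bas \<mu> (Mon (0, {I1, I3})) p = (1/2) \<cdot> (pD X2 X1 p - pD X1 X2 p + pD Y2 Y1 p - pD Y1 Y2 p)"
  "F_act_bas \<mu> (Mon (0, {I2, I4})) p = (1/2) \<cdot> (pD X2 X1 p - pD X1 X2 p - pD Y2 Y1 p + pD Y1 Y2 p)"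
  "F_act_bas \<mu> (Mon (0, {I1, I4})) p = (\<i>/2) \<cdot> (pD X1 X2 p + pD X2 X1 p - pD Y1 Y2 p - pD Y2 Y1 p)"
  "F_act_bas \<mu> (Mon (0, {I2, I3})) p = (- \<i>/2) \<cdot> (pD X1 X2 p + pD X2 X1 p + pD Y1 Y2 p + pD Y2 Y1 p)"
  by (simp_all only: F_act_bas_pD One_nat_def gbas.inject gbas.distinct prod.inject ix_sets_neq ix_sets_neq[symmetric]
      insert_not_empty insert_not_empty[symmetric] simp_thms if_True if_False nat.distinct)

lemma F_act_bas_linear:
  "F_act_bas \<mu> b (p + q) = F_act_bas \<mu> b p + F_act_bas \<mu> b q"
  "F_act_bas \<mu> b (c \<cdot> p) = c \<cdot> F_act_bas \<mu> b p"
  "F_act_bas \<mu> b 0 = 0"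
  unfolding F_act_bas_pD pD_linear
  by (simp_all add: cs.scale_right_distrib cs.scale_right_diff_distrib mult.commute algebra_simps)

lemma F_act_linear:
  "F_act \<mu> (x + y) p = F_act \<mu> x p + F_act \<mu> y p" "F_act \<mu> (c \<cdot> x) p = c \<cdot> F_act \<mu> x p"
  "F_act \<mu> 0 p = 0" "F_act \<mu> (x - y) p = F_act \<mu> x p - F_act \<mu> y p" "F_act \<mu> (- x) p = - F_act \<mu> x p"
  "F_act \<mu> x (p + q) = F_act \<mu> x p + F_act \<mu> x q" "F_act \<mu> x (c \<cdot> p) = c \<cdot> F_act \<mu> x p"
  "F_act \<mu> x 0 = 0"
  by (simp_all add: F_act_def lin_ext_add lin_ext_scale lin_ext_diff lin_ext_uminus F_act_bas_linear
      lin_ext_fun_add lin_ext_fun_scale lin_ext_fun_zero)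

lemma F_act_bas': "F_act \<mu> (bas b) p = F_act_bas \<mu> b p"
  by (simp add: F_act_def)

lemma F_act_bas_pos:
  assumes "gdeg b > 0"
  shows "F_act_bas \<mu> b p = 0"
proof -
  have "b \<noteq> Cen" "b \<noteq> Mon (1, {})" "b \<noteq> Mon (0, {I1, I2})" "b \<noteq> Mon (0, {I3, I4})" "b \<noteq> Mon (0, {I1, I3})"
    "b \<noteq> Mon (0, {I2, I4})" "b \<noteq> Mon (0, {I1, I4})" "b \<noteq> Mon (0, {I2, I3})"
    using assms by auto
  then show ?thesis by (simp only: F_act_bas_pD if_False)
qed

lemma F_act_pos: "(\<And>b. b \<in> keys x \<Longrightarrow> gdeg b > 0) \<Longrightarrow> F_act \<mu> x p = 0"
  unfolding F_act_def lin_ext_def by (rule sum.neutral) (simp add: F_act_bas_pos)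

lemma gdeg_zero_cases:
  assumes "gdeg a = 0"
  shows "a \<in> {Cen, Mon (1, {}), Mon (0, {I1, I2}), Mon (0, {I3, I4}), Mon (0, {I1, I3}), Mon (0, {I2, I4}),
    Mon (0, {I1, I4}), Mon (0, {I2, I3})}"
proof (cases a)
  case (Mon f)
  obtain m S where f: "f = (m, S)" by force
  have "2 * m + card S = 2" using assms by (simp add: Mon f)
  moreover have "S \<in> Pow {I1, I2, I3, I4}" by (simp add: UNIV_ix[symmetric])
  moreover have "m = 1 \<and> card S = 0 \<or> m = 0 \<and> card S = 2" using calculation(1) by (cases m) auto
  ultimately show ?thesis
    by (simp add: Mon f Pow_insert) (elim disjE; simp add: insert_commute)
qed simp

lemma k_bracket_bas: "k_bracket (bas (m, S)) (bas (n, T)) =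
    ((2 - of_nat (card S)) * of_nat n) \<cdot> kmul (bas (m, S)) (bas (n - 1, T))
    - (of_nat m * (2 - of_nat (card T))) \<cdot> kmul (bas (m - 1, S)) (bas (n, T))
    + (- 1) ^ card S \<cdot> (\<Sum>i\<in>UNIV. kmul (d_xi i (bas (m, S))) (d_xi i (bas (n, T))))"
  by (simp add: k_bracket_eq euler_bas d_t_bas parity_inv_bas k_lin cs.scale_sum_right mult.commute)

lemma sum_ix: "(\<Sum>i\<in>UNIV. h i) = h I1 + h I2 + h I3 + h I4"
  by (simp add: UNIV_ix add.assoc)

lemma br_Mon: "br (Mon a) (Mon b) = of_kalg (k_bracket (bas a) (bas b)) + psi a b \<cdot> bas Cen"
  by (simp add: g_bracket_def k_part_bas psi_ext_bas)

lemma br_Cen: "br Cen b = 0" "br b Cen = 0"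
  by (simp_all add: g_bracket_def k_part_bas k_bracket_linear psi_ext_linear of_kalg_linear k_part_linear)

lemma of_kalg_bas: "of_kalg (bas a) = bas (Mon a)"
  by (simp add: of_kalg_def)

lemma br_zero: "gdeg (Mon a) = 0 \<Longrightarrow> br (Mon a) (Mon b) = of_kalg (k_bracket (bas a) (bas b))"
  by (cases a; cases b) (auto simp: br_Mon psi_eq)

text \<open>[t, \<xi>_ij] is a multiple of 2 - 2 = 0, the value of \<open>euler\<close> on a
  quadratic monomial.\<close>

lemma br_t: 
  assumes "gdeg b = 0"
  shows "br (Mon (1, {})) b = 0" "br b (Mon (1, {})) = 0"
proof -
  have "br (Mon (1, {})) b = 0 \<and> br b (Mon (1, {})) = 0"
  proof (cases b)
    case (Mon f)
    obtain m S where f: "f = (m, S)" by force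
    have "2 * m + card S = 2" using assms by (simp add: Mon f)
    then have "m = 1 \<and> card S = 0 \<or> m = 0 \<and> card S = 2" by (cases m) auto
    then show ?thesis
      using assms by (auto simp: Mon f br_zero k_bracket_bas kmul_bas d_xi_bas of_kalg_linear kmul_linear)
  qed (simp add: br_Cen)
  then show "br (Mon (1, {})) b = 0" "br b (Mon (1, {})) = 0" by blast+
qed

text \<open>C and t are central in degree zero and act by scalars. The pairs among the six \<xi>_ij
  are computed through \<open>pD_pD\<close>.\<close>

lemma F_rep_zero:
  assumes "gdeg a = 0" "gdeg b = 0"
  shows "F_act \<mu> (br a b) p = F_act_bas \<mu> a (F_act_bas \<mu> b p) - F_act_bas \<mu> b (F_act_bas \<mu> a p)"
proof (cases "a \<in> {Cen, Mon (1, {})} \<or> b \<in> {Cen, Mon (1, {})}")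
  case True
  then have "br a b = 0" using assms by (auto simp: br_Cen br_t simp del: One_nat_def)
  moreover have "\<exists>s. \<forall>p. F_act_bas \<mu> c p = s \<cdot> p" if "c \<in> {Cen, Mon (1, {})}" for c
    using that by (auto simp: F_act_bas_values)
  ultimately show ?thesis using True by (metis F_act_bas_linear(2) F_act_linear(3) diff_self)
next
  case False
  let ?Z = "{Mon (0, {I1, I2}), Mon (0, {I3, I4}), Mon (0, {I1, I3}), Mon (0, {I2, I4}),
    Mon (0, {I1, I4}), Mon (0, {I2, I3})}"
  have "a \<noteq> Cen" "a \<noteq> Mon (1, {})" "b \<noteq> Cen" "b \<noteq> Mon (1, {})" using False by simp_all
  then have "a \<in> ?Z" "b \<in> ?Z"
    using gdeg_zero_cases[OF assms(1)] gdeg_zero_cases[OF assms(2)]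
    by (simp_all only: insert_iff[of a Cen] insert_iff[of a "Mon (1, {})"] insert_iff[of b Cen]
        insert_iff[of b "Mon (1, {})"] simp_thms)
  then show ?thesis
    by (elim insertE emptyE)
      (simp_all add: br_zero k_bracket_bas kmul_bas d_xi_bas sum_ix of_kalg_linear of_kalg_bas k_lin
        ix_less sg_insert eps_insert_left insert_Diff_if insert_commute F_act_linear F_act_bas'
        F_act_bas_values pD_linear pD_pD mult.left_commute[of "pv a" "pv b" for a b] pdiff_pdiff,
       (rule poly_mapping_eqI, simp add: lookup_add lookup_minus ring_distribs)+)
qed

lemma F_rep:
  assumes "gdeg a \<ge> 0" "gdeg b \<ge> 0"
  shows "F_act \<mu> (br a b) p = F_act_bas \<mu> a (F_act_bas \<mu> b p) - ksgn a b \<cdot> F_act_bas \<mu> b (F_act_bas \<mu> a p)"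
proof (cases "gdeg a = 0 \<and> gdeg b = 0")
  case True
  then show ?thesis using F_rep_zero[of a b] by (simp add: gpar_gdeg)
next
  case False
  then have "gdeg c > 0" if "c \<in> keys (br a b)" for c
    using gdeg_br[OF that] assms by linarith
  moreover have "gdeg a > 0 \<or> gdeg b > 0" using False assms by linarith
  ultimately show ?thesis
    by (auto simp: F_act_pos F_act_bas_pos F_act_bas_linear)
qed

lemma F_space_eq: "F_space \<mu> = {p. \<forall>e\<in>keys p. lookup e X1 + lookup e X2 = fst \<mu> \<and> lookup e Y1 + lookup e Y2 = fst (snd \<mu>)}"
  by (cases \<mu>) auto

lemma F_space_linear:
  "p \<in> F_space \<mu> \<Longrightarrow> q \<in> F_space \<mu> \<Longrightarrow> p + q \<in> F_space \<mu>"
  "p \<in> F_space \<mu> \<Longrightarrow> q \<in> F_space \<mu> \<Longrightarrow> p - q \<in> F_space \<mu>"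
  "p \<in> F_space \<mu> \<Longrightarrow> c \<cdot> p \<in> F_space \<mu>" "0 \<in> F_space \<mu>" "p \<in> F_space \<mu> \<Longrightarrow> - p \<in> F_space \<mu>"
  using keys_cscale[of c p] keys_diff[of p q] Poly_Mapping.keys_add[of p q]
  by (auto simp: F_space_eq in_keys_iff)

lemma pD_bas: "pD u v (bas e) = of_nat (lookup e v) \<cdot> bas (e - sngl v 1 + sngl u 1)"
  by (simp add: pD_def pdiff_bas cscale_mult_right pv_bas)

lemma pD_lin_ext: "pD u v p = lin_ext (\<lambda>e. pD u v (bas e)) p"
  by (induction p rule: pm_induct) (simp_all add: pD_linear lin_ext_add lin_ext_scale)

lemma pD_F_space:
  assumes "p \<in> F_space \<mu>" "u \<in> {X1, X2} \<and> v \<in> {X1, X2} \<or> u \<in> {Y1, Y2} \<and> v \<in> {Y1, Y2}"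
  shows "pD u v p \<in> F_space \<mu>"
proof -
  have "lookup k X1 + lookup k X2 = fst \<mu> \<and> lookup k Y1 + lookup k Y2 = fst (snd \<mu>)"
    if e: "e \<in> keys p" and k: "k \<in> keys (pD u v (bas e))" for e k
  proof -
    have "lookup e v \<noteq> 0 \<and> k = e - sngl v 1 + sngl u 1"
      using k by (auto simp: pD_bas in_keys_iff lookup_single when_def split: if_splits)
    moreover have "lookup e X1 + lookup e X2 = fst \<mu> \<and> lookup e Y1 + lookup e Y2 = fst (snd \<mu>)"
      using assms(1) e by (auto simp: F_space_eq)
    ultimately show ?thesis
      using assms(2) by (auto simp: lookup_add lookup_minus lookup_single)
  qed
  then show ?thesis
    using keys_lin_ext[of "\<lambda>e. pD u v (bas e)" p]
    unfolding F_space_eq pD_lin_ext[symmetric] by blast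
qed

lemma F_act_bas_F_space:
  assumes "p \<in> F_space \<mu>"
  shows "F_act_bas \<mu> b p \<in> F_space \<mu>"
proof -
  have "pD u v p \<in> F_space \<mu>" if "(u, v) \<in> {(X1, X1), (X1, X2), (X2, X1), (X2, X2), (Y1, Y1), (Y1, Y2), (Y2, Y1), (Y2, Y2)}" for u v
    using that by (auto intro!: pD_F_space[OF assms])
  then show ?thesis
    unfolding F_act_bas_pD by (simp add: F_space_linear assms)
qed

section \<open>A model for the induced module\<close>

type_synonym tmod = "(neg list \<times> (pvar \<Rightarrow>\<^sub>0 nat)) \<Rightarrow>\<^sub>0 complex"

lemma inj_lt: "inj lt"
proof (rule injI)
  fix y z show "lt y = lt z \<Longrightarrow> y = z" by (cases y; cases z) auto
qed

lemma range_lt: "x \<in> range lt \<longleftrightarrow> gdeg x < 0"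
proof
  assume "x \<in> range lt"
  then obtain y where "x = lt y" by blast
  then show "gdeg x < 0" by (cases y) auto
next
  assume x: "gdeg x < 0"
  then obtain m S where f: "x = Mon (m, S)" by (metis gdeg.simps(2) gbas.exhaust prod.exhaust less_irrefl)
  then have "2 * m + card S < 2" using x by simp
  then have "m = 0" "card S < 2" by linarith+
  then have "m = 0 \<and> (card S = 0 \<or> card S = 1)" using less_2_cases by fastforce
  then consider "x = lt Th" | i where "x = lt (Et i)"
    by (auto simp: f card_1_singleton_iff)
  then show "x \<in> range lt" by cases blast+
qed

definition lcons :: "neg \<Rightarrow> tmod \<Rightarrow> tmod" where
  "lcons y = lin_ext (\<lambda>(w, e). bas (y # w, e))"

definition emb :: "poly4 \<Rightarrow> tmod" where
  "emb = lin_ext (\<lambda>e. bas ([], e))"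

text \<open>
  Words in the basis of $\mathfrak g_{<0}$ are kept free: elements of negative degree act by
  prepending a letter, the others are moved through the word by the bracket until they reach \<open>F\<close>.
  This is an action of $\mathfrak g$ only modulo the submodule \<open>nul\<close> defined below, where only
  brackets with a letter enter; hence the Jacobi identity \<open>g_jacobi\<close> suffices.
\<close>

primrec act0 :: "weight \<Rightarrow> neg list \<Rightarrow> gbas \<Rightarrow> (pvar \<Rightarrow>\<^sub>0 nat) \<Rightarrow> tmod" where
  "act0 \<mu> [] x e = (if x \<in> range lt then bas ([inv lt x], e) else emb (F_act_bas \<mu> x (bas e)))"
| "act0 \<mu> (y # w) x e = (if x \<in> range lt then bas (inv lt x # y # w, e)
     else ksgn (lt y) x \<cdot> (lcons y (act0 \<mu> w x e) - lin_ext (\<lambda>b. act0 \<mu> w b e) (br (lt y) x)))"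

definition act :: "weight \<Rightarrow> galg \<Rightarrow> tmod \<Rightarrow> tmod" where
  "act \<mu> = bilin_ext (\<lambda>x (w, e). act0 \<mu> w x e)"

lemma lcons_linear:
  "lcons y (v + w) = lcons y v + lcons y w" "lcons y (c \<cdot> v) = c \<cdot> lcons y v" "lcons y 0 = 0"
  "lcons y (v - w) = lcons y v - lcons y w" "lcons y (- v) = - lcons y v"
  by (simp_all add: lcons_def lin_ext_add lin_ext_scale lin_ext_diff lin_ext_uminus)

lemma emb_linear:
  "emb (v + w) = emb v + emb w" "emb (c \<cdot> v) = c \<cdot> emb v" "emb 0 = 0"
  "emb (v - w) = emb v - emb w" "emb (- v) = - emb v"
  by (simp_all add: emb_def lin_ext_add lin_ext_scale lin_ext_diff lin_ext_uminus)

lemma act_linear: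
  "act \<mu> (x + y) v = act \<mu> x v + act \<mu> y v" "act \<mu> x (v + w) = act \<mu> x v + act \<mu> x w"
  "act \<mu> (c \<cdot> x) v = c \<cdot> act \<mu> x v" "act \<mu> x (c \<cdot> v) = c \<cdot> act \<mu> x v" "act \<mu> 0 v = 0" "act \<mu> x 0 = 0"
  "act \<mu> (x - y) v = act \<mu> x v - act \<mu> y v" "act \<mu> x (v - w) = act \<mu> x v - act \<mu> x w"
  by (simp_all add: act_def bilin_ext_linear bilin_ext_diff)

lemma act_uminus: "act \<mu> (- x) v = - act \<mu> x v" "act \<mu> x (- v) = - act \<mu> x v"
  using act_linear(7)[of \<mu> 0 x v] act_linear(8)[of \<mu> x 0 v] by (simp_all add: act_linear)

lemmas t_lin = lcons_linear emb_linear act_linear act_uminus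

lemma act_bas: "act \<mu> (bas x) (bas (w, e)) = act0 \<mu> w x e"
  by (simp add: act_def bilin_ext_bas)

lemma act_bas_right: "act \<mu> X (bas (w, e)) = lin_ext (\<lambda>b. act0 \<mu> w b e) X"
  by (simp add: act_def bilin_ext_lin_ext)

lemma act_lt: "act \<mu> (bas (lt y)) v = lcons y v"
proof (induction v rule: pm_induct)
  case (basis a)
  obtain w e where a: "a = (w, e)" by force
  show ?case by (cases w) (simp_all add: a act_bas lcons_def inv_f_f[OF inj_lt])
qed (simp_all add: t_lin)

lemma act_lcons:
  assumes "gdeg x \<ge> 0"
  shows "act \<mu> (bas x) (lcons y v) = ksgn (lt y) x \<cdot> (lcons y (act \<mu> (bas x) v) - act \<mu> (br (lt y) x) v)"
proof (induction v rule: pm_induct)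
  case (basis a)
  obtain w e where a: "a = (w, e)" by force
  have "x \<notin> range lt" using assms by (simp add: range_lt)
  moreover have "lcons y (bas (w, e)) = bas (y # w, e)" by (simp add: lcons_def)
  ultimately show ?case by (simp add: a act_bas act_bas_right)
qed (simp_all add: t_lin cs.scale_right_distrib cs.scale_right_diff_distrib mult.commute)

lemma act_emb: "gdeg x \<ge> 0 \<Longrightarrow> act \<mu> (bas x) (emb p) = emb (F_act_bas \<mu> x p)"
proof (induction p rule: pm_induct)
  case (basis e)
  then show ?case by (auto simp: emb_def act_bas range_lt)
qed (simp_all add: t_lin F_act_bas_linear)

lemma act_emb_ge0: "x \<in> g_ge0 \<Longrightarrow> act \<mu> x (emb p) = emb (F_act \<mu> x p)"
proof -
  assume "x \<in> g_ge0"
  then have "act \<mu> (bas b) (emb p) = emb (F_act_bas \<mu> b p)" if "b \<in> keys x" for b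
    using that by (simp add: act_emb g_ge0_def)
  moreover have "act \<mu> x v = (\<Sum>b\<in>keys x. lookup x b \<cdot> act \<mu> (bas b) v)" for v
    by (simp add: act_def bilin_ext_def lin_ext_def cs.scale_sum_right)
  ultimately show ?thesis
    by (simp add: F_act_def lin_ext_def) (simp add: emb_def lin_ext_sum lin_ext_scale)
qed

section \<open>Words modulo the commutation relations of letters\<close>

definition rel :: "weight \<Rightarrow> neg \<Rightarrow> neg \<Rightarrow> tmod \<Rightarrow> tmod" where
  "rel \<mu> y z v = lcons y (lcons z v) - ksgn (lt y) (lt z) \<cdot> lcons z (lcons y v) - act \<mu> (br (lt y) (lt z)) v"

text \<open>Relations in arbitrary context: the vector v in \<open>nul_rel\<close> is the right
  context, \<open>nul_lcons\<close> supplies the left one.\<close>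

inductive_set nul :: "weight \<Rightarrow> tmod set" for \<mu> where
  nul_zero: "0 \<in> nul \<mu>"
| nul_add: "u \<in> nul \<mu> \<Longrightarrow> v \<in> nul \<mu> \<Longrightarrow> u + v \<in> nul \<mu>"
| nul_scale: "v \<in> nul \<mu> \<Longrightarrow> c \<cdot> v \<in> nul \<mu>"
| nul_rel: "rel \<mu> y z v \<in> nul \<mu>"
| nul_lcons: "v \<in> nul \<mu> \<Longrightarrow> lcons y v \<in> nul \<mu>"

lemma nul_uminus: "v \<in> nul \<mu> \<Longrightarrow> - v \<in> nul \<mu>"
  using nul_scale[of v \<mu> "- 1"] by (simp add: cscale_minus_one)

lemma nul_diff: "u \<in> nul \<mu> \<Longrightarrow> v \<in> nul \<mu> \<Longrightarrow> u - v \<in> nul \<mu>"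
  using nul_add[OF _ nul_uminus] by fastforce

definition cg :: "weight \<Rightarrow> tmod \<Rightarrow> tmod \<Rightarrow> bool" where
  "cg \<mu> u v \<longleftrightarrow> u - v \<in> nul \<mu>"

lemma cg_refl: "cg \<mu> u u"
  by (simp add: cg_def nul_zero)

lemma cg_sym: "cg \<mu> u v \<Longrightarrow> cg \<mu> v u"
  using nul_uminus by (fastforce simp: cg_def)

lemma cg_trans [trans]: "cg \<mu> u v \<Longrightarrow> cg \<mu> v w \<Longrightarrow> cg \<mu> u w"
  using nul_add by (fastforce simp: cg_def)

lemma cg_add: "cg \<mu> u v \<Longrightarrow> cg \<mu> u' v' \<Longrightarrow> cg \<mu> (u + u') (v + v')"
  using nul_add by (fastforce simp: cg_def algebra_simps)

lemma cg_scale: "cg \<mu> u v \<Longrightarrow> cg \<mu> (c \<cdot> u) (c \<cdot> v)"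
  using nul_scale by (fastforce simp: cg_def cs.scale_right_diff_distrib[symmetric])

lemma cg_diff: "cg \<mu> u v \<Longrightarrow> cg \<mu> u' v' \<Longrightarrow> cg \<mu> (u - u') (v - v')"
  using nul_diff by (fastforce simp: cg_def algebra_simps)

lemma cg_lcons: "cg \<mu> u v \<Longrightarrow> cg \<mu> (lcons y u) (lcons y v)"
  using nul_lcons by (fastforce simp: cg_def lcons_linear(4)[symmetric])

lemma cg_zero: "cg \<mu> u 0 \<longleftrightarrow> u \<in> nul \<mu>"
  by (simp add: cg_def)

lemma pm_keys_induct [case_names zero add scale basis]:
  assumes "P 0" "\<And>v w. P v \<Longrightarrow> P w \<Longrightarrow> P (v + w)" "\<And>c v. P v \<Longrightarrow> P (c \<cdot> v)"
    "\<And>a. a \<in> keys v \<Longrightarrow> P (bas a)"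
  shows "P v"
proof -
  have "P (\<Sum>a\<in>A. lookup v a \<cdot> bas a)" if "finite A" "A \<subseteq> keys v" for A
    using that by (induction A rule: finite_induct) (auto intro: assms)
  then show ?thesis by (subst pm_expand) simp
qed

lemma gpar_cases: "gpar a = 0 \<or> gpar a = 1"
  by (cases a rule: gpar.cases) auto

text \<open>For x of nonnegative degree this is how the action was defined. For x of negative degree
  the difference of the two sides is, up to sign, one of the relations.\<close>

lemma act_lcons_cg:
  "cg \<mu> (act \<mu> (bas x) (lcons y v)) (ksgn (lt y) x \<cdot> (lcons y (act \<mu> (bas x) v) - act \<mu> (br (lt y) x) v))"
proof (cases "gdeg x \<ge> 0")
  case True
  then show ?thesis by (simp add: act_lcons cg_refl)
next
  case False
  then obtain z where x: "x = lt z" using range_lt[of x] by auto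
  have "act \<mu> (bas x) (lcons y v) - ksgn (lt y) x \<cdot> (lcons y (act \<mu> (bas x) v) - act \<mu> (br (lt y) x) v)
      = (- ksgn (lt y) x) \<cdot> rel \<mu> y z v"
    using gpar_cases[of "lt y"] gpar_cases[of "lt z"]
    by (auto simp: x rel_def act_lt cs.scale_right_diff_distrib cscale_minus_one)
  then show ?thesis by (simp only: cg_def nul_scale nul_rel)
qed

lemma act_lcons_cg_hom:
  assumes "\<And>b. b \<in> keys X \<Longrightarrow> gpar b = q"
  shows "cg \<mu> (act \<mu> X (lcons y v))
    ((- 1) ^ (gpar (lt y) * q) \<cdot> (lcons y (act \<mu> X v) - act \<mu> (g_bracket (bas (lt y)) X) v))"
proof (induction rule: pm_keys_induct[of _ X])
  case (basis b)
  then show ?case using act_lcons_cg[of \<mu> b y v] assms[OF basis] by simp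
next
  case (add X Y)
  show ?case using cg_add[OF add] by (simp add: t_lin g_bracket_linear algebra_simps cs.scale_right_distrib)
next
  case (scale c X)
  show ?case using cg_scale[OF scale, of c]
    by (simp add: t_lin g_bracket_linear cs.scale_right_diff_distrib mult.commute)
qed (simp_all add: t_lin g_bracket_linear cg_refl)

lemma act_nul_gen:
  assumes "\<And>x. act \<mu> (bas x) v \<in> nul \<mu>"
  shows "act \<mu> X v \<in> nul \<mu>"
  by (induction X rule: pm_induct) (auto simp: t_lin assms intro: nul.intros)

lemma sgn_mod: "(- 1 :: complex) ^ (k * ((m + n) mod 2)) = (- 1) ^ (k * m) * (- 1) ^ (k * n)"
  by (metis power_mod_2 power_mult power_add distrib_left mult.commute)

lemma act_cons2_cg:
  "cg \<mu> (act \<mu> (bas x) (lcons y (lcons z v)))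
    (ksgn (lt y) x \<cdot> (ksgn (lt z) x \<cdot> (lcons y (lcons z (act \<mu> (bas x) v)) - lcons y (act \<mu> (br (lt z) x) v))
      - (ksgn (lt z) (lt y) * ksgn (lt z) x) \<cdot> (lcons z (act \<mu> (br (lt y) x) v)
        - act \<mu> (g_bracket (bas (lt z)) (br (lt y) x)) v)))"
proof -
  have "cg \<mu> (act \<mu> (bas x) (lcons y (lcons z v)))
      (ksgn (lt y) x \<cdot> (lcons y (act \<mu> (bas x) (lcons z v)) - act \<mu> (br (lt y) x) (lcons z v)))"
    by (rule act_lcons_cg)
  also have "cg \<mu> (ksgn (lt y) x \<cdot> (lcons y (act \<mu> (bas x) (lcons z v)) - act \<mu> (br (lt y) x) (lcons z v)))
     (ksgn (lt y) x \<cdot> (lcons y (ksgn (lt z) x \<cdot> (lcons z (act \<mu> (bas x) v) - act \<mu> (br (lt z) x) v))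
      - (- 1) ^ (gpar (lt z) * ((gpar (lt y) + gpar x) mod 2)) \<cdot> (lcons z (act \<mu> (br (lt y) x) v)
        - act \<mu> (g_bracket (bas (lt z)) (br (lt y) x)) v)))"
    by (intro cg_scale cg_diff cg_lcons act_lcons_cg act_lcons_cg_hom gpar_br)
  finally show ?thesis by (simp add: sgn_mod t_lin)
qed

text \<open>This makes the quotient by \<open>nul\<close> stable under the action. Pushing x through
  the relation for y and z gives, up to sign, the same relation on x v: the terms with one bracket
  [y, x] or [z, x] cancel, and the double brackets cancel by \<open>g_jacobi\<close>.\<close>

lemma act_nul: "v \<in> nul \<mu> \<Longrightarrow> act \<mu> X v \<in> nul \<mu>"
proof (induction v arbitrary: X rule: nul.induct)
  case (nul_lcons v y)
  have "act \<mu> (bas x) (lcons y v) \<in> nul \<mu>" for x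
  proof -
    have "cg \<mu> (act \<mu> (bas x) (lcons y v)) (ksgn (lt y) x \<cdot> (lcons y (act \<mu> (bas x) v) - act \<mu> (br (lt y) x) v))"
      by (rule act_lcons_cg)
    moreover have "cg \<mu> (ksgn (lt y) x \<cdot> (lcons y (act \<mu> (bas x) v) - act \<mu> (br (lt y) x) v)) 0"
      unfolding cg_zero by (intro nul_scale nul_diff nul.nul_lcons nul_lcons)
    ultimately show ?thesis using cg_trans cg_zero by blast
  qed
  then show ?case by (rule act_nul_gen)
next
  case (nul_rel y z v)
  have "act \<mu> (bas x) (rel \<mu> y z v) \<in> nul \<mu>" for x
  proof -
    let ?e = "ksgn (lt y) x" and ?f = "ksgn (lt z) x" and ?g = "ksgn (lt y) (lt z)"
    \<comment> \<open>[y, z] has negative degree, so it is a combination of letters of one common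
      parity, and \<open>act_lcons_cg\<close> applies to each of them.\<close>
    have 3: "cg \<mu> (act \<mu> (bas x) (act \<mu> (br (lt y) (lt z)) v))
      ((?e * ?f) \<cdot> (act \<mu> (br (lt y) (lt z)) (act \<mu> (bas x) v) - act \<mu> (g_bracket (br (lt y) (lt z)) (bas x)) v))"
    proof -
      have "cg \<mu> (act \<mu> (bas x) (act \<mu> B v))
          ((?e * ?f) \<cdot> (act \<mu> B (act \<mu> (bas x) v) - act \<mu> (g_bracket B (bas x)) v))"
        if B: "\<And>b. b \<in> keys B \<Longrightarrow> b \<in> range lt \<and> gpar b = (gpar (lt y) + gpar (lt z)) mod 2" for B
      proof (induction rule: pm_keys_induct[of _ B])
        case (basis b)
        then obtain u where u: "b = lt u" "gpar (lt u) = (gpar (lt y) + gpar (lt z)) mod 2" using B by blast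
        have "ksgn (lt u) x = ?e * ?f"
          unfolding u(2) by (metis sgn_mod mult.commute)
        then show ?case using act_lcons_cg[of \<mu> x u v] by (simp add: u(1) act_lt)
      next
        case (add X Y)
        show ?case using cg_add[OF add] by (simp add: t_lin g_bracket_linear algebra_simps cs.scale_right_distrib)
      next
        case (scale c X)
        show ?case using cg_scale[OF scale, of c]
          by (simp add: t_lin g_bracket_linear cs.scale_right_diff_distrib mult.commute)
      qed (simp_all add: t_lin g_bracket_linear cg_refl)
      moreover have "b \<in> range lt \<and> gpar b = (gpar (lt y) + gpar (lt z)) mod 2" if "b \<in> keys (br (lt y) (lt z))" for b
        using that gdeg_br[OF that] gpar_br[OF that] range_lt[of "lt y"] range_lt[of "lt z"] range_lt[of b] by auto
      ultimately show ?thesis by blast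
    qed
    let ?E = "\<lambda>y z. (ksgn (lt y) x \<cdot> (ksgn (lt z) x \<cdot> (lcons y (lcons z (act \<mu> (bas x) v)) - lcons y (act \<mu> (br (lt z) x) v))
      - (ksgn (lt z) (lt y) * ksgn (lt z) x) \<cdot> (lcons z (act \<mu> (br (lt y) x) v)
        - act \<mu> (g_bracket (bas (lt z)) (br (lt y) x)) v)))"
    let ?E3 = "(?e * ?f) \<cdot> (act \<mu> (br (lt y) (lt z)) (act \<mu> (bas x) v) - act \<mu> (g_bracket (br (lt y) (lt z)) (bas x)) v)"
    have "cg \<mu> (act \<mu> (bas x) (rel \<mu> y z v)) (?E y z - ?g \<cdot> ?E z y - ?E3)"
      unfolding rel_def t_lin by (intro cg_diff cg_scale act_cons2_cg 3)
    moreover have "?E y z - ?g \<cdot> ?E z y - ?E3 = (?e * ?f) \<cdot> rel \<mu> y z (act \<mu> (bas x) v)"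
    proof -
      have J: "act \<mu> (g_bracket (br (lt y) (lt z)) (bas x)) v =
          act \<mu> (g_bracket (bas (lt y)) (br (lt z) x)) v - ?g \<cdot> act \<mu> (g_bracket (bas (lt z)) (br (lt y) x)) v"
        by (simp add: g_jacobi[of y "lt z" x] t_lin)
      show ?thesis
        using gpar_cases[of "lt y"] gpar_cases[of "lt z"] gpar_cases[of x]
        unfolding J rel_def
        by (elim disjE; simp add: cs.scale_right_diff_distrib cscale_minus_one algebra_simps)
    qed
    ultimately show ?thesis using cg_trans cg_zero nul_scale nul.nul_rel by metis
  qed
  then show ?case by (rule act_nul_gen)
qed (auto simp: t_lin intro: nul.intros)

section \<open>Supercommutators act as brackets\<close>

lemma act_comm_hom_left:
  assumes "\<And>a. cg \<mu> (act \<mu> (bas a) (act \<mu> (bas b) v)) (ksgn a b \<cdot> act \<mu> (bas b) (act \<mu> (bas a) v) + act \<mu> (br a b) v)"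
    and "\<And>a. a \<in> keys X \<Longrightarrow> gpar a = q"
  shows "cg \<mu> (act \<mu> X (act \<mu> (bas b) v)) ((- 1) ^ (q * gpar b) \<cdot> act \<mu> (bas b) (act \<mu> X v) + act \<mu> (g_bracket X (bas b)) v)"
proof (induction rule: pm_keys_induct[of _ X])
  case (basis a)
  then show ?case using assms by force
next
  case (add X Y)
  show ?case using cg_add[OF add] by (simp add: t_lin g_bracket_linear algebra_simps cs.scale_right_distrib)
next
  case (scale c X)
  show ?case using cg_scale[OF scale, of c]
    by (simp add: t_lin g_bracket_linear cs.scale_right_distrib mult.commute)
qed (simp_all add: t_lin g_bracket_linear cg_refl)

lemma act_comm_hom_right:
  assumes "\<And>b. cg \<mu> (act \<mu> (bas a) (act \<mu> (bas b) v)) (ksgn a b \<cdot> act \<mu> (bas b) (act \<mu> (bas a) v) + act \<mu> (br a b) v)"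
    and "\<And>a. a \<in> keys X \<Longrightarrow> gpar a = q"
  shows "cg \<mu> (act \<mu> (bas a) (act \<mu> X v)) ((- 1) ^ (gpar a * q) \<cdot> act \<mu> X (act \<mu> (bas a) v) + act \<mu> (g_bracket (bas a) X) v)"
proof (induction rule: pm_keys_induct[of _ X])
  case (basis b)
  then show ?case using assms by force
next
  case (add X Y)
  show ?case using cg_add[OF add] by (simp add: t_lin g_bracket_linear algebra_simps cs.scale_right_distrib)
next
  case (scale c X)
  show ?case using cg_scale[OF scale, of c]
    by (simp add: t_lin g_bracket_linear cs.scale_right_distrib mult.commute)
qed (simp_all add: t_lin g_bracket_linear cg_refl)

lemma act_comm_lt:
  "cg \<mu> (act \<mu> (bas a) (lcons y v)) (ksgn a (lt y) \<cdot> lcons y (act \<mu> (bas a) v) + act \<mu> (br a (lt y)) v)"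
  "cg \<mu> (lcons y (act \<mu> (bas a) v)) (ksgn (lt y) a \<cdot> act \<mu> (bas a) (lcons y v) + act \<mu> (br (lt y) a) v)"
proof -
  show "cg \<mu> (act \<mu> (bas a) (lcons y v)) (ksgn a (lt y) \<cdot> lcons y (act \<mu> (bas a) v) + act \<mu> (br a (lt y)) v)"
    using act_lcons_cg[of \<mu> a y v]
    by (simp add: g_skew t_lin cs.scale_right_diff_distrib mult.commute[of "gpar a"])
  have "cg \<mu> (ksgn (lt y) a \<cdot> act \<mu> (bas a) (lcons y v)) (lcons y (act \<mu> (bas a) v) - act \<mu> (br (lt y) a) v)"
    using cg_scale[OF act_lcons_cg[of \<mu> a y v], of "ksgn (lt y) a"] by (simp add: neg_one_sq)
  from cg_add[OF cg_sym[OF this] cg_refl[of \<mu> "act \<mu> (br (lt y) a) v"]]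
  show "cg \<mu> (lcons y (act \<mu> (bas a) v)) (ksgn (lt y) a \<cdot> act \<mu> (bas a) (lcons y v) + act \<mu> (br (lt y) a) v)"
    by (simp add: algebra_simps)
qed

text \<open>Induction on the word. Removing the first letter y requires the claim for (a, b),
  ([y, a], b) and (a, [y, b]), so a and b are arbitrary in the induction. For the empty word it is
  \<open>F_rep\<close>; a negative a or b falls under \<open>act_comm_lt\<close>. The double
  brackets are matched by \<open>g_jacobi\<close>.\<close>

lemma act_comm_basis:
  "cg \<mu> (act \<mu> (bas a) (act \<mu> (bas b) (bas (w, e)))) (ksgn a b \<cdot> act \<mu> (bas b) (act \<mu> (bas a) (bas (w, e))) + act \<mu> (br a b) (bas (w, e)))"
proof (induction w arbitrary: a b)
  case Nil
  have e: "bas ([], e) = emb (bas e)" by (simp add: emb_def)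
  consider y where "b = lt y" | y where "a = lt y" | "gdeg a \<ge> 0" "gdeg b \<ge> 0"
    using range_lt[of a] range_lt[of b] by fastforce
  then show ?case
  proof cases
    case 3
    have "br a b \<in> g_ge0" using 3 gdeg_br[of _ a b] by (force simp: g_ge0_def)
    then show ?thesis
      using 3 by (simp add: e act_emb act_emb_ge0 F_rep emb_linear cg_refl)
  qed (use act_comm_lt in \<open>simp_all add: act_lt\<close>)
next
  case (Cons y w)
  let ?v = "bas (w, e)"
  have e: "bas (y # w, e) = lcons y ?v" by (simp add: lcons_def)
  consider z where "b = lt z" | z where "a = lt z" | "gdeg a \<ge> 0" "gdeg b \<ge> 0"
    using range_lt[of a] range_lt[of b] by fastforce
  then show ?case
  proof cases
    case 3
    have step: "cg \<mu> (act \<mu> (bas a) (act \<mu> (bas b) (lcons y ?v)))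
      (ksgn (lt y) b \<cdot> (ksgn (lt y) a \<cdot> (lcons y (ksgn a b \<cdot> act \<mu> (bas b) (act \<mu> (bas a) ?v) + act \<mu> (br a b) ?v)
         - ((- 1) ^ (((gpar (lt y) + gpar a) mod 2) * gpar b) \<cdot> act \<mu> (bas b) (act \<mu> (br (lt y) a) ?v)
            + act \<mu> (g_bracket (br (lt y) a) (bas b)) ?v))
       - ((- 1) ^ (gpar a * ((gpar (lt y) + gpar b) mod 2)) \<cdot> act \<mu> (br (lt y) b) (act \<mu> (bas a) ?v)
            + act \<mu> (g_bracket (bas a) (br (lt y) b)) ?v)))"
    proof -
      have "act \<mu> (bas a) (act \<mu> (bas b) (lcons y ?v)) =
        ksgn (lt y) b \<cdot> (ksgn (lt y) a \<cdot> (lcons y (act \<mu> (bas a) (act \<mu> (bas b) ?v)) - act \<mu> (br (lt y) a) (act \<mu> (bas b) ?v))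
          - act \<mu> (bas a) (act \<mu> (br (lt y) b) ?v))"
        using 3 by (simp add: act_lcons t_lin)
      then show ?thesis
        by (simp only:) (rule cg_scale[OF cg_diff[OF cg_scale[OF cg_diff[OF cg_lcons[OF Cons.IH]
            act_comm_hom_left[OF Cons.IH gpar_br]]] act_comm_hom_right[OF Cons.IH gpar_br]]])
    qed
    have ba: "act \<mu> (bas b) (act \<mu> (bas a) (lcons y ?v)) =
      ksgn (lt y) a \<cdot> (ksgn (lt y) b \<cdot> (lcons y (act \<mu> (bas b) (act \<mu> (bas a) ?v)) - act \<mu> (br (lt y) b) (act \<mu> (bas a) ?v))
        - act \<mu> (bas b) (act \<mu> (br (lt y) a) ?v))"
      using 3 by (simp add: act_lcons t_lin)
    have c: "cg \<mu> (act \<mu> (br a b) (lcons y ?v))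
      ((- 1) ^ (gpar (lt y) * ((gpar a + gpar b) mod 2)) \<cdot> (lcons y (act \<mu> (br a b) ?v)
        - act \<mu> (g_bracket (bas (lt y)) (br a b)) ?v))"
      by (intro act_lcons_cg_hom gpar_br)
    show ?thesis
      unfolding e
      apply (rule cg_trans[OF step])
      apply (rule cg_sym)
      apply (rule cg_trans[OF cg_add[OF cg_refl c]])
      unfolding ba g_jacobi[of y a b]
      using gpar_cases[of "lt y"] gpar_cases[of a] gpar_cases[of b]
      by (elim disjE; simp add: t_lin cs.scale_right_diff_distrib cs.scale_right_distrib cscale_minus_one algebra_simps cg_refl)
  qed (use act_comm_lt in \<open>simp_all add: act_lt e\<close>)
qed

lemma act_comm:
  "cg \<mu> (act \<mu> (bas a) (act \<mu> (bas b) v)) (ksgn a b \<cdot> act \<mu> (bas b) (act \<mu> (bas a) v) + act \<mu> (br a b) v)"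
proof (induction v rule: pm_induct)
  case (basis k)
  then show ?case using act_comm_basis by (cases k) simp
next
  case (add u v)
  show ?case using cg_add[OF add] by (simp add: t_lin algebra_simps cs.scale_right_distrib)
next
  case (scale c v)
  show ?case using cg_scale[OF scale, of c]
    by (simp add: t_lin cs.scale_right_distrib mult.commute)
qed (simp add: t_lin cg_refl)

section \<open>The model as a module over U(g)\<close>

definition tact :: "weight \<Rightarrow> tens_alg \<Rightarrow> tmod \<Rightarrow> tmod" where
  "tact \<mu> p v = lin_ext (\<lambda>w. foldr (\<lambda>b. act \<mu> (bas b)) (letters w) v) p"

lemma foldr_act_linear:
  "foldr (\<lambda>b. act \<mu> (bas b)) bs (u + v) = foldr (\<lambda>b. act \<mu> (bas b)) bs u + foldr (\<lambda>b. act \<mu> (bas b)) bs v"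
  "foldr (\<lambda>b. act \<mu> (bas b)) bs (c \<cdot> v) = c \<cdot> foldr (\<lambda>b. act \<mu> (bas b)) bs v"
  "foldr (\<lambda>b. act \<mu> (bas b)) bs 0 = 0"
  by (induction bs) (simp_all add: t_lin)

lemma tact_linear:
  "tact \<mu> (p + q) v = tact \<mu> p v + tact \<mu> q v" "tact \<mu> (c \<cdot> p) v = c \<cdot> tact \<mu> p v"
  "tact \<mu> (p - q) v = tact \<mu> p v - tact \<mu> q v" "tact \<mu> 0 v = 0"
  "tact \<mu> p (u + v) = tact \<mu> p u + tact \<mu> p v" "tact \<mu> p (c \<cdot> v) = c \<cdot> tact \<mu> p v" "tact \<mu> p 0 = 0"
  by (simp_all add: tact_def lin_ext_add lin_ext_scale lin_ext_diff foldr_act_linear lin_ext_fun_add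
      lin_ext_fun_scale lin_ext_fun_zero)

lemma tact_mult: "tact \<mu> (p * q) v = tact \<mu> p (tact \<mu> q v)"
proof (induction p rule: pm_induct)
  case (basis a)
  show ?case
  proof (induction q rule: pm_induct)
    case (basis b)
    show ?case by (simp add: mult_single tact_def plus_fword_def)
  qed (simp_all add: tact_linear distrib_left cscale_mult_right)
qed (simp_all add: tact_linear distrib_right cscale_mult_left)

lemma tact_g_to_tens: "tact \<mu> (g_to_tens x) v = act \<mu> x v"
proof (induction x rule: pm_induct)
  case (basis a)
  then show ?case by (simp add: g_to_tens_def tact_def)
qed (simp_all add: g_to_tens_def lin_ext_add lin_ext_scale tact_linear t_lin)

lemma tact_nul: "v \<in> nul \<mu> \<Longrightarrow> tact \<mu> p v \<in> nul \<mu>"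
proof (induction p rule: pm_induct)
  case (basis a)
  have "foldr (\<lambda>b. act \<mu> (bas b)) bs v \<in> nul \<mu>" for bs
    using basis by (induction bs) (auto intro: act_nul)
  then show ?case by (simp add: tact_def)
qed (auto simp: tact_linear intro: nul.intros)

lemma tact_U_ideal: "p \<in> U_ideal \<Longrightarrow> tact \<mu> p v \<in> nul \<mu>"
  unfolding U_ideal_def
proof (induction rule: cs.span_induct_alt)
  case (step c x y)
  then obtain p r q where x: "x = p * r * q" and r: "r \<in> U_rels" by blast
  have "tact \<mu> r u \<in> nul \<mu>" for u
  proof -
    obtain a b where "r = g_to_tens (bas a) * g_to_tens (bas b)
        - ksgn a b \<cdot> (g_to_tens (bas b) * g_to_tens (bas a)) - g_to_tens (br a b)"
      using r unfolding U_rels_def by blast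
    then show ?thesis
      using act_comm[of \<mu> a b u] by (simp add: tact_linear tact_mult tact_g_to_tens cg_def diff_diff_eq)
  qed
  then have "tact \<mu> x v \<in> nul \<mu>" by (simp add: x tact_mult tact_nul)
  then show ?case using step by (auto simp: tact_linear intro: nul.intros)
qed (simp add: tact_linear nul.intros)

text \<open>Acts through a chosen representative of u. Another choice changes the result by an
  element of \<open>nul\<close>, so the rules in u hold as congruences, while linearity in the
  vector is exact.\<close>

definition uact :: "weight \<Rightarrow> ualg \<Rightarrow> tmod \<Rightarrow> tmod" where
  "uact \<mu> u = tact \<mu> (rep_ualg u)"

lemma uact_abs: "cg \<mu> (uact \<mu> (abs_ualg p) v) (tact \<mu> p v)"
proof -
  have "U_cong p p" by (simp add: U_cong_def U_ideal_def cs.span_zero)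
  then have "U_cong (rep_ualg (abs_ualg p)) p" by (rule Quotient_rep_abs[OF Quotient_ualg])
  then show ?thesis
    unfolding cg_def uact_def tact_linear(3)[symmetric] U_cong_def by (rule tact_U_ideal)
qed

lemma ualg_abs_rep: "abs_ualg (rep_ualg u) = u"
  by (rule Quotient_abs_rep[OF Quotient_ualg])

lemma uact_rules:
  "cg \<mu> (uact \<mu> (u + u') v) (uact \<mu> u v + uact \<mu> u' v)"
  "cg \<mu> (uact \<mu> (uscale c u) v) (c \<cdot> uact \<mu> u v)"
  "cg \<mu> (uact \<mu> (u * u') v) (uact \<mu> u (uact \<mu> u' v))"
  "cg \<mu> (uact \<mu> (gU x) v) (act \<mu> x v)"
  "uact \<mu> u (v + w) = uact \<mu> u v + uact \<mu> u w"
  "uact \<mu> u (c \<cdot> v) = c \<cdot> uact \<mu> u v"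
proof -
  let ?r = rep_ualg
  have "u + u' = abs_ualg (?r u + ?r u')" by (metis plus_ualg.abs_eq ualg_abs_rep)
  then show "cg \<mu> (uact \<mu> (u + u') v) (uact \<mu> u v + uact \<mu> u' v)"
    using uact_abs[of \<mu> "?r u + ?r u'" v] by (simp add: tact_linear uact_def)
  have "uscale c u = abs_ualg (c \<cdot> ?r u)" by (metis uscale.abs_eq ualg_abs_rep)
  then show "cg \<mu> (uact \<mu> (uscale c u) v) (c \<cdot> uact \<mu> u v)"
    using uact_abs[of \<mu> "c \<cdot> ?r u" v] by (simp add: tact_linear uact_def)
  have "u * u' = abs_ualg (?r u * ?r u')" by (metis times_ualg.abs_eq ualg_abs_rep)
  then show "cg \<mu> (uact \<mu> (u * u') v) (uact \<mu> u (uact \<mu> u' v))"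
    using uact_abs[of \<mu> "?r u * ?r u'" v] by (simp add: tact_mult uact_def)
  show "cg \<mu> (uact \<mu> (gU x) v) (act \<mu> x v)"
    using uact_abs[of \<mu> "g_to_tens x" v] by (simp add: tact_g_to_tens gU_def)
qed (simp_all add: uact_def tact_linear)

lemma uact_nul: "v \<in> nul \<mu> \<Longrightarrow> uact \<mu> u v \<in> nul \<mu>"
  by (simp add: uact_def tact_nul)

lemma cg_uact: "cg \<mu> v w \<Longrightarrow> cg \<mu> (uact \<mu> u v) (uact \<mu> u w)"
  using uact_nul[of "v - w" \<mu> u] uact_rules(5)[of \<mu> u "v - w" w] by (simp add: cg_def eq_diff_eq)

definition model :: "weight \<Rightarrow> preind \<Rightarrow> tmod" where
  "model \<mu> = lin_ext (\<lambda>(u, f). uact \<mu> u (emb f))"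

lemma model_linear:
  "model \<mu> (s + s') = model \<mu> s + model \<mu> s'" "model \<mu> (c \<cdot> s) = c \<cdot> model \<mu> s" "model \<mu> 0 = 0"
  "model \<mu> (s - s') = model \<mu> s - model \<mu> s'"
  by (simp_all add: model_def lin_ext_add lin_ext_scale lin_ext_diff)

lemma model_tens: "model \<mu> (u \<otimes> f) = uact \<mu> u (emb f)"
  by (simp add: model_def pre_tens_def)

text \<open>Whatever vanishes in Ind(F) is sent into \<open>nul\<close>, so constraints on the
  coefficients of elements of \<open>nul\<close> prove independence in Ind(F).\<close>

lemma model_rels: "s \<in> cs.span (ind_rels \<mu>) \<Longrightarrow> model \<mu> s \<in> nul \<mu>"
proof (induction rule: cs.span_induct_alt)
  case (step c x y)
  have "model \<mu> x \<in> nul \<mu>"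
    using step(1) unfolding ind_rels_def
  proof (elim UnE; clarsimp simp: model_linear model_tens emb_linear uact_rules(5,6))
    show "uact \<mu> (u + u') (emb f) - uact \<mu> u (emb f) - uact \<mu> u' (emb f) \<in> nul \<mu>" for u u' f
      using uact_rules(1)[of \<mu> u u' "emb f"] by (simp add: cg_def algebra_simps)
    show "uact \<mu> (uscale c u) (emb f) - c \<cdot> uact \<mu> u (emb f) \<in> nul \<mu>" for c u f
      using uact_rules(2)[of \<mu> c u "emb f"] by (simp add: cg_def)
    show "uact \<mu> (u * gU x) (emb f) - uact \<mu> u (emb (F_act \<mu> x f)) \<in> nul \<mu>" if "x \<in> g_ge0" for u x f
      using cg_trans[OF uact_rules(3) cg_uact[OF uact_rules(4)], of \<mu> u x "emb f"] that
      by (simp add: cg_def act_emb_ge0)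
  qed (simp_all add: nul_zero)
  then show ?case using step by (auto simp: model_linear intro: nul.intros)
qed (simp add: model_linear nul.intros)

section \<open>Linear independence in degrees one and two\<close>

lemma lookup_lcons: "lookup (lcons y v) (w, e) = (case w of [] \<Rightarrow> 0 | z # w' \<Rightarrow> if z = y then lookup v (w', e) else 0)"
proof (induction v rule: pm_induct)
  case (basis a)
  then show ?case by (cases a) (auto simp: lcons_def lookup_single when_def split: list.splits)
qed (auto simp: lcons_linear lookup_add split: list.splits)

lemma lookup_emb: "lookup (emb p) (w, e) = (if w = [] then lookup p e else 0)"
  by (induction p rule: pm_induct) (auto simp: emb_linear lookup_add, auto simp: emb_def lookup_single when_def)

text \<open>The central term vanishes: it needs complementary supports, and two supports with at
  most one element each cannot exhaust four indices.\<close>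

lemma br_lt: "br (lt y) (lt z) = (if y = z \<and> y \<noteq> Th then - bas (lt Th) else 0)"
proof (cases y)
  case Th
  have "{i} \<noteq> UNIV" for i :: ix
    by (cases i; auto simp: set_eq_iff split: ix.splits)
  then show ?thesis
    by (cases z) (simp_all add: Th br_Mon k_bracket_one d_t_bas of_kalg_linear psi_eq)
next
  case (Et i)
  have "\<not> (i = j \<and> - {i} = {j})" "{} \<noteq> - {i}" "{k} \<noteq> - {i}" for j k :: ix
    by (cases i; cases k; auto simp: set_eq_iff split: ix.splits)+
  moreover have "kD i (bas (0, {j})) = (if i = j then - bas (0, {}) else 0)" for j
    by (auto simp: kD_def d_t_bas d_xi_bas k_lin sg_insert)
  moreover have "kD i (bas (0, {})) = 0" by (simp add: kD_def d_t_bas d_xi_bas k_lin)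
  ultimately show ?thesis
    unfolding Et
    by (cases z) (auto simp: br_Mon k_bracket_xi[unfolded xi_def] of_kalg_linear of_kalg_bas psi_eq)
qed

lemma neg_cases: "y = Th \<or> y = Et I1 \<or> y = Et I2 \<or> y = Et I3 \<or> y = Et I4"
  by (metis neg.exhaust ix.exhaust)

text \<open>
  The relations are quadratic, so in degree at most two the words \<open>[]\<close>, \<open>[Et i]\<close> and, up to
  $\eta_i\eta_j = -\eta_j\eta_i$ and $2\eta_i^2 = -\Theta$, the words of degree two stay independent.
\<close>

lemma nul_lookup:
  assumes "v \<in> nul \<mu>"
  shows "lookup v ([], e) = 0" "lookup v ([Et i], e) = 0"
    "lookup v ([Th], e) = (\<Sum>i\<in>UNIV. lookup v ([Et i, Et i], e)) / 2"
    "lookup v ([Et i, Et j], e) = lookup v ([Et j, Et i], e)"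
proof -
  have "lookup v ([], e) = 0 \<and> (\<forall>i. lookup v ([Et i], e) = 0) \<and>
    2 * lookup v ([Th], e) = (\<Sum>i\<in>UNIV. lookup v ([Et i, Et i], e)) \<and>
    (\<forall>i j. lookup v ([Et i, Et j], e) = lookup v ([Et j, Et i], e))"
    using assms
  proof (induction rule: nul.induct)
    case (nul_rel y z v)
    have "act \<mu> (br (lt y) (lt z)) v = (if y = z \<and> y \<noteq> Th then - lcons Th v else 0)"
      by (auto simp: br_lt t_lin act_lt simp del: lt.simps)
    then have r: "rel \<mu> y z v = lcons y (lcons z v) - ksgn (lt y) (lt z) \<cdot> lcons z (lcons y v)
        + (if y = z \<and> y \<noteq> Th then lcons Th v else 0)"
      by (auto simp: rel_def)
    show ?case
      unfolding r
      using neg_cases[of y] neg_cases[of z]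
      by (elim disjE; hypsubst; auto simp: lookup_add lookup_minus lookup_lcons sum_ix)
  next
    case (nul_lcons v y)
    then show ?case by (auto simp: lookup_lcons intro!: sum.neutral)
  qed (simp_all add: lookup_add lookup_lcons sum.distrib sum_distrib_left[symmetric] distrib_left)
  then show "lookup v ([], e) = 0" "lookup v ([Et i], e) = 0"
    "lookup v ([Th], e) = (\<Sum>i\<in>UNIV. lookup v ([Et i, Et i], e)) / 2"
    "lookup v ([Et i, Et j], e) = lookup v ([Et j, Et i], e)"
    by (auto simp: mult.commute)
qed

lemma model_cons: 
  "cg \<mu> (model \<mu> (\<eta> i \<otimes> f)) (lcons (Et i) (emb f))"
  "cg \<mu> (model \<mu> (gU (mon {}) \<otimes> f)) (lcons Th (emb f))"
  "cg \<mu> (model \<mu> ((\<eta> i * \<eta> j) \<otimes> f)) (lcons (Et i) (lcons (Et j) (emb f)))"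
proof -
  have e: "\<eta> i = gU (bas (lt (Et i)))" for i by (simp add: \<eta>_def mon_def)
  have m: "mon {} = bas (lt Th)" by (simp add: mon_def)
  have 1: "cg \<mu> (uact \<mu> (gU (bas (lt y))) v) (lcons y v)" for y v
    using uact_rules(4)[of \<mu> "bas (lt y)" v] by (simp only: act_lt)
  show "cg \<mu> (model \<mu> (\<eta> i \<otimes> f)) (lcons (Et i) (emb f))"
    "cg \<mu> (model \<mu> (gU (mon {}) \<otimes> f)) (lcons Th (emb f))"
    unfolding model_tens e m by (rule 1)+
  show "cg \<mu> (model \<mu> ((\<eta> i * \<eta> j) \<otimes> f)) (lcons (Et i) (lcons (Et j) (emb f)))"
    unfolding model_tens e
    by (rule cg_trans[OF uact_rules(3)]) (rule cg_trans[OF 1 cg_lcons[OF 1]])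
qed

lemma indep_degree_1:
  assumes "(\<Sum>i\<in>UNIV. \<eta> i \<otimes> f i) \<in> cs.span (ind_rels \<mu>)"
  shows "f i = 0"
proof (rule poly_mapping_eqI)
  fix e
  have s: "cg \<mu> (model \<mu> (\<Sum>i\<in>A. \<eta> i \<otimes> f i)) (\<Sum>i\<in>A. lcons (Et i) (emb (f i)))" for A
    by (induction A rule: infinite_finite_induct) (auto simp: model_linear cg_refl intro: cg_add model_cons)
  have "(\<Sum>i\<in>UNIV. lcons (Et i) (emb (f i))) \<in> nul \<mu>"
    using cg_trans[OF cg_sym[OF s]] model_rels[OF assms] cg_zero by blast
  from nul_lookup(2)[OF this, of i e] show "lookup (f i) e = lookup 0 e"
    by (simp add: lookup_sum lookup_lcons lookup_emb)
qed

text \<open>Since 2\<eta>_i^2 = -\<Theta>, the diagonal of g contributes -\<Theta>/2 times its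
  trace. Since distinct \<eta>_i and \<eta>_j anticommute, the remaining terms depend only on the
  antisymmetric part of g.\<close>

lemma indep_degree_2:
  assumes "gU (mon {}) \<otimes> f + (\<Sum>i\<in>UNIV. \<Sum>j\<in>UNIV. (\<eta> i * \<eta> j) \<otimes> g i j) \<in> cs.span (ind_rels \<mu>)"
  shows "f = (1/2) \<cdot> (\<Sum>i\<in>UNIV. g i i)" "g i j = g j i"
proof -
  let ?t = "\<lambda>i j. lcons (Et i) (lcons (Et j) (emb (g i j)))"
  have s: "cg \<mu> (model \<mu> (\<Sum>j\<in>A. (\<eta> i * \<eta> j) \<otimes> g i j)) (\<Sum>j\<in>A. ?t i j)" for A i
    by (induction A rule: infinite_finite_induct) (auto simp: model_linear cg_refl intro: cg_add model_cons)
  have "cg \<mu> (model \<mu> (\<Sum>i\<in>A. \<Sum>j\<in>UNIV. (\<eta> i * \<eta> j) \<otimes> g i j)) (\<Sum>i\<in>A. \<Sum>j\<in>UNIV. ?t i j)" for A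
    by (induction A rule: infinite_finite_induct) (auto simp: model_linear cg_refl intro: cg_add s)
  then have "cg \<mu> (model \<mu> (gU (mon {}) \<otimes> f + (\<Sum>i\<in>UNIV. \<Sum>j\<in>UNIV. (\<eta> i * \<eta> j) \<otimes> g i j)))
      (lcons Th (emb f) + (\<Sum>i\<in>UNIV. \<Sum>j\<in>UNIV. ?t i j))"
    unfolding model_linear by (intro cg_add model_cons)
  then have n: "lcons Th (emb f) + (\<Sum>i\<in>UNIV. \<Sum>j\<in>UNIV. ?t i j) \<in> nul \<mu>"
    using cg_trans[OF cg_sym] model_rels[OF assms] cg_zero by blast
  have l: "lookup (lcons Th (emb f) + (\<Sum>i\<in>UNIV. \<Sum>j\<in>UNIV. ?t i j)) ([Et a, Et b], e) = lookup (g a b) e" for a b e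
  proof -
    have 1: "lookup (?t x y) ([Et a, Et b], e) = (if a = x then if b = y then lookup (g x y) e else 0 else 0)" for x y
      by (simp add: lookup_lcons lookup_emb)
    have 2: "(\<Sum>y\<in>UNIV. if a = x then if b = y then lookup (g x y) e else 0 else 0) =
        (if a = x then lookup (g x b) e else 0)" for x
      by simp
    have 3: "lookup (lcons Th (emb f)) ([Et a, Et b], e) = 0" by (simp add: lookup_lcons)
    show ?thesis unfolding lookup_add lookup_sum 1 2 3 by simp
  qed
  have lt: "lookup (lcons Th (emb f) + (\<Sum>i\<in>UNIV. \<Sum>j\<in>UNIV. ?t i j)) ([Th], e) = lookup f e" for e
    by (simp add: lookup_add lookup_sum lookup_lcons lookup_emb)
  show "f = (1/2) \<cdot> (\<Sum>i\<in>UNIV. g i i)"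
    using nul_lookup(3)[OF n] unfolding l lt by (intro poly_mapping_eqI) (simp add: lookup_sum)
  show "g i j = g j i"
    using nul_lookup(4)[OF n] unfolding l by (intro poly_mapping_eqI) simp
qed

section \<open>Linearized tensors\<close>

text \<open>Extend a basis of R to a basis of the whole space and send the part from R to
  zero.\<close>

lemma linear_kernel_exists:
  assumes "cs.subspace R"
  shows "\<exists>q :: ('a \<Rightarrow>\<^sub>0 complex) \<Rightarrow> ('a \<Rightarrow>\<^sub>0 complex). (\<forall>s t. q (s + t) = q s + q t) \<and> (\<forall>c s. q (c \<cdot> s) = c \<cdot> q s) \<and> (\<forall>s. q s = 0 \<longleftrightarrow> s \<in> R)"
proof -
  interpret vp: vector_space_pair "cscale :: complex \<Rightarrow> ('a \<Rightarrow>\<^sub>0 complex) \<Rightarrow> _" "cscale :: complex \<Rightarrow> ('a \<Rightarrow>\<^sub>0 complex) \<Rightarrow> _" ..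
  obtain B where B: "B \<subseteq> R" "cs.independent B" "R \<subseteq> cs.span B"
    using cs.maximal_independent_subset by metis
  let ?C = "cs.extend_basis B"
  have C: "cs.independent ?C" "B \<subseteq> ?C" "cs.span ?C = UNIV"
    using cs.extend_basis_superset[OF B(2)] cs.independent_extend_basis[OF B(2)] cs.span_extend_basis[OF B(2)]
    by auto
  obtain q where q: "Vector_Spaces.linear cscale cscale q" "\<forall>x\<in>?C. q x = (if x \<in> B then 0 else x)"
    using vp.linear_independent_extend[OF C(1), of "\<lambda>x. if x \<in> B then 0 else x"] by blast
  have add: "q (s + t) = q s + q t" and scale: "q (c \<cdot> s) = c \<cdot> q s" for s t c
    using q(1) by (simp_all add: vp.linear_add vp.linear_scale)
  have zero: "q 0 = 0" using scale[of 0 0] by simp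
  have 1: "q s = 0" if "s \<in> cs.span B" for s
    using that
  proof (induction rule: cs.span_induct_alt)
    case (step c x y)
    then show ?case using q(2) C(2) by (auto simp: add scale)
  qed (rule zero)
  have 2: "q s = s" if "s \<in> cs.span (?C - B)" for s
    using that
  proof (induction rule: cs.span_induct_alt)
    case (step c x y)
    then show ?case using q(2) by (auto simp: add scale)
  qed (rule zero)
  have "q s = 0 \<longleftrightarrow> s \<in> R" for s
  proof
    assume s: "q s = 0"
    have "s \<in> cs.span (B \<union> (?C - B))" using C by (simp add: Un_absorb1)
    then obtain u w where "s = u + w" "u \<in> cs.span B" "w \<in> cs.span (?C - B)"
      unfolding cs.span_Un by blast
    with s have "s \<in> cs.span B" using 1[of u] 2[of w] by (simp add: add)
    then show "s \<in> R" using B(1) assms cs.span_minimal by blast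
  qed (use B(3) 1 in blast)
  with add scale show ?thesis by blast
qed

text \<open>
  The elements of \<^term>\<open>Ind \<mu>\<close> are bare cosets; a linear map with the right kernel replaces
  the quotient by an honest vector space.
\<close>

definition qm :: "weight \<Rightarrow> preind \<Rightarrow> preind" where
  "qm \<mu> = (SOME q. (\<forall>s t. q (s + t) = q s + q t) \<and> (\<forall>c s. q (c \<cdot> s) = c \<cdot> q s) \<and>
     (\<forall>s. q s = 0 \<longleftrightarrow> s \<in> cs.span (ind_rels \<mu>)))"

lemma qm:
  "qm \<mu> (s + t) = qm \<mu> s + qm \<mu> t" "qm \<mu> (c \<cdot> s) = c \<cdot> qm \<mu> s"
  "qm \<mu> s = 0 \<longleftrightarrow> s \<in> cs.span (ind_rels \<mu>)"
proof -
  have "(\<forall>s t. qm \<mu> (s + t) = qm \<mu> s + qm \<mu> t) \<and> (\<forall>c s. qm \<mu> (c \<cdot> s) = c \<cdot> qm \<mu> s) \<and>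
     (\<forall>s. qm \<mu> s = 0 \<longleftrightarrow> s \<in> cs.span (ind_rels \<mu>))"
    unfolding qm_def by (rule someI_ex[OF linear_kernel_exists[OF cs.subspace_span]])
  then show "qm \<mu> (s + t) = qm \<mu> s + qm \<mu> t" "qm \<mu> (c \<cdot> s) = c \<cdot> qm \<mu> s"
    "qm \<mu> s = 0 \<longleftrightarrow> s \<in> cs.span (ind_rels \<mu>)" by blast+
qed

lemma qm_linear:
  "qm \<mu> 0 = 0" "qm \<mu> (s - t) = qm \<mu> s - qm \<mu> t" "qm \<mu> (- s) = - qm \<mu> s"
proof -
  show z: "qm \<mu> 0 = 0" using qm(2)[of \<mu> 0 0] by simp
  show d: "qm \<mu> (s - t) = qm \<mu> s - qm \<mu> t" for s t using qm(1)[of \<mu> "s - t" t] by simp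
  show "qm \<mu> (- s) = - qm \<mu> s" using d[of 0 s] by (simp add: z)
qed

lemma ind_cls_eq_iff: "ind_cls \<mu> s = ind_cls \<mu> t \<longleftrightarrow> qm \<mu> s = qm \<mu> t"
proof
  assume "ind_cls \<mu> s = ind_cls \<mu> t"
  moreover have "s \<in> ind_cls \<mu> s" by (simp add: ind_cls_def cs.span_zero)
  ultimately have "s - t \<in> cs.span (ind_rels \<mu>)" by (simp add: ind_cls_def)
  then show "qm \<mu> s = qm \<mu> t" using qm(3)[of \<mu> "s - t"] by (simp add: qm_linear)
next
  assume "qm \<mu> s = qm \<mu> t"
  then have "s - t \<in> cs.span (ind_rels \<mu>)" using qm(3)[of \<mu> "s - t"] by (simp add: qm_linear)
  then show "ind_cls \<mu> s = ind_cls \<mu> t" by (rule ind_cls_eqI)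
qed

definition tn :: "weight \<Rightarrow> ualg \<Rightarrow> poly4 \<Rightarrow> preind" where
  "tn \<mu> u f = qm \<mu> (u \<otimes> f)"

lemma tn_rel: "r \<in> ind_rels \<mu> \<Longrightarrow> qm \<mu> r = 0"
  by (simp add: qm(3) cs.span_base)

lemma tn_linear:
  assumes "f \<in> F_space \<mu>"
  shows "tn \<mu> (u + u') f = tn \<mu> u f + tn \<mu> u' f"
    "f' \<in> F_space \<mu> \<Longrightarrow> tn \<mu> u (f + f') = tn \<mu> u f + tn \<mu> u f'"
    "tn \<mu> (uscale c u) f = c \<cdot> tn \<mu> u f"
    "tn \<mu> u (c \<cdot> f) = c \<cdot> tn \<mu> u f"
    "x \<in> g_ge0 \<Longrightarrow> tn \<mu> (u * gU x) f = tn \<mu> u (F_act \<mu> x f)"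
proof -
  have "(u + u') \<otimes> f - u \<otimes> f - u' \<otimes> f \<in> ind_rels \<mu>"
    "f' \<in> F_space \<mu> \<Longrightarrow> u \<otimes> (f + f') - u \<otimes> f - u \<otimes> f' \<in> ind_rels \<mu>"
    "uscale c u \<otimes> f - c \<cdot> (u \<otimes> f) \<in> ind_rels \<mu>" "u \<otimes> (c \<cdot> f) - c \<cdot> (u \<otimes> f) \<in> ind_rels \<mu>"
    "x \<in> g_ge0 \<Longrightarrow> (u * gU x) \<otimes> f - u \<otimes> F_act \<mu> x f \<in> ind_rels \<mu>"
    unfolding ind_rels_def using assms by blast+
  from this[THEN tn_rel]
  show "tn \<mu> (u + u') f = tn \<mu> u f + tn \<mu> u' f"
    "f' \<in> F_space \<mu> \<Longrightarrow> tn \<mu> u (f + f') = tn \<mu> u f + tn \<mu> u f'"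
    "tn \<mu> (uscale c u) f = c \<cdot> tn \<mu> u f" "tn \<mu> u (c \<cdot> f) = c \<cdot> tn \<mu> u f"
    "x \<in> g_ge0 \<Longrightarrow> tn \<mu> (u * gU x) f = tn \<mu> u (F_act \<mu> x f)"
    by (simp_all add: qm qm_linear tn_def diff_diff_eq)
qed

lemma tn_linear':
  assumes "f \<in> F_space \<mu>"
  shows "tn \<mu> (u - u') f = tn \<mu> u f - tn \<mu> u' f" "tn \<mu> (- u) f = - tn \<mu> u f" "tn \<mu> 0 f = 0"
    "f' \<in> F_space \<mu> \<Longrightarrow> tn \<mu> u (f - f') = tn \<mu> u f - tn \<mu> u f'" "tn \<mu> u (- f) = - tn \<mu> u f" "tn \<mu> u 0 = 0"
proof -
  show 1: "tn \<mu> (u - u') f = tn \<mu> u f - tn \<mu> u' f" for u u'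
    using tn_linear(1)[OF assms, of "u - u'" u'] by simp
  show 0: "tn \<mu> 0 f = 0" using 1[of 0 0] by simp
  show "tn \<mu> (- u) f = - tn \<mu> u f" using 1[of 0 u] 0 by simp
  show 2: "f' \<in> F_space \<mu> \<Longrightarrow> tn \<mu> u (f - f') = tn \<mu> u f - tn \<mu> u f'" for f'
    using tn_linear(2)[OF F_space_linear(2)[OF assms, of f'], of f' u] by simp
  show 3: "tn \<mu> u 0 = 0" using tn_linear(4)[OF assms, of u 0] by simp
  show "tn \<mu> u (- f) = - tn \<mu> u f"
    using tn_linear(4)[OF assms, of u "- 1"] by (simp add: cscale_minus_one)
qed

section \<open>Commutation rules in U(g)\<close>

lemma gU_linear:
  "gU (x + y) = gU x + gU y" "gU (c \<cdot> x) = uscale c (gU x)" "gU (x - y) = gU x - gU y" "gU (- x) = - gU x" "gU 0 = 0"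
  by (simp_all add: gU_def g_to_tens_def lin_ext_add lin_ext_scale lin_ext_diff lin_ext_uminus
      plus_ualg.abs_eq uscale.abs_eq minus_ualg.abs_eq uminus_ualg.abs_eq zero_ualg_def)

lemma uscale_mult_left: "uscale c u * u' = uscale c (u * u')"
  by transfer (simp add: cscale_mult_left U_cong_def U_ideal_def cs.span_zero)

lemma gU_commute_bas: "gU (bas a) * gU (bas b) = uscale (ksgn a b) (gU (bas b) * gU (bas a)) + gU (br a b)"
proof -
  have "g_to_tens (bas a) * g_to_tens (bas b) - ksgn a b \<cdot> (g_to_tens (bas b) * g_to_tens (bas a))
      - g_to_tens (br a b) \<in> U_rels"
    unfolding U_rels_def by blast
  then have "1 * (g_to_tens (bas a) * g_to_tens (bas b) - ksgn a b \<cdot> (g_to_tens (bas b) * g_to_tens (bas a))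
      - g_to_tens (br a b)) * 1 \<in> U_ideal"
    unfolding U_ideal_def by (intro cs.span_base) blast
  then show ?thesis
    by (simp add: gU_def times_ualg.abs_eq uscale.abs_eq plus_ualg.abs_eq ualg.abs_eq_iff U_cong_def diff_diff_eq)
qed

lemma gU_commute:
  assumes "\<And>a. a \<in> keys x \<Longrightarrow> gpar a = p" "\<And>b. b \<in> keys y \<Longrightarrow> gpar b = q"
  shows "gU x * gU y = uscale ((- 1) ^ (p * q)) (gU y * gU x) + gU (g_bracket x y)"
proof (induction rule: pm_keys_induct[of _ x])
  case (basis a)
  have "gU (bas a) * gU y = uscale ((- 1) ^ (p * q)) (gU y * gU (bas a)) + gU (g_bracket (bas a) y)"
  proof (induction rule: pm_keys_induct[of _ y])
    case (basis b)
    show ?case using gU_commute_bas[of a b] assms(1)[OF \<open>a \<in> keys x\<close>] assms(2)[OF basis] by simp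
  qed (simp_all add: gU_linear g_bracket_linear algebra_simps us.scale_right_distrib uscale_mult_left uscale_mult_right)
  then show ?case .
qed (simp_all add: gU_linear g_bracket_linear algebra_simps us.scale_right_distrib uscale_mult_left uscale_mult_right)

definition ghom :: "int \<Rightarrow> galg set" where
  "ghom d = {x. \<forall>b\<in>keys x. gdeg b = d}"

lemma ghom_linear:
  "x \<in> ghom d \<Longrightarrow> y \<in> ghom d \<Longrightarrow> x + y \<in> ghom d" "x \<in> ghom d \<Longrightarrow> y \<in> ghom d \<Longrightarrow> x - y \<in> ghom d"
  "x \<in> ghom d \<Longrightarrow> c \<cdot> x \<in> ghom d" "x \<in> ghom d \<Longrightarrow> - x \<in> ghom d" "0 \<in> ghom d"
  using keys_cscale[of c x] keys_diff[of x y] Poly_Mapping.keys_add[of x y]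
  by (auto simp: ghom_def)

lemma ghom_bas: "gdeg b = d \<Longrightarrow> bas b \<in> ghom d"
  by (simp add: ghom_def)

lemma ghom_bracket:
  assumes "x \<in> ghom d" "y \<in> ghom e"
  shows "g_bracket x y \<in> ghom (d + e)"
proof (induction rule: pm_keys_induct[of _ x])
  case a: (basis a)
  show ?case
  proof (induction rule: pm_keys_induct[of _ y])
    case (basis b)
    then show ?case using a assms gdeg_br[of _ a b] by (auto simp: ghom_def)
  qed (auto simp: g_bracket_linear intro: ghom_linear)
qed (auto simp: g_bracket_linear intro: ghom_linear)

lemma ghom_gpar: "x \<in> ghom d \<Longrightarrow> b \<in> keys x \<Longrightarrow> gpar b = nat (d mod 2)"
  by (simp add: ghom_def gpar_gdeg)

lemma gU_anticommute: "x \<in> ghom d \<Longrightarrow> y \<in> ghom e \<Longrightarrow> odd d \<Longrightarrow> odd e \<Longrightarrow> gU x * gU y = gU (g_bracket x y) - gU y * gU x"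
  using gU_commute[of x "nat (d mod 2)" y "nat (e mod 2)"] ghom_gpar[of x d] ghom_gpar[of y e] by (simp add: odd_iff_mod_2_eq_one)

lemma gU_commute_even: "x \<in> ghom d \<Longrightarrow> y \<in> ghom e \<Longrightarrow> even d \<Longrightarrow> gU x * gU y = gU (g_bracket x y) + gU y * gU x"
  using gU_commute[of x "nat (d mod 2)" y "nat (e mod 2)"] ghom_gpar[of x d] ghom_gpar[of y e] by simp

section \<open>The vectors of degree two\<close>

definition wg11 :: galg where "wg11 = mon {I2} + \<i> \<cdot> mon {I1}"
definition wg22 :: galg where "wg22 = mon {I2} - \<i> \<cdot> mon {I1}"
definition wg12 :: galg where "wg12 = - mon {I4} + \<i> \<cdot> mon {I3}"
definition wg21 :: galg where "wg21 = mon {I4} + \<i> \<cdot> mon {I3}"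
definition tt :: galg where "tt = bas (Mon (1, {}))"
definition tm :: "ix \<Rightarrow> galg" where "tm i = bas (Mon (1, {i}))"

text \<open>
  \<open>xpij\<close> and \<open>xmij\<close> are $t w_{ij} \pm w_{ij}^*$, where $\xi_i^* = \partial_i\xi_{1234}$. Together they span
  the component of degree one, and their brackets with $\mathfrak g_{-1}$ only involve
  one of the two copies of $\mathfrak{sl}_2$ each.
\<close>

definition xp11 :: galg where "xp11 = tm I2 + \<i> \<cdot> tm I1 - mon {I1, I3, I4} + \<i> \<cdot> mon {I2, I3, I4}"
definition xp22 :: galg where "xp22 = tm I2 - \<i> \<cdot> tm I1 - mon {I1, I3, I4} - \<i> \<cdot> mon {I2, I3, I4}"
definition xp12 :: galg where "xp12 = - tm I4 + \<i> \<cdot> tm I3 + mon {I1, I2, I3} + \<i> \<cdot> mon {I1, I2, I4}"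
definition xp21 :: galg where "xp21 = tm I4 + \<i> \<cdot> tm I3 - mon {I1, I2, I3} + \<i> \<cdot> mon {I1, I2, I4}"
definition xm11 :: galg where "xm11 = tm I2 + \<i> \<cdot> tm I1 + mon {I1, I3, I4} - \<i> \<cdot> mon {I2, I3, I4}"
definition xm22 :: galg where "xm22 = tm I2 - \<i> \<cdot> tm I1 + mon {I1, I3, I4} + \<i> \<cdot> mon {I2, I3, I4}"
definition xm12 :: galg where "xm12 = - tm I4 + \<i> \<cdot> tm I3 - mon {I1, I2, I3} - \<i> \<cdot> mon {I1, I2, I4}"
definition xm21 :: galg where "xm21 = tm I4 + \<i> \<cdot> tm I3 + mon {I1, I2, I3} - \<i> \<cdot> mon {I1, I2, I4}"

lemmas wg_defs = wg11_def wg22_def wg12_def wg21_def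
lemmas x_defs = xp11_def xp22_def xp12_def xp21_def xm11_def xm22_def xm12_def xm21_def
lemmas g0_defs = e_x_def f_x_def h_x_def e_y_def f_y_def h_y_def tt_def

lemma w_gU: "w11 = gU wg11" "w22 = gU wg22" "w12 = gU wg12" "w21 = gU wg21"
  by (simp_all add: w11_def w22_def w12_def w21_def wg_defs \<eta>_def gU_linear)

lemma g_bracket_diff:
  "g_bracket (x - x') y = g_bracket x y - g_bracket x' y" "g_bracket x (y - y') = g_bracket x y - g_bracket x y'"
  "g_bracket (- x) y = - g_bracket x y" "g_bracket x (- y) = - g_bracket x y"
proof -
  show 1: "g_bracket (x - x') y = g_bracket x y - g_bracket x' y" for x x'
    using g_bracket_linear(1)[of "x - x'" x' y] by simp
  show 2: "g_bracket x (y - y') = g_bracket x y - g_bracket x y'" for y y'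
    using g_bracket_linear(2)[of x "y - y'" y'] by simp
  show "g_bracket (- x) y = - g_bracket x y" "g_bracket x (- y) = - g_bracket x y"
    using 1[of 0 x] 2[of 0 y] by (simp_all add: g_bracket_linear)
qed

lemma psi_xi: "psi (0, {i}) (m, T) = (if m = 0 \<and> i \<notin> T \<and> card T = 3 then - eps {i} T else 0)"
proof -
  have c: "card (- {i}) = 3" by (simp add: Compl_eq_Diff_UNIV card_ix)
  have "T = - {i} \<longleftrightarrow> i \<notin> T \<and> card T = 3"
  proof
    assume T: "i \<notin> T \<and> card T = 3"
    then have "T \<subseteq> - {i}" by auto
    with T c show "T = - {i}" by (intro card_subset_eq) auto
  qed (use c in auto)
  then show ?thesis by (auto simp: psi_eq)
qed

lemma br_xi: "br (Mon (0, {i})) (Mon a) = of_kalg (kD i (bas a)) + psi (0, {i}) a \<cdot> bas Cen"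
  by (simp add: br_Mon k_bracket_xi[unfolded xi_def])

lemma bracket_w_x:
  "g_bracket wg11 xp11 = 0" "g_bracket wg12 xp11 = 0" "g_bracket wg21 xp11 = - (4 \<cdot> e_y)" "g_bracket wg22 xp11 = - (2 \<cdot> tt) - 2 \<cdot> bas Cen + 2 \<cdot> h_y"
  "g_bracket wg11 xp12 = 0" "g_bracket wg12 xp12 = 0" "g_bracket wg21 xp12 = 2 \<cdot> tt + 2 \<cdot> bas Cen + 2 \<cdot> h_y" "g_bracket wg22 xp12 = 4 \<cdot> f_y"
  "g_bracket wg11 xp21 = 4 \<cdot> e_y" "g_bracket wg12 xp21 = 2 \<cdot> tt + 2 \<cdot> bas Cen - 2 \<cdot> h_y" "g_bracket wg21 xp21 = 0" "g_bracket wg22 xp21 = 0"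
  "g_bracket wg11 xp22 = - (2 \<cdot> tt) - 2 \<cdot> bas Cen - 2 \<cdot> h_y" "g_bracket wg12 xp22 = - (4 \<cdot> f_y)" "g_bracket wg21 xp22 = 0" "g_bracket wg22 xp22 = 0"
  "g_bracket wg11 xm11 = 0" "g_bracket wg12 xm11 = - (4 \<cdot> e_x)" "g_bracket wg21 xm11 = 0" "g_bracket wg22 xm11 = - (2 \<cdot> tt) + 2 \<cdot> bas Cen + 2 \<cdot> h_x"
  "g_bracket wg11 xm12 = 4 \<cdot> e_x" "g_bracket wg12 xm12 = 0" "g_bracket wg21 xm12 = 2 \<cdot> tt - 2 \<cdot> bas Cen - 2 \<cdot> h_x" "g_bracket wg22 xm12 = 0"
  "g_bracket wg11 xm21 = 0" "g_bracket wg12 xm21 = 2 \<cdot> tt - 2 \<cdot> bas Cen + 2 \<cdot> h_x" "g_bracket wg21 xm21 = 0" "g_bracket wg22 xm21 = 4 \<cdot> f_x"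
  "g_bracket wg11 xm22 = - (2 \<cdot> tt) + 2 \<cdot> bas Cen - 2 \<cdot> h_x" "g_bracket wg12 xm22 = 0" "g_bracket wg21 xm22 = - (4 \<cdot> f_x)" "g_bracket wg22 xm22 = 0"
  unfolding wg_defs x_defs g0_defs tm_def mon_def
  by (simp_all add: g_bracket_linear g_bracket_diff br_xi kD_def d_t_bas xi_bas d_xi_bas psi_xi sg_insert
      ix_less insert_commute insert_Diff_if k_lin of_kalg_linear of_kalg_bas eps_insert_left,
    (rule poly_mapping_eqI, simp add: lookup_add lookup_minus ring_distribs)+)

text \<open>The identification of g_{-1} with V_x \<otimes> V_y: the first index of w_ij belongs to
  sl_2^x and the second to sl_2^y, with 1 as the highest weight.\<close>

lemma bracket_zero_w:
  "g_bracket e_x wg11 = 0" "g_bracket e_x wg12 = 0" "g_bracket e_x wg21 = wg11" "g_bracket e_x wg22 = wg12"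
  "g_bracket e_y wg11 = 0" "g_bracket e_y wg12 = wg11" "g_bracket e_y wg21 = 0" "g_bracket e_y wg22 = wg21"
  "g_bracket f_x wg11 = wg21" "g_bracket f_x wg12 = wg22" "g_bracket f_x wg21 = 0" "g_bracket f_x wg22 = 0"
  "g_bracket f_y wg11 = wg12" "g_bracket f_y wg12 = 0" "g_bracket f_y wg21 = wg22" "g_bracket f_y wg22 = 0"
  "g_bracket h_x wg11 = wg11" "g_bracket h_x wg12 = wg12" "g_bracket h_x wg21 = - wg21" "g_bracket h_x wg22 = - wg22"
  "g_bracket h_y wg11 = wg11" "g_bracket h_y wg12 = - wg12" "g_bracket h_y wg21 = wg21" "g_bracket h_y wg22 = - wg22"
  "g_bracket tt wg11 = - wg11" "g_bracket tt wg12 = - wg12" "g_bracket tt wg21 = - wg21" "g_bracket tt wg22 = - wg22"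
  "g_bracket (bas Cen) wg11 = 0" "g_bracket (bas Cen) wg12 = 0" "g_bracket (bas Cen) wg21 = 0" "g_bracket (bas Cen) wg22 = 0"
  unfolding wg_defs g0_defs mon_def
  by (simp_all add: g_bracket_linear g_bracket_diff br_zero br_Cen k_bracket_bas kmul_bas d_xi_bas sum_ix sg_insert
      ix_less insert_commute insert_Diff_if k_lin of_kalg_linear of_kalg_bas eps_insert_left,
    (rule poly_mapping_eqI, simp add: lookup_add lookup_minus ring_distribs)+)

abbreviation "wt \<mu> \<equiv> fst (snd (snd \<mu>))"
abbreviation "wc \<mu> \<equiv> snd (snd (snd \<mu>))"
abbreviation "ws \<mu> \<equiv> wt \<mu> + wc \<mu>"
abbreviation "wd \<mu> \<equiv> wt \<mu> - wc \<mu>"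
abbreviation "eX \<equiv> pD X1 X2"
abbreviation "fX \<equiv> pD X2 X1"
abbreviation "hX p \<equiv> pD X1 X1 p - pD X2 X2 p"
abbreviation "eY \<equiv> pD Y1 Y2"
abbreviation "fY \<equiv> pD Y2 Y1"
abbreviation "hY p \<equiv> pD Y1 Y1 p - pD Y2 Y2 p"
abbreviation \<Theta> :: ualg where "\<Theta> \<equiv> gU (mon {})"

lemma F_act_gens:
  "F_act \<mu> e_x p = eX p" "F_act \<mu> f_x p = fX p" "F_act \<mu> h_x p = hX p"
  "F_act \<mu> e_y p = eY p" "F_act \<mu> f_y p = fY p" "F_act \<mu> h_y p = hY p"
  "F_act \<mu> tt p = wt \<mu> \<cdot> p" "F_act \<mu> (bas Cen) p = wc \<mu> \<cdot> p"
  by (simp_all add: F_act_generators pD_def tt_def F_act_bas' F_act_bas_values)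

lemma pD_in_F:
  assumes "p \<in> F_space \<mu>"
  shows "pD X1 X1 p \<in> F_space \<mu>" "pD X1 X2 p \<in> F_space \<mu>" "pD X2 X1 p \<in> F_space \<mu>" "pD X2 X2 p \<in> F_space \<mu>"
    "pD Y1 Y1 p \<in> F_space \<mu>" "pD Y1 Y2 p \<in> F_space \<mu>" "pD Y2 Y1 p \<in> F_space \<mu>" "pD Y2 Y2 p \<in> F_space \<mu>"
  by (simp_all add: pD_F_space assms)

lemma tn_zero: "tn \<mu> u 0 = 0" 
  using tn_linear'(6)[OF F_space_linear(4)] .

lemma ghom_facts:
  "wg11 \<in> ghom (- 1)" "wg12 \<in> ghom (- 1)" "wg21 \<in> ghom (- 1)" "wg22 \<in> ghom (- 1)"
  "xp11 \<in> ghom 1" "xp12 \<in> ghom 1" "xp21 \<in> ghom 1" "xp22 \<in> ghom 1"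
  "xm11 \<in> ghom 1" "xm12 \<in> ghom 1" "xm21 \<in> ghom 1" "xm22 \<in> ghom 1"
  "e_x \<in> ghom 0" "e_y \<in> ghom 0" "mon {} \<in> ghom (- 2)"
  unfolding wg_defs x_defs e_x_def e_y_def tm_def mon_def
  by (auto intro!: ghom_linear ghom_bas)

lemma ghom_ge0: "x \<in> ghom d \<Longrightarrow> d \<ge> 0 \<Longrightarrow> x \<in> g_ge0"
  by (auto simp: ghom_def g_ge0_def)

lemma F_act_ghom_pos: "x \<in> ghom d \<Longrightarrow> d > 0 \<Longrightarrow> F_act \<mu> x p = 0"
  by (rule F_act_pos) (auto simp: ghom_def)

text \<open>x passes both factors and then annihilates F. On the way it leaves the degree zero
  elements [w, x] and [w', x]; the first of these still has to pass w', which produces the double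
  bracket.\<close>

lemma act_pair:
  assumes x: "x \<in> ghom 1" and w: "w \<in> ghom (- 1)" "w' \<in> ghom (- 1)" and f: "f \<in> F_space \<mu>"
  shows "tn \<mu> (gU x * (gU w * gU w')) f = tn \<mu> (gU (g_bracket (g_bracket w x) w')) f
    + tn \<mu> (gU w') (F_act \<mu> (g_bracket w x) f) - tn \<mu> (gU w) (F_act \<mu> (g_bracket w' x) f)"
proof -
  let ?k = "g_bracket w x" and ?k' = "g_bracket w' x"
  have k: "?k \<in> ghom 0" "?k' \<in> ghom 0" using ghom_bracket[OF w(1) x] ghom_bracket[OF w(2) x] by simp_all
  have xw: "gU x * gU w = gU ?k - gU w * gU x" "gU x * gU w' = gU ?k' - gU w' * gU x"
    using gU_anticommute[OF w(1) x] gU_anticommute[OF w(2) x] by simp_all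
  have "gU x * (gU w * gU w') = gU ?k * gU w' - gU w * (gU x * gU w')"
    unfolding mult.assoc[symmetric, of "gU x"] xw(1) left_diff_distrib mult.assoc ..
  also have "\<dots> = gU (g_bracket ?k w') + gU w' * gU ?k - gU w * gU ?k' + gU w * gU w' * gU x"
    using gU_commute_even[OF k(1) w(2)] by (simp add: xw right_diff_distrib mult.assoc algebra_simps)
  finally show ?thesis
    using k x by (simp add: tn_linear tn_linear' f ghom_ge0 F_act_ghom_pos tn_zero)
qed

lemma act_theta:
  assumes x: "x \<in> ghom 1" and f: "f \<in> F_space \<mu>"
  shows "tn \<mu> (gU x * \<Theta>) f = - tn \<mu> (gU (g_bracket (mon {}) x)) f"
proof -
  have "gU x * \<Theta> = \<Theta> * gU x - gU (g_bracket (mon {}) x)"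
    using gU_commute_even[OF ghom_facts(15) x] by (simp add: algebra_simps)
  then show ?thesis
    using x by (simp add: tn_linear tn_linear' f ghom_ge0 F_act_ghom_pos tn_zero)
qed

lemma bracket_theta_x:
  "g_bracket (mon {}) xp11 = 2 \<cdot> wg11" "g_bracket (mon {}) xp12 = 2 \<cdot> wg12"
  "g_bracket (mon {}) xp21 = 2 \<cdot> wg21" "g_bracket (mon {}) xp22 = 2 \<cdot> wg22"
  "g_bracket (mon {}) xm11 = 2 \<cdot> wg11" "g_bracket (mon {}) xm12 = 2 \<cdot> wg12"
  "g_bracket (mon {}) xm21 = 2 \<cdot> wg21" "g_bracket (mon {}) xm22 = 2 \<cdot> wg22"
proof -
  have ne: "{I1, I3, I4} \<noteq> UNIV" "{I2, I3, I4} \<noteq> UNIV" "{I1, I2, I3} \<noteq> UNIV" "{I1, I2, I4} \<noteq> UNIV"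
    unfolding UNIV_ix_eq by simp_all
  show "g_bracket (mon {}) xp11 = 2 \<cdot> wg11" "g_bracket (mon {}) xp12 = 2 \<cdot> wg12"
    "g_bracket (mon {}) xp21 = 2 \<cdot> wg21" "g_bracket (mon {}) xp22 = 2 \<cdot> wg22"
    "g_bracket (mon {}) xm11 = 2 \<cdot> wg11" "g_bracket (mon {}) xm12 = 2 \<cdot> wg12"
    "g_bracket (mon {}) xm21 = 2 \<cdot> wg21" "g_bracket (mon {}) xm22 = 2 \<cdot> wg22"
    unfolding wg_defs x_defs tm_def mon_def
    by (simp_all add: g_bracket_linear g_bracket_diff br_Mon k_bracket_one d_t_bas of_kalg_linear of_kalg_bas psi_eq ne
       cs.scale_right_distrib cs.scale_right_diff_distrib mult.commute)
qed

text \<open>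
  \<open>vecl \<mu> u\<close> is \<open>u\<close> applied to the general vector of degree 2. Pairing the middle coefficients as
  \<open>w11 * w22 + w21 * w12\<close> and \<open>w22 * w11 + w21 * w12\<close> separates the self-dual from the anti-self-dual part
  of $\Lambda^2\mathfrak g_{-1}$, that is, the adjoint modules of the two copies of $\mathfrak{sl}_2$.
\<close>

definition vecl :: "weight \<Rightarrow> ualg \<Rightarrow> poly4 \<Rightarrow> poly4 \<Rightarrow> poly4 \<Rightarrow> poly4 \<Rightarrow> poly4 \<Rightarrow> poly4 \<Rightarrow> poly4 \<Rightarrow> preind" where
  "vecl \<mu> u c a2 a0 am b2 b0 bm = tn \<mu> (u * \<Theta>) c
     + tn \<mu> (u * (w11 * w12)) a2 + tn \<mu> (u * (w11 * w22)) a0 + tn \<mu> (u * (w21 * w12)) a0 + tn \<mu> (u * (w22 * w21)) am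
     + tn \<mu> (u * (w11 * w21)) b2 + tn \<mu> (u * (w22 * w11)) b0 + tn \<mu> (u * (w21 * w12)) b0 + tn \<mu> (u * (w22 * w12)) bm"

definition wvec :: "weight \<Rightarrow> poly4 \<Rightarrow> poly4 \<Rightarrow> poly4 \<Rightarrow> poly4 \<Rightarrow> preind" where
  "wvec \<mu> g11 g12 g21 g22 = tn \<mu> w11 g11 + tn \<mu> w12 g12 + tn \<mu> w21 g21 + tn \<mu> w22 g22"

text \<open>t and C enter the brackets with the \<open>xp\<close> only through t + C and those with
  the \<open>xm\<close> only through t - C, hence \<open>ws\<close> and \<open>wd\<close>. The
  images are expanded in the w_ij so that coefficients can be compared.\<close>

lemma vecl_x:
  assumes "c \<in> F_space \<mu>" "a2 \<in> F_space \<mu>" "a0 \<in> F_space \<mu>" "am \<in> F_space \<mu>" "b2 \<in> F_space \<mu>" "b0 \<in> F_space \<mu>" "bm \<in> F_space \<mu>"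
  shows
  "vecl \<mu> (gU xp11) c a2 a0 am b2 b0 bm = wvec \<mu>
     ((2 * ws \<mu>) \<cdot> a0 + 2 \<cdot> hY b0 + 4 \<cdot> eY b2 - 4 \<cdot> a0 - 2 \<cdot> hY a0 - (2 * ws \<mu>) \<cdot> b0 - 2 \<cdot> c)
     (2 \<cdot> hY bm - 4 \<cdot> eY a0 - 4 \<cdot> eY b0 - (2 * ws \<mu>) \<cdot> bm)
     (4 \<cdot> am + 2 \<cdot> hY am - (2 * ws \<mu>) \<cdot> am)
     (4 \<cdot> eY am)"
  "vecl \<mu> (gU xp12) c a2 a0 am b2 b0 bm = wvec \<mu>
     (4 \<cdot> fY b0 - 4 \<cdot> fY a0 - 2 \<cdot> hY b2 - (2 * ws \<mu>) \<cdot> b2)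
     (2 \<cdot> hY a0 + (2 * ws \<mu>) \<cdot> a0 + 2 \<cdot> hY b0 + (2 * ws \<mu>) \<cdot> b0 + 4 \<cdot> fY bm - 4 \<cdot> a0 - 2 \<cdot> c)
     (4 \<cdot> fY am)
     (4 \<cdot> am - 2 \<cdot> hY am - (2 * ws \<mu>) \<cdot> am)"
  "vecl \<mu> (gU xp21) c a2 a0 am b2 b0 bm = wvec \<mu>
     (4 \<cdot> a2 + 2 \<cdot> hY a2 - (2 * ws \<mu>) \<cdot> a2)
     (4 \<cdot> eY a2)
     (4 \<cdot> a0 + 2 \<cdot> hY a0 + 2 \<cdot> hY b0 + 4 \<cdot> eY b2 - (2 * ws \<mu>) \<cdot> a0 - (2 * ws \<mu>) \<cdot> b0 - 2 \<cdot> c)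
     (4 \<cdot> eY a0 + 2 \<cdot> hY bm - 4 \<cdot> eY b0 - (2 * ws \<mu>) \<cdot> bm)"
  "vecl \<mu> (gU xp22) c a2 a0 am b2 b0 bm = wvec \<mu>
     (4 \<cdot> fY a2)
     (4 \<cdot> a2 - 2 \<cdot> hY a2 - (2 * ws \<mu>) \<cdot> a2)
     (4 \<cdot> fY a0 + 4 \<cdot> fY b0 - 2 \<cdot> hY b2 - (2 * ws \<mu>) \<cdot> b2)
     (4 \<cdot> a0 + 2 \<cdot> hY b0 + (2 * ws \<mu>) \<cdot> b0 + 4 \<cdot> fY bm - 2 \<cdot> hY a0 - (2 * ws \<mu>) \<cdot> a0 - 2 \<cdot> c)"
  "vecl \<mu> (gU xm11) c a2 a0 am b2 b0 bm = wvec \<mu>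
     ((2 * wd \<mu>) \<cdot> a0 + 4 \<cdot> eX a2 + 4 \<cdot> b0 + 2 \<cdot> hX b0 - 2 \<cdot> hX a0 - (2 * wd \<mu>) \<cdot> b0 - 2 \<cdot> c)
     (4 \<cdot> bm + 2 \<cdot> hX bm - (2 * wd \<mu>) \<cdot> bm)
     (4 \<cdot> eX a0 + 2 \<cdot> hX am + 4 \<cdot> eX b0 - (2 * wd \<mu>) \<cdot> am)
     (4 \<cdot> eX bm)"
  "vecl \<mu> (gU xm12) c a2 a0 am b2 b0 bm = wvec \<mu>
     (4 \<cdot> b2 + 2 \<cdot> hX b2 - (2 * wd \<mu>) \<cdot> b2)
     ((2 * wd \<mu>) \<cdot> a0 + 4 \<cdot> eX a2 + (2 * wd \<mu>) \<cdot> b0 - 2 \<cdot> hX a0 - 4 \<cdot> b0 - 2 \<cdot> hX b0 - 2 \<cdot> c)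
     (4 \<cdot> eX b2)
     (4 \<cdot> eX a0 + 2 \<cdot> hX am - (2 * wd \<mu>) \<cdot> am - 4 \<cdot> eX b0)"
  "vecl \<mu> (gU xm21) c a2 a0 am b2 b0 bm = wvec \<mu>
     (4 \<cdot> fX b0 - 4 \<cdot> fX a0 - 2 \<cdot> hX a2 - (2 * wd \<mu>) \<cdot> a2)
     (4 \<cdot> fX bm)
     (4 \<cdot> fX am + 4 \<cdot> b0 - 2 \<cdot> hX a0 - (2 * wd \<mu>) \<cdot> a0 - 2 \<cdot> hX b0 - (2 * wd \<mu>) \<cdot> b0 - 2 \<cdot> c)
     (4 \<cdot> bm - 2 \<cdot> hX bm - (2 * wd \<mu>) \<cdot> bm)"
  "vecl \<mu> (gU xm22) c a2 a0 am b2 b0 bm = wvec \<mu>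
     (4 \<cdot> fX b2)
     (- (4 \<cdot> fX a0 + 2 \<cdot> hX a2 + (2 * wd \<mu>) \<cdot> a2 + 4 \<cdot> fX b0))
     (4 \<cdot> b2 - 2 \<cdot> hX b2 - (2 * wd \<mu>) \<cdot> b2)
     (4 \<cdot> fX am + 2 \<cdot> hX b0 + (2 * wd \<mu>) \<cdot> b0 - 2 \<cdot> hX a0 - (2 * wd \<mu>) \<cdot> a0 - 4 \<cdot> b0 - 2 \<cdot> c)"
  unfolding vecl_def wvec_def w_gU
  by (simp_all add: assms act_pair act_theta ghom_facts bracket_w_x bracket_zero_w bracket_theta_x g_bracket_linear g_bracket_diff
      F_act_linear F_act_gens gU_linear tn_linear tn_linear' tn_zero F_space_linear pD_in_F,
    (rule poly_mapping_eqI, simp add: lookup_add lookup_minus algebra_simps)+)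

text \<open>The w_ij are isotropic for the symmetric form that the bracket defines on g_{-1}, and
  they form two hyperbolic pairs: w11 with w22, and w12 with w21.\<close>

lemma bracket_w_w:
  "g_bracket wg11 wg11 = 0" "g_bracket wg12 wg12 = 0" "g_bracket wg21 wg21 = 0" "g_bracket wg22 wg22 = 0"
  "g_bracket wg12 wg11 = 0" "g_bracket wg21 wg11 = 0" "g_bracket wg22 wg11 = - (2 \<cdot> mon {})"
  "g_bracket wg12 wg21 = 2 \<cdot> mon {}" "g_bracket wg12 wg22 = 0" "g_bracket wg21 wg22 = 0"
proof -
  have b: "g_bracket (mon {i}) (mon {j}) = (if i = j then - mon {} else 0)" for i j
    using br_lt[of "Et i" "Et j"] by (simp add: mon_def)
  show
    "g_bracket wg11 wg11 = 0" "g_bracket wg12 wg12 = 0" "g_bracket wg21 wg21 = 0" "g_bracket wg22 wg22 = 0"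
    "g_bracket wg12 wg11 = 0" "g_bracket wg21 wg11 = 0" "g_bracket wg22 wg11 = - (2 \<cdot> mon {})"
    "g_bracket wg12 wg21 = 2 \<cdot> mon {}" "g_bracket wg12 wg22 = 0" "g_bracket wg21 wg22 = 0"
    unfolding wg_defs
    by (simp_all add: g_bracket_linear g_bracket_diff b cscale_two)
qed

lemma uscale_half: "u + u = 0 \<Longrightarrow> u = (0 :: ualg)"
proof -
  assume u: "u + u = 0"
  have "u = uscale (1/2) (u + u)"
    by (simp add: us.scale_right_distrib us.scale_left_distrib[symmetric])
  then show ?thesis by (simp add: u)
qed

text \<open>Oriented as rewriting rules towards \<Theta> and one fixed order for each pair of
  distinct w.\<close>

lemma w_products:
  "w11 * w11 = 0" "w12 * w12 = 0" "w21 * w21 = 0" "w22 * w22 = 0"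
  "w12 * w11 = - (w11 * w12)" "w21 * w11 = - (w11 * w21)" "w22 * w11 = - (w11 * w22) - uscale 2 \<Theta>"
  "w12 * w21 = uscale 2 \<Theta> - w21 * w12" "w12 * w22 = - (w22 * w12)" "w21 * w22 = - (w22 * w21)"
proof -
  have 1: "gU x * gU y = gU (g_bracket x y) - gU y * gU x" if "x \<in> ghom (- 1)" "y \<in> ghom (- 1)" for x y
    by (rule gU_anticommute[OF that]) simp_all
  have sq: "gU x * gU x = 0" if "x \<in> ghom (- 1)" "g_bracket x x = 0" for x
  proof -
    have "gU x * gU x = - (gU x * gU x)"
      using 1[OF that(1) that(1)] by (simp only: that(2) gU_linear(5) diff_0)
    then show ?thesis by (rule uscale_half[OF eq_neg_iff_add_eq_0[THEN iffD1]])
  qed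
  show "w11 * w11 = 0" "w12 * w12 = 0" "w21 * w21 = 0" "w22 * w22 = 0"
    unfolding w_gU by (intro sq ghom_facts bracket_w_w)+
  show "w12 * w11 = - (w11 * w12)" "w21 * w11 = - (w11 * w21)" "w22 * w11 = - (w11 * w22) - uscale 2 \<Theta>"
    "w12 * w21 = uscale 2 \<Theta> - w21 * w12" "w12 * w22 = - (w22 * w12)" "w21 * w22 = - (w22 * w21)"
    unfolding w_gU
    using 1[OF ghom_facts(2,1)] 1[OF ghom_facts(3,1)] 1[OF ghom_facts(4,1)] 1[OF ghom_facts(2,3)]
      1[OF ghom_facts(2,4)] 1[OF ghom_facts(3,4)]
    by (simp_all add: bracket_w_w gU_linear)
qed

lemma act_pair_even:
  assumes h: "h \<in> ghom 0" and w: "w \<in> ghom (- 1)" "w' \<in> ghom (- 1)" and f: "f \<in> F_space \<mu>"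
  shows "tn \<mu> (gU h * (gU w * gU w')) f = tn \<mu> (gU (g_bracket h w) * gU w') f
    + tn \<mu> (gU w * gU (g_bracket h w')) f + tn \<mu> (gU w * gU w') (F_act \<mu> h f)"
proof -
  have "gU h * (gU w * gU w') = gU (g_bracket h w) * gU w' + gU w * (gU h * gU w')"
    using gU_commute_even[OF h w(1)] by (simp add: mult.assoc[symmetric] distrib_right)
  also have "\<dots> = gU (g_bracket h w) * gU w' + gU w * gU (g_bracket h w') + gU w * gU w' * gU h"
    using gU_commute_even[OF h w(2)] by (simp add: distrib_left mult.assoc)
  finally show ?thesis using h by (simp add: tn_linear f ghom_ge0)
qed

lemma act_theta_even:
  assumes h: "h \<in> ghom 0" "g_bracket h (mon {}) = 0" and f: "f \<in> F_space \<mu>"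
  shows "tn \<mu> (gU h * \<Theta>) f = tn \<mu> \<Theta> (F_act \<mu> h f)"
  using gU_commute_even[OF h(1) ghom_facts(15)] h by (simp add: gU_linear tn_linear f ghom_ge0)

lemma bracket_e_theta: "g_bracket e_x (mon {}) = 0" "g_bracket e_y (mon {}) = 0"
  unfolding e_x_def e_y_def mon_def
  by (simp_all add: g_bracket_linear g_bracket_diff br_zero k_bracket_one d_t_bas of_kalg_linear)

text \<open>The a's and the b's are coordinates in the two adjoint modules, which explains the
  constants. For instance e_x sends \<open>w22 * w21\<close> to
  \<open>w12 * w21 + w22 * w11\<close>, where the two multiples of \<Theta> cancel and the negative
  of \<open>w11 * w22 + w21 * w12\<close> remains; this is the term - am.\<close>

lemma vecl_e:
  assumes "c \<in> F_space \<mu>" "a2 \<in> F_space \<mu>" "a0 \<in> F_space \<mu>" "am \<in> F_space \<mu>" "b2 \<in> F_space \<mu>" "b0 \<in> F_space \<mu>" "bm \<in> F_space \<mu>"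
  shows "vecl \<mu> (gU e_x) c a2 a0 am b2 b0 bm =
      vecl \<mu> 1 (eX c) (eX a2 + 2 \<cdot> a0) (eX a0 - am) (eX am) (eX b2) (eX b0) (eX bm)"
    "vecl \<mu> (gU e_y) c a2 a0 am b2 b0 bm =
      vecl \<mu> 1 (eY c) (eY a2) (eY a0) (eY am) (eY b2 - 2 \<cdot> b0) (eY b0 + bm) (eY bm)"
  unfolding vecl_def w_gU
  by (simp_all only: assms act_pair_even act_theta_even ghom_facts bracket_zero_w bracket_e_theta
      F_act_gens gU_linear mult_1_left,
    simp_all add: assms w_products[unfolded w_gU] tn_linear tn_linear' tn_zero F_space_linear pD_in_F,
    (rule poly_mapping_eqI, simp add: lookup_add lookup_minus algebra_simps)+)

lemma wvec_zero:
  assumes "g11 \<in> F_space \<mu>" "g12 \<in> F_space \<mu>" "g21 \<in> F_space \<mu>" "g22 \<in> F_space \<mu>"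
    and z: "wvec \<mu> g11 g12 g21 g22 = 0"
  shows "g11 = 0" "g12 = 0" "g21 = 0" "g22 = 0"
proof -
  \<comment> \<open>The coefficients of the \<eta>_i after inserting the definitions of the
    w.\<close>
  define h where "h = (\<lambda>i. case i of I1 \<Rightarrow> \<i> \<cdot> (g11 - g22) | I2 \<Rightarrow> g11 + g22 | I3 \<Rightarrow> \<i> \<cdot> (g12 + g21) | I4 \<Rightarrow> g21 - g12)"
  have "wvec \<mu> g11 g12 g21 g22 = qm \<mu> (\<Sum>i\<in>UNIV. \<eta> i \<otimes> h i)"
    unfolding sum_ix qm h_def tn_def[symmetric] ix.case
    by (simp add: wvec_def w11_def w12_def w21_def w22_def assms tn_linear tn_linear' F_space_linear
        cs.scale_right_diff_distrib cs.scale_right_distrib algebra_simps)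
  then have h: "h i = 0" for i using z by (intro indep_degree_1) (simp add: qm(3))
  from h[of I1] h[of I2] h[of I3] h[of I4]
  have *: "g11 - g22 = 0" "g11 + g22 = 0" "g12 + g21 = 0" "g21 - g12 = 0" by (simp_all add: h_def)
  have "lookup g11 e = 0 \<and> lookup g12 e = 0 \<and> lookup g21 e = 0 \<and> lookup g22 e = 0" for e
    using *[THEN arg_cong[of _ _ "\<lambda>p. lookup p e"]]
    by (simp add: lookup_add lookup_minus complex_eq_iff)
  then show "g11 = 0" "g12 = 0" "g21 = 0" "g22 = 0"
    by (auto intro!: poly_mapping_eqI)
qed

lemma vecl_zero:
  assumes "c \<in> F_space \<mu>" "a2 \<in> F_space \<mu>" "a0 \<in> F_space \<mu>" "am \<in> F_space \<mu>" "b2 \<in> F_space \<mu>" "b0 \<in> F_space \<mu>" "bm \<in> F_space \<mu>"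
    and z: "vecl \<mu> 1 c a2 a0 am b2 b0 bm = 0"
  shows "c = 0" "a2 = 0" "a0 = 0" "am = 0" "b2 = 0" "b0 = 0" "bm = 0"
proof -
  \<comment> \<open>The coefficients of \<eta>_i \<eta>_j after expanding the products of the w. The
    diagonal sums to zero, so c is the whole coefficient of \<Theta>; the six pairs off the diagonal
    determine the six other unknowns.\<close>
  define g where "g = (\<lambda>i j. case (i, j) of
      (I1, I1) \<Rightarrow> a0 + b0 | (I2, I2) \<Rightarrow> a0 + b0 | (I3, I3) \<Rightarrow> - (a0 + b0) | (I4, I4) \<Rightarrow> - (a0 + b0)
    | (I1, I2) \<Rightarrow> \<i> \<cdot> (a0 - b0) | (I2, I1) \<Rightarrow> - (\<i> \<cdot> (a0 - b0))
    | (I4, I3) \<Rightarrow> \<i> \<cdot> (a0 + b0) | (I3, I4) \<Rightarrow> - (\<i> \<cdot> (a0 + b0))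
    | (I2, I4) \<Rightarrow> am - a2 + b2 - bm | (I2, I3) \<Rightarrow> \<i> \<cdot> (a2 + am + b2 + bm)
    | (I1, I4) \<Rightarrow> \<i> \<cdot> (bm + b2 - a2 - am) | (I1, I3) \<Rightarrow> am + bm - a2 - b2 | _ \<Rightarrow> 0)"
  have "vecl \<mu> 1 c a2 a0 am b2 b0 bm = qm \<mu> (gU (mon {}) \<otimes> c + (\<Sum>i\<in>UNIV. \<Sum>j\<in>UNIV. (\<eta> i * \<eta> j) \<otimes> g i j))"
    unfolding sum_ix qm g_def tn_def[symmetric] ix.case prod.case
    by (simp add: vecl_def w11_def w12_def w21_def w22_def assms tn_linear tn_linear' tn_zero F_space_linear
        distrib_left distrib_right left_diff_distrib right_diff_distrib uscale_mult_left uscale_mult_right)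
      (rule poly_mapping_eqI, simp add: lookup_add lookup_minus algebra_simps)
  then have "gU (mon {}) \<otimes> c + (\<Sum>i\<in>UNIV. \<Sum>j\<in>UNIV. (\<eta> i * \<eta> j) \<otimes> g i j) \<in> cs.span (ind_rels \<mu>)"
    using z by (simp add: qm(3))
  note i = indep_degree_2[OF this]
  show "c = 0" using i(1) by (simp add: sum_ix g_def)
  have "lookup a0 e = 0 \<and> lookup b0 e = 0 \<and> lookup a2 e = 0 \<and> lookup am e = 0 \<and> lookup b2 e = 0 \<and> lookup bm e = 0" for e
  proof -
    have "lookup (g i j) e = lookup (g j i) e" for i j by (simp only: i(2)[of i j])
    from this[of I1 I2] this[of I4 I3] this[of I2 I4] this[of I2 I3] this[of I1 I4] this[of I1 I3]
    show ?thesis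
      by (simp add: g_def lookup_add lookup_minus complex_eq_iff)
  qed
  then show "a2 = 0" "a0 = 0" "am = 0" "b2 = 0" "b0 = 0" "bm = 0"
    by (auto intro!: poly_mapping_eqI)
qed

text \<open>A vector v of degree 2 is recorded by its orbit map u \<mapsto> u v, so that one choice
  of coefficients serves all elements u that are applied to it.\<close>

definition presented :: "weight \<Rightarrow> (ualg \<Rightarrow> preind) \<Rightarrow> bool" where
  "presented \<mu> T \<longleftrightarrow> (\<exists>c\<in>F_space \<mu>. \<exists>a2\<in>F_space \<mu>. \<exists>a0\<in>F_space \<mu>. \<exists>am\<in>F_space \<mu>. \<exists>b2\<in>F_space \<mu>. \<exists>b0\<in>F_space \<mu>.
     \<exists>bm\<in>F_space \<mu>. \<forall>u. T u = vecl \<mu> u c a2 a0 am b2 b0 bm)"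

lemma presentedI:
  assumes "\<And>u. T u = vecl \<mu> u c a2 a0 am b2 b0 bm"
    "c \<in> F_space \<mu>" "a2 \<in> F_space \<mu>" "a0 \<in> F_space \<mu>" "am \<in> F_space \<mu>" "b2 \<in> F_space \<mu>" "b0 \<in> F_space \<mu>" "bm \<in> F_space \<mu>"
  shows "presented \<mu> T"
  unfolding presented_def
  by (rule bexI[of _ c], rule bexI[of _ a2], rule bexI[of _ a0], rule bexI[of _ am], rule bexI[of _ b2],
      rule bexI[of _ b0], rule bexI[of _ bm]) (simp_all add: assms)

lemma presentedE:
  assumes "presented \<mu> T"
  obtains c a2 a0 am b2 b0 bm where "c \<in> F_space \<mu>" "a2 \<in> F_space \<mu>" "a0 \<in> F_space \<mu>" "am \<in> F_space \<mu>" "b2 \<in> F_space \<mu>" "b0 \<in> F_space \<mu>" "bm \<in> F_space \<mu>"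
    "\<And>u. T u = vecl \<mu> u c a2 a0 am b2 b0 bm"
  using assms unfolding presented_def by (elim bexE) simp

lemma presented_linear:
  "presented \<mu> T \<Longrightarrow> presented \<mu> T' \<Longrightarrow> presented \<mu> (\<lambda>u. T u + T' u)"
  "presented \<mu> T \<Longrightarrow> presented \<mu> (\<lambda>u. k \<cdot> T u)"
  "presented \<mu> (\<lambda>u. 0)"
proof -
  assume T: "presented \<mu> T" and T': "presented \<mu> T'"
  from T show "presented \<mu> (\<lambda>u. T u + T' u)"
  proof (rule presentedE)
    fix c a2 a0 am b2 b0 bm
    assume F: "c \<in> F_space \<mu>" "a2 \<in> F_space \<mu>" "a0 \<in> F_space \<mu>" "am \<in> F_space \<mu>" "b2 \<in> F_space \<mu>" "b0 \<in> F_space \<mu>" "bm \<in> F_space \<mu>"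
      and T: "\<And>u. T u = vecl \<mu> u c a2 a0 am b2 b0 bm"
    from T' show ?thesis
    proof (rule presentedE)
      fix c' a2' a0' am' b2' b0' bm'
      assume F': "c' \<in> F_space \<mu>" "a2' \<in> F_space \<mu>" "a0' \<in> F_space \<mu>" "am' \<in> F_space \<mu>" "b2' \<in> F_space \<mu>" "b0' \<in> F_space \<mu>" "bm' \<in> F_space \<mu>"
        and T': "\<And>u. T' u = vecl \<mu> u c' a2' a0' am' b2' b0' bm'"
      show ?thesis
        by (rule presentedI[of _ _ "c + c'" "a2 + a2'" "a0 + a0'" "am + am'" "b2 + b2'" "b0 + b0'" "bm + bm'"])
          (simp_all add: T T' vecl_def tn_linear F F' F_space_linear algebra_simps)
    qed
  qed
next
  assume "presented \<mu> T"
  then show "presented \<mu> (\<lambda>u. k \<cdot> T u)"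
  proof (rule presentedE)
    fix c a2 a0 am b2 b0 bm
    assume F: "c \<in> F_space \<mu>" "a2 \<in> F_space \<mu>" "a0 \<in> F_space \<mu>" "am \<in> F_space \<mu>" "b2 \<in> F_space \<mu>" "b0 \<in> F_space \<mu>" "bm \<in> F_space \<mu>"
      and T: "\<And>u. T u = vecl \<mu> u c a2 a0 am b2 b0 bm"
    show ?thesis
      by (rule presentedI[of _ _ "k \<cdot> c" "k \<cdot> a2" "k \<cdot> a0" "k \<cdot> am" "k \<cdot> b2" "k \<cdot> b0" "k \<cdot> bm"])
        (simp_all add: T vecl_def tn_linear F F_space_linear cs.scale_right_distrib)
  qed
next
  show "presented \<mu> (\<lambda>u. 0)"
    by (rule presentedI[of _ _ 0 0 0 0 0 0 0]) (simp_all add: vecl_def tn_zero F_space_linear)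
qed

lemma presented_uminus: "presented \<mu> T \<Longrightarrow> presented \<mu> (\<lambda>u. - T u)"
  using presented_linear(2)[of \<mu> T "- 1"] by (simp add: cscale_minus_one)

lemma presented_diff: "presented \<mu> T \<Longrightarrow> presented \<mu> T' \<Longrightarrow> presented \<mu> (\<lambda>u. T u - T' u)"
  using presented_linear(1)[OF _ presented_uminus] by fastforce

lemma presented_products:
  assumes f: "f \<in> F_space \<mu>"
  shows "presented \<mu> (\<lambda>u. tn \<mu> (u * \<Theta>) f)"
    "presented \<mu> (\<lambda>u. tn \<mu> (u * (w11 * w12)) f)" "presented \<mu> (\<lambda>u. tn \<mu> (u * (w11 * w21)) f)"
    "presented \<mu> (\<lambda>u. tn \<mu> (u * (w22 * w21)) f)" "presented \<mu> (\<lambda>u. tn \<mu> (u * (w22 * w12)) f)"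
    "presented \<mu> (\<lambda>u. tn \<mu> (u * (w11 * w22)) f)" "presented \<mu> (\<lambda>u. tn \<mu> (u * (w21 * w12)) f)"
proof -
  note simps = vecl_def tn_zero tn_linear tn_linear' f F_space_linear w_products right_diff_distrib uscale_mult_right
  show "presented \<mu> (\<lambda>u. tn \<mu> (u * \<Theta>) f)"
    by (rule presentedI[of _ _ f 0 0 0 0 0 0]) (simp_all add: simps)
  show "presented \<mu> (\<lambda>u. tn \<mu> (u * (w11 * w12)) f)"
    by (rule presentedI[of _ _ 0 f 0 0 0 0 0]) (simp_all add: simps)
  show "presented \<mu> (\<lambda>u. tn \<mu> (u * (w11 * w21)) f)"
    by (rule presentedI[of _ _ 0 0 0 0 f 0 0]) (simp_all add: simps)
  show "presented \<mu> (\<lambda>u. tn \<mu> (u * (w22 * w21)) f)"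
    by (rule presentedI[of _ _ 0 0 0 f 0 0 0]) (simp_all add: simps)
  show "presented \<mu> (\<lambda>u. tn \<mu> (u * (w22 * w12)) f)"
    by (rule presentedI[of _ _ 0 0 0 0 0 0 f]) (simp_all add: simps)
  \<comment> \<open>As w22 w11 = - w11 w22 - 2\<Theta>, the product w11 w22 is half the
    a0-combination minus half the b0-combination minus \<Theta>.\<close>
  show "presented \<mu> (\<lambda>u. tn \<mu> (u * (w11 * w22)) f)"
    by (rule presentedI[of _ _ "- f" 0 "(1/2) \<cdot> f" 0 0 "- ((1/2) \<cdot> f)" 0])
      (simp_all add: simps, rule poly_mapping_eqI, simp add: lookup_add lookup_minus algebra_simps)
  \<comment> \<open>For the same reason w21 w12 is half the sum of both combinations plus
    \<Theta>.\<close>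
  show "presented \<mu> (\<lambda>u. tn \<mu> (u * (w21 * w12)) f)"
    by (rule presentedI[of _ _ f 0 "(1/2) \<cdot> f" 0 0 "(1/2) \<cdot> f" 0])
      (simp_all add: simps, rule poly_mapping_eqI, simp add: lookup_add lookup_minus algebra_simps)
qed

lemma eta_w:
  "\<eta> I1 = uscale (- \<i>/2) (w11 - w22)" "\<eta> I2 = uscale (1/2) (w11 + w22)"
  "\<eta> I3 = uscale (- \<i>/2) (w21 + w12)" "\<eta> I4 = uscale (1/2) (w21 - w12)"
  by (simp_all add: w11_def w22_def w12_def w21_def us.scale_right_distrib us.scale_right_diff_distrib
      us.scale_left_distrib[symmetric] flip: mult_2) 

lemma presented_eta:
  assumes f: "f \<in> F_space \<mu>"
  shows "presented \<mu> (\<lambda>u. tn \<mu> (u * (\<eta> i * \<eta> j)) f)"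
proof -
  let ?W = "{w11, w12, w21, w22}"
  have W: "presented \<mu> (\<lambda>u. tn \<mu> (u * (w * w')) f)" if "w \<in> ?W" "w' \<in> ?W" for w w'
    using that
    by (auto simp: w_products right_diff_distrib uscale_mult_right tn_linear tn_linear' f
        intro!: presented_products presented_linear presented_diff presented_uminus)
  have "presented \<mu> (\<lambda>u. tn \<mu> (u * (uscale a (w1 + w2) * uscale b (w3 + w4))) f)"
    "presented \<mu> (\<lambda>u. tn \<mu> (u * (uscale a (w1 - w2) * uscale b (w3 + w4))) f)"
    "presented \<mu> (\<lambda>u. tn \<mu> (u * (uscale a (w1 + w2) * uscale b (w3 - w4))) f)"
    "presented \<mu> (\<lambda>u. tn \<mu> (u * (uscale a (w1 - w2) * uscale b (w3 - w4))) f)"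
    if "w1 \<in> ?W" "w2 \<in> ?W" "w3 \<in> ?W" "w4 \<in> ?W" for a b w1 w2 w3 w4
    unfolding uscale_mult_left uscale_mult_right distrib_left distrib_right left_diff_distrib right_diff_distrib
      tn_linear[OF f] tn_linear'[OF f] us.scale_scale
    by (intro presented_linear presented_diff presented_uminus W that)+
  then show ?thesis
    by (cases i; cases j; simp only: eta_w insert_iff simp_thms)
qed

text \<open>Each letter has degree at most -1, so a word of degree -2 has at most two
  letters.\<close>

lemma neg_words:
  assumes "\<forall>b\<in>set bs. gdeg b < 0" "sum_list (map gdeg bs) = - 2"
  shows "bs = [lt Th] \<or> (\<exists>i j. bs = [lt (Et i), lt (Et j)])"
proof -
  have le: "sum_list (map gdeg cs) \<le> - int (length cs)" if "\<forall>b\<in>set cs. gdeg b < 0" for cs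
    using that by (induction cs) auto
  have l: "length bs \<le> 2" using le[OF assms(1)] assms(2) by linarith
  have ltE: "\<exists>y. b = lt y" if "b \<in> set bs" for b using assms(1) that range_lt[of b] by blast
  consider "bs = []" | b where "bs = [b]" | b b' where "bs = [b, b']" | b b' b'' r where "bs = b # b' # b'' # r"
    by (metis neq_Nil_conv)
  then show ?thesis
  proof cases
    case 2
    then obtain y where "b = lt y" using ltE[of b] by auto
    then show ?thesis using assms(2) 2 by (cases y) auto
  next
    case 3
    then obtain y z where "b = lt y" "b' = lt z" using ltE[of b] ltE[of b'] by auto
    then show ?thesis using assms(2) 3 by (cases y; cases z) auto
  qed (use assms(2) l in auto)
qed

lemma presented_U_neg:
  assumes "u0 \<in> U_neg 2" and f: "f \<in> F_space \<mu>"
  shows "presented \<mu> (\<lambda>u. tn \<mu> (u * u0) f)"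
  using assms(1) unfolding U_neg_def
proof (induction rule: us.span_induct_alt)
  case (step k x y)
  then obtain bs where x: "x = prod_list (map (gU \<circ> bas) bs)" and "\<forall>b\<in>set bs. gdeg b < 0"
    "sum_list (map gdeg bs) = - 2" by auto
  then consider "bs = [lt Th]" | i j where "bs = [lt (Et i), lt (Et j)]"
    using neg_words by blast
  then have "presented \<mu> (\<lambda>u. tn \<mu> (u * x) f)"
  proof cases
    case 1
    then have "x = \<Theta>" by (simp add: x mon_def)
    then show ?thesis using presented_products(1)[OF f] by simp
  next
    case 2
    then have "x = \<eta> i * \<eta> j" by (simp add: x \<eta>_def mon_def)
    then show ?thesis using presented_eta[OF f] by simp
  qed
  then show ?case
    using step by (simp add: distrib_left uscale_mult_right tn_linear f presented_linear)
qed (simp add: tn_linear' f presented_linear)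

lemma pre_act_linear:
  "pre_act u (s + t) = pre_act u s + pre_act u t" "pre_act u (k \<cdot> s) = k \<cdot> pre_act u s" "pre_act u 0 = 0"
  "pre_act u (s - t) = pre_act u s - pre_act u t"
  by (simp_all add: pre_act_def lin_ext_add lin_ext_scale lin_ext_diff)

lemma presented_degree_2:
  assumes "s \<in> cs.span {u \<otimes> f | u f. u \<in> U_neg 2 \<and> f \<in> F_space \<mu>}"
  shows "presented \<mu> (\<lambda>u. qm \<mu> (pre_act u s))"
  using assms
proof (induction rule: cs.span_induct_alt)
  case (step k x y)
  then obtain u0 f where "x = u0 \<otimes> f" "u0 \<in> U_neg 2" "f \<in> F_space \<mu>" by blast
  then have "presented \<mu> (\<lambda>u. qm \<mu> (pre_act u x))"
    using presented_U_neg by (simp add: tn_def)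
  with step show ?case by (simp add: pre_act_linear qm presented_linear)
qed (simp add: pre_act_linear qm_linear presented_linear)

lemma ind_act_zero_iff: "ind_act \<mu> u (ind_cls \<mu> s) = ind_cls \<mu> 0 \<longleftrightarrow> qm \<mu> (pre_act u s) = 0"
  by (simp add: ind_act_cls ind_cls_eq_iff qm_linear)

lemma pre_act_mult: "pre_act (u * u') s = pre_act u (pre_act u' s)"
proof (induction s rule: pm_induct)
  case (basis a)
  then show ?case
    by (cases a) (simp add: pre_act_def pre_tens_def mult.assoc)
qed (simp_all add: pre_act_linear)

text \<open>The relations of Ind(F) are stable under left multiplication; hence what z annihilates
  is also annihilated by every u z.\<close>

lemma qm_pre_act_zero: "qm \<mu> s = 0 \<Longrightarrow> qm \<mu> (pre_act u s) = 0"
proof -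
  assume "qm \<mu> s = 0"
  then have "ind_cls \<mu> s = ind_cls \<mu> 0" by (simp add: ind_cls_eq_iff qm_linear)
  then have "ind_cls \<mu> (pre_act u s) = ind_cls \<mu> (pre_act u 0)" by (metis ind_act_cls)
  then show ?thesis by (simp add: ind_cls_eq_iff qm_linear pre_act_linear)
qed

section \<open>Reduction to a system of equations in \<open>F\<close>\<close>

text \<open>The equations for one copy of sl_2. The first four come from degree one; the last four
  express annihilation by e. In S^2V \<otimes> F, the entries p2, p0, pm are the coefficients of
  vectors of weight 2, 0, -2 in S^2V, and d is the value of t - C or t + C.\<close>

definition half_sys :: "(poly4 \<Rightarrow> poly4) \<Rightarrow> (poly4 \<Rightarrow> poly4) \<Rightarrow> (poly4 \<Rightarrow> poly4) \<Rightarrow> complex \<Rightarrow> poly4 \<Rightarrow> poly4 \<Rightarrow> poly4 \<Rightarrow> poly4 \<Rightarrow> bool" where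
  "half_sys e f h d c p2 p0 pm \<longleftrightarrow>
     d \<cdot> p0 - h p0 + 2 \<cdot> e p2 = c \<and> 2 \<cdot> f pm - h p0 - d \<cdot> p0 = c \<and> 2 \<cdot> e p0 + h pm = d \<cdot> pm \<and> 2 \<cdot> f p0 + h p2 + d \<cdot> p2 = 0 \<and>
     e pm = 0 \<and> e p0 = pm \<and> e p2 = - (2 \<cdot> p0) \<and> e c = 0"

definition invariant :: "(poly4 \<Rightarrow> poly4) \<Rightarrow> (poly4 \<Rightarrow> poly4) \<Rightarrow> (poly4 \<Rightarrow> poly4) \<Rightarrow> complex \<Rightarrow> poly4 \<Rightarrow> bool" where
  "invariant e f h s p \<longleftrightarrow> e p = 0 \<and> f p = 0 \<and> h p = 0 \<and> s \<cdot> p = 2 \<cdot> p"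

text \<open>
  The sign of \<open>b0\<close> is reversed so that both halves satisfy the same equations.
\<close>

definition sing_sys :: "weight \<Rightarrow> poly4 \<Rightarrow> poly4 \<Rightarrow> poly4 \<Rightarrow> poly4 \<Rightarrow> poly4 \<Rightarrow> poly4 \<Rightarrow> poly4 \<Rightarrow> bool" where
  "sing_sys \<mu> c a2 a0 am b2 b0 bm \<longleftrightarrow>
     half_sys eX fX hX (wd \<mu>) c a2 a0 am \<and> half_sys eY fY hY (ws \<mu>) c b2 (- b0) bm \<and>
     (\<forall>p\<in>{a2, a0, am}. invariant eY fY hY (ws \<mu>) p) \<and> (\<forall>p\<in>{b2, b0, bm}. invariant eX fX hX (wd \<mu>) p)"

lemma poly_all_eq: "p = q \<longleftrightarrow> (\<forall>k. lookup p k = lookup q k)"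
  by (simp add: poly_mapping_eq_iff fun_eq_iff)

text \<open>Sums and differences of the four equations separate a from b. The doubled signs on the
  right have the shape that \<open>half_sys\<close> takes for the argument
  \<open>- b0\<close>.\<close>

lemma split_Y0:
  "(2 \<cdot> A + 2 \<cdot> (p - q) + 4 \<cdot> eb - 4 \<cdot> a - 2 \<cdot> ha - 2 \<cdot> B - 2 \<cdot> c = 0 \<and>
    2 \<cdot> ha + 2 \<cdot> A + 2 \<cdot> (p - q) + 2 \<cdot> B + 4 \<cdot> fb - 4 \<cdot> a - 2 \<cdot> c = 0 \<and>
    4 \<cdot> a + 2 \<cdot> ha + 2 \<cdot> (p - q) + 4 \<cdot> eb - 2 \<cdot> A - 2 \<cdot> B - 2 \<cdot> c = 0 \<and>
    4 \<cdot> a + 2 \<cdot> (p - q) + 2 \<cdot> B + 4 \<cdot> fb - 2 \<cdot> ha - 2 \<cdot> A - 2 \<cdot> c = 0) \<longleftrightarrow>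
   (ha = 0 \<and> A = 2 \<cdot> a \<and> - B - (- p - - q) + 2 \<cdot> eb = c \<and> 2 \<cdot> fb - (- p - - q) - - B = c)"
  unfolding poly_all_eq all_conj_distrib[symmetric]
  by (intro all_cong1) (auto simp: lookup_add lookup_minus complex_eq_iff)

lemma split_X0:
  "(2 \<cdot> A + 4 \<cdot> ea + 4 \<cdot> b + 2 \<cdot> hb - 2 \<cdot> ha - 2 \<cdot> B - 2 \<cdot> c = 0 \<and>
    2 \<cdot> A + 4 \<cdot> ea + 2 \<cdot> B - 2 \<cdot> ha - 4 \<cdot> b - 2 \<cdot> hb - 2 \<cdot> c = 0 \<and>
    4 \<cdot> fa + 4 \<cdot> b - 2 \<cdot> ha - 2 \<cdot> A - 2 \<cdot> hb - 2 \<cdot> B - 2 \<cdot> c = 0 \<and>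
    4 \<cdot> fa + 2 \<cdot> hb + 2 \<cdot> B - 2 \<cdot> ha - 2 \<cdot> A - 4 \<cdot> b - 2 \<cdot> c = 0) \<longleftrightarrow>
   (hb = 0 \<and> B = 2 \<cdot> b \<and> A - ha + 2 \<cdot> ea = c \<and> 2 \<cdot> fa - ha - A = c)"
  unfolding poly_all_eq all_conj_distrib[symmetric]
  by (intro all_cong1) (auto simp: lookup_add lookup_minus complex_eq_iff)

lemma split_rest:
  "(2 \<cdot> hb - 4 \<cdot> ea - 4 \<cdot> eb - 2 \<cdot> B = 0 \<and> 4 \<cdot> ea + 2 \<cdot> hb - 4 \<cdot> eb - 2 \<cdot> B = 0) \<longleftrightarrow> (ea = 0 \<and> - (2 \<cdot> eb) + hb = B)"
  "(4 \<cdot> fb - 4 \<cdot> fa - 2 \<cdot> hb - 2 \<cdot> B = 0 \<and> 4 \<cdot> fa + 4 \<cdot> fb - 2 \<cdot> hb - 2 \<cdot> B = 0) \<longleftrightarrow> (fa = 0 \<and> - (2 \<cdot> fb) + hb + B = 0)"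
  "(4 \<cdot> ea + 2 \<cdot> ha + 4 \<cdot> eb - 2 \<cdot> A = 0 \<and> 4 \<cdot> ea + 2 \<cdot> ha - 2 \<cdot> A - 4 \<cdot> eb = 0) \<longleftrightarrow> (eb = 0 \<and> 2 \<cdot> ea + ha = A)"
  "(4 \<cdot> fb - 4 \<cdot> fa - 2 \<cdot> ha - 2 \<cdot> A = 0 \<and> - (4 \<cdot> fa + 2 \<cdot> ha + 2 \<cdot> A + 4 \<cdot> fb) = 0) \<longleftrightarrow> (fb = 0 \<and> 2 \<cdot> fa + ha + A = 0)"
  "(4 \<cdot> a + 2 \<cdot> ha - 2 \<cdot> A = 0 \<and> 4 \<cdot> a - 2 \<cdot> ha - 2 \<cdot> A = 0) \<longleftrightarrow> (ha = 0 \<and> A = 2 \<cdot> a)"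
  "4 \<cdot> a = 0 \<longleftrightarrow> a = 0" "a2 + 2 \<cdot> a = 0 \<longleftrightarrow> a2 = - (2 \<cdot> a)" "a2 - 2 \<cdot> a = 0 \<longleftrightarrow> a2 = - (- (2 \<cdot> a))" "ea - a = 0 \<longleftrightarrow> ea = a"
  "ea + a = 0 \<longleftrightarrow> - ea = a"
  unfolding poly_all_eq all_conj_distrib[symmetric]
  by (rule all_cong1, (auto simp: lookup_add lookup_minus complex_eq_iff)[1])+

lemma wvec_zero_iff:
  assumes "g11 \<in> F_space \<mu>" "g12 \<in> F_space \<mu>" "g21 \<in> F_space \<mu>" "g22 \<in> F_space \<mu>"
  shows "wvec \<mu> g11 g12 g21 g22 = 0 \<longleftrightarrow> g11 = 0 \<and> g12 = 0 \<and> g21 = 0 \<and> g22 = 0"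
  using wvec_zero[OF assms] by (auto simp: wvec_def tn_zero)

lemma vecl_zero_iff:
  assumes "c \<in> F_space \<mu>" "a2 \<in> F_space \<mu>" "a0 \<in> F_space \<mu>" "am \<in> F_space \<mu>" "b2 \<in> F_space \<mu>" "b0 \<in> F_space \<mu>" "bm \<in> F_space \<mu>"
  shows "vecl \<mu> 1 c a2 a0 am b2 b0 bm = 0 \<longleftrightarrow> c = 0 \<and> a2 = 0 \<and> a0 = 0 \<and> am = 0 \<and> b2 = 0 \<and> b0 = 0 \<and> bm = 0"
  using vecl_zero[OF assms] by (auto simp: vecl_def tn_zero)

text \<open>Independence of the w_ij, and of the normal form in degree two, turns the ten conditions
  into equations in F. Most of these mix the two halves; the \<open>split\<close> lemmas decouple
  them.\<close>

lemma sing_sys_iff: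
  assumes F: "c \<in> F_space \<mu>" "a2 \<in> F_space \<mu>" "a0 \<in> F_space \<mu>" "am \<in> F_space \<mu>" "b2 \<in> F_space \<mu>" "b0 \<in> F_space \<mu>" "bm \<in> F_space \<mu>"
  shows "sing_sys \<mu> c a2 a0 am b2 b0 bm \<longleftrightarrow>
    (\<forall>x\<in>{xp11, xp12, xp21, xp22, xm11, xm12, xm21, xm22, e_x, e_y}. vecl \<mu> (gU x) c a2 a0 am b2 b0 bm = 0)"
proof -
  have s: "(2 * k) \<cdot> p = 2 \<cdot> k \<cdot> p" for k and p :: poly4 by simp
  note mem = F_space_linear F pD_in_F[OF F(1)] pD_in_F[OF F(2)] pD_in_F[OF F(3)] pD_in_F[OF F(4)] pD_in_F[OF F(5)]
    pD_in_F[OF F(6)] pD_in_F[OF F(7)]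
  have x: "vecl \<mu> (gU x) c a2 a0 am b2 b0 bm = wvec \<mu> g11 g12 g21 g22 \<Longrightarrow>
     g11 \<in> F_space \<mu> \<Longrightarrow> g12 \<in> F_space \<mu> \<Longrightarrow> g21 \<in> F_space \<mu> \<Longrightarrow> g22 \<in> F_space \<mu> \<Longrightarrow>
     vecl \<mu> (gU x) c a2 a0 am b2 b0 bm = 0 \<longleftrightarrow> g11 = 0 \<and> g12 = 0 \<and> g21 = 0 \<and> g22 = 0" for x g11 g12 g21 g22
    using wvec_zero_iff by simp
  have e: "vecl \<mu> (gU x) c a2 a0 am b2 b0 bm = vecl \<mu> 1 c' a2' a0' am' b2' b0' bm' \<Longrightarrow>
     c' \<in> F_space \<mu> \<Longrightarrow> a2' \<in> F_space \<mu> \<Longrightarrow> a0' \<in> F_space \<mu> \<Longrightarrow> am' \<in> F_space \<mu> \<Longrightarrow> b2' \<in> F_space \<mu> \<Longrightarrow> b0' \<in> F_space \<mu> \<Longrightarrow> bm' \<in> F_space \<mu> \<Longrightarrow>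
     vecl \<mu> (gU x) c a2 a0 am b2 b0 bm = 0 \<longleftrightarrow> c' = 0 \<and> a2' = 0 \<and> a0' = 0 \<and> am' = 0 \<and> b2' = 0 \<and> b0' = 0 \<and> bm' = 0"
     for x c' a2' a0' am' b2' b0' bm'
    using vecl_zero_iff by simp
  note X = vecl_x[OF F, THEN x, unfolded s]
  note E = vecl_e[OF F, THEN e]
  show ?thesis
    unfolding sing_sys_def half_sys_def invariant_def pD_linear cs.scale_minus_right
    apply (simp only: ball_simps ball_empty X E mem simp_thms)
    \<comment> \<open>With these instances the equations of the system are atoms, and the rest is
      propositional.\<close>
    using split_Y0[of "ws \<mu> \<cdot> a0" "pD Y1 Y1 b0" "pD Y2 Y2 b0" "eY b2" a0 "hY a0" "ws \<mu> \<cdot> b0" c "fY bm"]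
      split_X0[of "wd \<mu> \<cdot> a0" "eX a2" b0 "hX b0" "hX a0" "wd \<mu> \<cdot> b0" c "fX am"]
      split_rest(1)[of "hY bm" "eY a0" "eY b0" "ws \<mu> \<cdot> bm"] split_rest(2)[of "fY b0" "fY a0" "hY b2" "ws \<mu> \<cdot> b2"]
      split_rest(3)[of "eX a0" "hX am" "eX b0" "wd \<mu> \<cdot> am"] split_rest(4)[of "fX b0" "fX a0" "hX a2" "wd \<mu> \<cdot> a2"]
      split_rest(5)[of am "hY am" "ws \<mu> \<cdot> am"] split_rest(5)[of a2 "hY a2" "ws \<mu> \<cdot> a2"]
      split_rest(5)[of bm "hX bm" "wd \<mu> \<cdot> bm"] split_rest(5)[of b2 "hX b2" "wd \<mu> \<cdot> b2"]
      split_rest(6)[of "eY am"] split_rest(6)[of "fY am"] split_rest(6)[of "eY a2"] split_rest(6)[of "fY a2"]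
      split_rest(6)[of "eX bm"] split_rest(6)[of "fX bm"] split_rest(6)[of "eX b2"] split_rest(6)[of "fX b2"]
      split_rest(7)[of "eX a2" a0] split_rest(8)[of "eY b2" b0] split_rest(9)[of "eX a0" am] split_rest(10)[of "eY b0" bm]
    by argo
qed

section \<open>Generators of the positive part\<close>

lemma vecl_mult_u:
  assumes "c \<in> F_space \<mu>" "a2 \<in> F_space \<mu>" "a0 \<in> F_space \<mu>" "am \<in> F_space \<mu>" "b2 \<in> F_space \<mu>" "b0 \<in> F_space \<mu>" "bm \<in> F_space \<mu>"
  shows "vecl \<mu> (u + u') c a2 a0 am b2 b0 bm = vecl \<mu> u c a2 a0 am b2 b0 bm + vecl \<mu> u' c a2 a0 am b2 b0 bm"
    "vecl \<mu> (uscale k u) c a2 a0 am b2 b0 bm = k \<cdot> vecl \<mu> u c a2 a0 am b2 b0 bm"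
    "vecl \<mu> 0 c a2 a0 am b2 b0 bm = 0"
  by (simp_all add: vecl_def tn_linear tn_linear' assms distrib_right uscale_mult_left cs.scale_right_distrib algebra_simps)

lemma w_commute_pos:
  assumes x: "x \<in> ghom d" and w: "w \<in> ghom (- 1)"
  obtains k where "gU x * gU w = uscale k (gU w * gU x) + gU (g_bracket x w)" "g_bracket x w \<in> ghom (d - 1)"
  using gU_commute[of x "nat (d mod 2)" w "nat (- 1 mod 2)"] ghom_gpar[OF x] ghom_gpar[OF w] ghom_bracket[OF x w]
  by auto

lemma tn_pos: "x \<in> ghom d \<Longrightarrow> d > 0 \<Longrightarrow> f \<in> F_space \<mu> \<Longrightarrow> tn \<mu> (u * gU x) f = 0"
  by (simp add: tn_linear ghom_ge0 F_act_ghom_pos tn_zero)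

text \<open>Moving x to the right past two elements of degree -1 leaves only factors of degree at
  least 3 - 2 = 1 next to F, and these act by zero. The commutation signs k, l, j are
  immaterial.\<close>

lemma high_degree_pair:
  assumes x: "x \<in> ghom d" "d \<ge> 3" and w: "w \<in> ghom (- 1)" "w' \<in> ghom (- 1)" and f: "f \<in> F_space \<mu>"
  shows "tn \<mu> (gU x * (gU w * gU w')) f = 0"
proof -
  obtain k where 1: "gU x * gU w = uscale k (gU w * gU x) + gU (g_bracket x w)" "g_bracket x w \<in> ghom (d - 1)"
    using w_commute_pos[OF x(1) w(1)] .
  obtain l where 2: "gU x * gU w' = uscale l (gU w' * gU x) + gU (g_bracket x w')" "g_bracket x w' \<in> ghom (d - 1)"
    using w_commute_pos[OF x(1) w(2)] .
  obtain j where 3: "gU (g_bracket x w) * gU w' = uscale j (gU w' * gU (g_bracket x w)) + gU (g_bracket (g_bracket x w) w')"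
      "g_bracket (g_bracket x w) w' \<in> ghom (d - 1 - 1)"
    using w_commute_pos[OF 1(2) w(2)] .
  have "gU x * (gU w * gU w') = (gU x * gU w) * gU w'" by (simp only: mult.assoc)
  also have "\<dots> = uscale k (gU w * (gU x * gU w')) + gU (g_bracket x w) * gU w'"
    by (simp only: 1 distrib_right uscale_mult_left mult.assoc)
  also have "\<dots> = uscale (k * l) (gU w * gU w' * gU x) + uscale k (gU w * gU (g_bracket x w'))
      + uscale j (gU w' * gU (g_bracket x w)) + 1 * gU (g_bracket (g_bracket x w) w')"
    by (simp only: 2 3 distrib_left uscale_mult_right mult.assoc us.scale_right_distrib us.scale_scale mult_1_left add.assoc)
  finally show ?thesis
    using x(2) by (simp only: tn_linear[OF f] tn_pos[OF x(1) _ f] tn_pos[OF 1(2) _ f] tn_pos[OF 2(2) _ f] tn_pos[OF 3(2) _ f]) simp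
qed

lemma high_degree_theta:
  assumes x: "x \<in> ghom d" "d \<ge> 3" and f: "f \<in> F_space \<mu>"
  shows "tn \<mu> (gU x * \<Theta>) f = 0"
proof -
  have b: "g_bracket (mon {}) x \<in> ghom (- 2 + d)" by (rule ghom_bracket[OF ghom_facts(15) x(1)])
  have "gU x * \<Theta> = \<Theta> * gU x - 1 * gU (g_bracket (mon {}) x)"
    using gU_commute_even[OF ghom_facts(15) x(1)] by (simp add: algebra_simps)
  then show ?thesis
    using x(2) by (simp only: tn_linear'[OF f] tn_pos[OF x(1) _ f] tn_pos[OF b _ f]) simp
qed

lemma vecl_high_degree:
  assumes F: "c \<in> F_space \<mu>" "a2 \<in> F_space \<mu>" "a0 \<in> F_space \<mu>" "am \<in> F_space \<mu>" "b2 \<in> F_space \<mu>" "b0 \<in> F_space \<mu>" "bm \<in> F_space \<mu>"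
    and x: "x \<in> ghom d" "d \<ge> 3"
  shows "vecl \<mu> (gU x) c a2 a0 am b2 b0 bm = 0"
  unfolding vecl_def w_gU by (simp add: F high_degree_pair[OF x] high_degree_theta[OF x] ghom_facts)

lemma degree_one_basis:
  assumes "gdeg b = 1"
  shows "b \<in> {Mon (1, {I1}), Mon (1, {I2}), Mon (1, {I3}), Mon (1, {I4}),
    Mon (0, {I2, I3, I4}), Mon (0, {I1, I3, I4}), Mon (0, {I1, I2, I4}), Mon (0, {I1, I2, I3})}"
proof (cases b)
  case (Mon f)
  obtain m S where f: "f = (m, S)" by force
  have "2 * m + card S = 3" using assms by (simp add: Mon f)
  moreover have "S \<in> Pow {I1, I2, I3, I4}" by (simp add: UNIV_ix[symmetric])
  moreover have "m = 1 \<and> card S = 1 \<or> m = 0 \<and> card S = 3"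
    using calculation(1) by presburger
  ultimately show ?thesis
    by (simp add: Mon f Pow_insert) (elim disjE; simp add: insert_commute)
qed (use assms in simp)

lemma degree_two_basis:
  assumes "gdeg b = 2"
  shows "b \<in> {Mon (2, {}), Mon (0, {I1, I2, I3, I4}), Mon (1, {I1, I2}), Mon (1, {I3, I4}), Mon (1, {I1, I3}),
    Mon (1, {I2, I4}), Mon (1, {I1, I4}), Mon (1, {I2, I3})}"
proof (cases b)
  case (Mon f)
  obtain m S where f: "f = (m, S)" by force
  have c: "2 * m + card S = 4" using assms by (simp add: Mon f)
  moreover have S: "S \<in> Pow {I1, I2, I3, I4}" by (simp add: UNIV_ix[symmetric])
  moreover have "m = 2 \<and> card S = 0 \<or> m = 1 \<and> card S = 2 \<or> m = 0 \<and> card S = 4"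
    using c by presburger
  ultimately show ?thesis
    by (simp add: Mon f Pow_insert) (elim disjE; simp add: insert_commute)
qed (use assms in simp)

lemma degree_one_span:
  "tm I1 = (- \<i>/4) \<cdot> (xp11 - xp22 + xm11 - xm22)" "tm I2 = (1/4) \<cdot> (xp11 + xp22 + xm11 + xm22)"
  "tm I3 = (- \<i>/4) \<cdot> (xp12 + xp21 + xm12 + xm21)" "tm I4 = (1/4) \<cdot> (xp21 - xp12 + xm21 - xm12)"
  "mon {I2, I3, I4} = (- \<i>/4) \<cdot> (xp11 - xp22 - xm11 + xm22)" "mon {I1, I3, I4} = (1/4) \<cdot> (xm11 + xm22 - xp11 - xp22)"
  "mon {I1, I2, I4} = (- \<i>/4) \<cdot> (xp12 + xp21 - xm12 - xm21)" "mon {I1, I2, I3} = (1/4) \<cdot> (xp12 - xp21 - xm12 + xm21)"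
  unfolding x_defs
  by (rule poly_mapping_eqI, simp add: lookup_add lookup_minus field_simps)+

lemma degree_two_brackets:
  "g_bracket (tm I1) (tm I1) = - bas (Mon (2, {}))"
  "g_bracket (tm I1) (mon {I2, I3, I4}) = bas (Mon (0, {I1, I2, I3, I4}))"
  "g_bracket (tm I3) (mon {I1, I2, I3}) = - bas (Mon (1, {I1, I2}))"
  "g_bracket (tm I1) (mon {I1, I3, I4}) = - bas (Mon (1, {I3, I4}))"
  "g_bracket (tm I2) (mon {I1, I2, I3}) = bas (Mon (1, {I1, I3}))"
  "g_bracket (tm I1) (mon {I1, I2, I4}) = - bas (Mon (1, {I2, I4}))"
  "g_bracket (tm I2) (mon {I1, I2, I4}) = bas (Mon (1, {I1, I4}))"
  "g_bracket (tm I1) (mon {I1, I2, I3}) = - bas (Mon (1, {I2, I3}))"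
  unfolding tm_def mon_def
  by (simp_all add: br_Mon k_bracket_bas kmul_bas d_xi_bas sum_ix psi_eq sg_insert
      ix_less insert_commute insert_Diff_if k_lin of_kalg_linear of_kalg_bas eps_insert_left
      cs.scale_left_distrib[symmetric] cs.scale_left_diff_distrib[symmetric] cscale_two numeral_2_eq_2)

text \<open>The assumption on s says that the coefficients come from one vector. This allows u z to
  be evaluated by letting z act first, so that brackets of annihilating elements annihilate as
  well.\<close>

lemma vecl_pos:
  assumes F: "c \<in> F_space \<mu>" "a2 \<in> F_space \<mu>" "a0 \<in> F_space \<mu>" "am \<in> F_space \<mu>" "b2 \<in> F_space \<mu>" "b0 \<in> F_space \<mu>" "bm \<in> F_space \<mu>"
    and s: "\<And>u. qm \<mu> (pre_act u s) = vecl \<mu> u c a2 a0 am b2 b0 bm"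
    and sys: "sing_sys \<mu> c a2 a0 am b2 b0 bm" and x: "x \<in> g_gt0"
  shows "vecl \<mu> (gU x) c a2 a0 am b2 b0 bm = 0"
proof -
  let ?V = "\<lambda>u. vecl \<mu> u c a2 a0 am b2 b0 bm"
  let ?K = "\<lambda>x. ?V (gU x) = 0"
  have add: "?K (x + y)" if "?K x" "?K y" for x y using that by (simp add: gU_linear vecl_mult_u[OF F])
  have scale: "?K (k \<cdot> x)" if "?K x" for x k using that by (simp add: gU_linear vecl_mult_u[OF F])
  have neg: "?K (- x)" if "?K x" for x using scale[OF that, of "- 1"] by (simp add: cscale_minus_one)
  have diff: "?K (x - y)" if "?K x" "?K y" for x y using add[OF that(1) neg[OF that(2)]] by simp
  have br: "?K (g_bracket x y)" if "x \<in> ghom 1" "y \<in> ghom 1" "?K x" "?K y" for x y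
  proof -
    have "?V (u * gU z) = 0" if "?K z" for u z
      using qm_pre_act_zero[of \<mu> "pre_act (gU z) s" u] that by (simp only: s pre_act_mult[symmetric])
    moreover have "gU (g_bracket x y) = gU x * gU y + gU y * gU x"
      using gU_anticommute[OF that(1,2)] by simp
    ultimately show ?thesis using that by (simp add: vecl_mult_u[OF F])
  qed
  have x8: "?K xp11" "?K xp12" "?K xp21" "?K xp22" "?K xm11" "?K xm12" "?K xm21" "?K xm22"
    using sys unfolding sing_sys_iff[OF F] by blast+
  have one: "?K (tm i)" "?K (mon {I2, I3, I4})" "?K (mon {I1, I3, I4})" "?K (mon {I1, I2, I4})" "?K (mon {I1, I2, I3})" for i
    unfolding degree_one_span by (cases i; simp only: degree_one_span; intro scale add diff x8) (intro scale add diff x8)+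
  have h: "tm i \<in> ghom 1" "mon {I2, I3, I4} \<in> ghom 1" "mon {I1, I3, I4} \<in> ghom 1" "mon {I1, I2, I4} \<in> ghom 1" "mon {I1, I2, I3} \<in> ghom 1" for i
    by (simp_all add: tm_def mon_def ghom_bas)
  have "?K (bas b)" if b: "gdeg b > 0" for b
  proof -
    consider "gdeg b = 1" | "gdeg b = 2" | "gdeg b \<ge> 3" using b by linarith
    then show ?thesis
    proof cases
      case 1
      then show ?thesis
        using degree_one_basis[OF 1] one(1)[of I1] one(1)[of I2] one(1)[of I3] one(1)[of I4] one(2-5)
        unfolding tm_def mon_def by (elim insertE emptyE) simp_all
    next
      case 2
      have k: "?K x" if "?K (- x)" for x using neg[OF that] by simp
      note t = br[OF h(1) h(1) one(1) one(1), of I1 I1] br[OF h(1) h(2) one(1,2), of I1] br[OF h(1) h(5) one(1,5), of I3]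
        br[OF h(1) h(3) one(1,3), of I1] br[OF h(1) h(5) one(1,5), of I2] br[OF h(1) h(4) one(1,4), of I1]
        br[OF h(1) h(4) one(1,4), of I2] br[OF h(1) h(5) one(1,5), of I1]
      show ?thesis
        using degree_two_basis[OF 2] t[unfolded degree_two_brackets]
        by (elim insertE emptyE; hypsubst) (auto intro: k)
    next
      case 3
      then show ?thesis by (intro vecl_high_degree[OF F ghom_bas[OF refl]])
    qed
  qed
  moreover have "gdeg b > 0" if "b \<in> keys x" for b using x that by (simp add: g_gt0_def)
  ultimately have "?K (bas b)" if "b \<in> keys x" for b using that by blast
  then show ?thesis
    by (rule pm_keys_induct[of ?K x, rotated 3]) (auto simp: gU_linear vecl_mult_u[OF F])
qed

section \<open>Solving the system\<close>

text \<open>The coefficient at e comes from the single monomial in which one u is replaced by v.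
  Exponents are subtracted in the naturals, hence the separate case of exponent 0.\<close>

lemma lookup_pD:
  assumes "u \<noteq> v"
  shows "lookup (pD u v p) e = (if lookup e u = 0 then 0
     else of_nat (lookup e v + 1) * lookup p (e - sngl u 1 + sngl v 1))"
proof (induction p rule: pm_induct)
  case (basis f)
  have "lookup f v \<noteq> 0 \<and> f - sngl v 1 + sngl u 1 = e \<longleftrightarrow>
      lookup e u \<noteq> 0 \<and> f = e - sngl u 1 + sngl v 1"
  proof
    assume l: "lookup f v \<noteq> 0 \<and> f - sngl v 1 + sngl u 1 = e"
    then have e: "e = f - sngl v 1 + sngl u 1" by simp
    show "lookup e u \<noteq> 0 \<and> f = e - sngl u 1 + sngl v 1"
      using l assms unfolding e
      by (auto intro!: poly_mapping_eqI simp: lookup_add lookup_minus lookup_single when_def)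
  next
    assume l: "lookup e u \<noteq> 0 \<and> f = e - sngl u 1 + sngl v 1"
    then have f: "f = e - sngl u 1 + sngl v 1" by simp
    show "lookup f v \<noteq> 0 \<and> f - sngl v 1 + sngl u 1 = e"
      using l assms unfolding f
      by (auto intro!: poly_mapping_eqI simp: lookup_add lookup_minus lookup_single when_def)
  qed
  moreover have "lookup f v = lookup e v + 1" if "f = e - sngl u 1 + sngl v 1"
    using that assms by (simp add: lookup_add lookup_minus lookup_single)
  ultimately show ?case
    by (auto simp: pD_bas lookup_single when_def)
qed (auto simp: pD_linear lookup_add algebra_simps)

lemma lookup_pD_same: "lookup (pD u u p) e = of_nat (lookup e u) * lookup p e"
proof (induction p rule: pm_induct)
  case (basis f)
  have "f - sngl u 1 + sngl u 1 = f" if "lookup f u \<noteq> 0"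
    using that by (auto intro!: poly_mapping_eqI simp: lookup_add lookup_minus lookup_single when_def)
  then show ?case by (cases "lookup f u = 0") (auto simp: pD_bas lookup_single when_def)
qed (auto simp: pD_linear lookup_add algebra_simps)

text \<open>If e contained v, replacing one v by u would give a monomial of u \<partial>_v p whose
  coefficient is a nonzero multiple of that of e.\<close>

lemma invariant_exponents:
  assumes "u \<noteq> v" "pD u v p = 0" "pD v u p = 0" "e \<in> keys p"
  shows "lookup e u = 0" "lookup e v = 0"
proof -
  have *: "lookup e v = 0" if "u \<noteq> v" "pD u v p = 0" for u v
  proof (rule ccontr)
    assume v: "lookup e v \<noteq> 0"
    let ?e = "e - sngl v 1 + sngl u 1"
    have "lookup ?e u \<noteq> 0" "?e - sngl u 1 + sngl v 1 = e"
      using v that(1) by (auto intro!: poly_mapping_eqI simp: lookup_add lookup_minus lookup_single when_def)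
    then have "of_nat (lookup ?e v + 1) * lookup p e = 0"
      using lookup_pD[OF that(1), of p ?e] that(2) by simp
    then show False using assms(4) by (auto simp: in_keys_iff simp del: of_nat_add of_nat_Suc)
  qed
  show "lookup e u = 0" "lookup e v = 0" using * assms by metis+
qed

section \<open>Binary forms and the system for one copy of sl_2\<close>

definition mono2 :: "pvar \<Rightarrow> pvar \<Rightarrow> nat \<Rightarrow> nat \<Rightarrow> poly4" where
  "mono2 u v a b = bas (sngl u a + sngl v b)"

definition binary :: "pvar \<Rightarrow> pvar \<Rightarrow> nat \<Rightarrow> poly4 \<Rightarrow> bool" where
  "binary u v m p \<longleftrightarrow> (\<forall>e\<in>keys p. \<exists>i\<le>m. e = sngl u (m - i) + sngl v i)"

definition bcoeff :: "pvar \<Rightarrow> pvar \<Rightarrow> nat \<Rightarrow> poly4 \<Rightarrow> nat \<Rightarrow> complex" where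
  "bcoeff u v m p i = lookup p (sngl u (m - i) + sngl v i)"

lemma binary_eqI:
  assumes "binary u v m p" "binary u v m q" "\<And>i. i \<le> m \<Longrightarrow> bcoeff u v m p i = bcoeff u v m q i"
  shows "p = q"
proof (rule poly_mapping_eqI)
  fix e
  show "lookup p e = lookup q e"
  proof (cases "e \<in> keys p \<union> keys q")
    case True
    then obtain i where "i \<le> m" "e = sngl u (m - i) + sngl v i"
      using assms(1,2) unfolding binary_def by blast
    then show ?thesis using assms(3)[of i] by (simp add: bcoeff_def)
  qed (simp add: in_keys_iff)
qed

lemma binary_closed:
  "binary u v m 0" "binary u v m p \<Longrightarrow> binary u v m (k \<cdot> p)" "binary u v m p \<Longrightarrow> binary u v m (- p)"
  "j \<le> m \<Longrightarrow> binary u v m (mono2 u v (m - j) j)"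
  using keys_cscale[of k p] by (auto simp: binary_def mono2_def)

lemma bcoeff_linear:
  "bcoeff u v m (p + q) i = bcoeff u v m p i + bcoeff u v m q i" "bcoeff u v m (p - q) i = bcoeff u v m p i - bcoeff u v m q i"
  "bcoeff u v m (k \<cdot> p) i = k * bcoeff u v m p i" "bcoeff u v m (- p) i = - bcoeff u v m p i" "bcoeff u v m 0 i = 0"
  by (simp_all add: bcoeff_def lookup_add lookup_minus)

lemma bcoeff_mono2:
  assumes "u \<noteq> v"
  shows "bcoeff u v m (mono2 u v (m - j) j) i = (if i = j then 1 else 0)"
proof -
  have "i = j" if "sngl u (m - j) + sngl v j = sngl u (m - i) + sngl v i"
    using arg_cong[OF that, of "\<lambda>e. lookup e v"] assms by (simp add: lookup_add lookup_single)
  then show ?thesis by (auto simp: bcoeff_def mono2_def lookup_single when_def)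
qed

lemma bcoeff_pD:
  assumes "u \<noteq> v" "i \<le> m"
  shows "bcoeff u v m (pD u v p) i = (if i = m then 0 else of_nat (i + 1) * bcoeff u v m p (i + 1))"
    "bcoeff u v m (pD v u p) i = (if i = 0 then 0 else of_nat (m - i + 1) * bcoeff u v m p (i - 1))"
    "bcoeff u v m (pD u u p) i = of_nat (m - i) * bcoeff u v m p i"
    "bcoeff u v m (pD v v p) i = of_nat i * bcoeff u v m p i"
proof -
  let ?E = "\<lambda>i. sngl u (m - i) + sngl v i"
  have l: "lookup (?E j) u = m - j" "lookup (?E j) v = j" for j
    using assms(1) by (simp_all add: lookup_add lookup_single)
  have "?E i - sngl u 1 + sngl v 1 = ?E (i + 1)" if "i < m"
    using that assms(1) by (intro poly_mapping_eqI) (auto simp: lookup_add lookup_minus lookup_single when_def)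
  then show "bcoeff u v m (pD u v p) i = (if i = m then 0 else of_nat (i + 1) * bcoeff u v m p (i + 1))"
    using assms(2) by (auto simp: bcoeff_def lookup_pD[OF assms(1)] l)
  have "?E i - sngl v 1 + sngl u 1 = ?E (i - 1)" if "i > 0"
    using that assms by (intro poly_mapping_eqI) (auto simp: lookup_add lookup_minus lookup_single when_def)
  then show "bcoeff u v m (pD v u p) i = (if i = 0 then 0 else of_nat (m - i + 1) * bcoeff u v m p (i - 1))"
    by (auto simp: bcoeff_def lookup_pD[OF assms(1)[symmetric]] l)
  show "bcoeff u v m (pD u u p) i = of_nat (m - i) * bcoeff u v m p i"
    "bcoeff u v m (pD v v p) i = of_nat i * bcoeff u v m p i"
    by (simp_all add: bcoeff_def lookup_pD_same l)
qed

abbreviation "pair_sys u v \<equiv> half_sys (pD u v) (pD v u) (\<lambda>p. pD u u p - pD v v p)"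

text \<open>Index i belongs to u^(m-i) v^i. At index 0 the terms with f drop out, and those with e
  are replaced through the highest weight equations; thus the 4 in d - m - 4 comes from 2 e p2 = -4
  p0, and the 2 in 2 + m from 2 e p0 = 2 pm.\<close>

lemma half_sys_coeffs:
  fixes m :: nat
  assumes uv: "u \<noteq> v"
    and H: "pair_sys u v d c p2 p0 pm"
  defines "C \<equiv> bcoeff u v m"
  shows "C p0 m = 0"
    "\<And>i. i < m \<Longrightarrow> C pm (i + 1) = 0"
    "\<And>i. i < m \<Longrightarrow> of_nat (i + 1) * C p0 (i + 1) = C pm i" "C pm m = 0"
    "\<And>i. i < m \<Longrightarrow> of_nat (i + 1) * C p2 (i + 1) = - (2 * C p0 i)"
    "(d - of_nat m - 4) * C p0 0 = C c 0" "(- d - of_nat m) * C p0 0 = C c 0"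
    "(2 + of_nat m) * C pm 0 = d * C pm 0" "(of_nat m + d) * C p2 0 = 0"
proof -
  have h: "d \<cdot> p0 - (pD u u p0 - pD v v p0) + 2 \<cdot> pD u v p2 = c" "2 \<cdot> pD v u pm - (pD u u p0 - pD v v p0) - d \<cdot> p0 = c"
    "2 \<cdot> pD u v p0 + (pD u u pm - pD v v pm) = d \<cdot> pm" "2 \<cdot> pD v u p0 + (pD u u p2 - pD v v p2) + d \<cdot> p2 = 0"
    "pD u v pm = 0" "pD u v p0 = pm" "pD u v p2 = - (2 \<cdot> p0)"
    using H unfolding half_sys_def by blast+
  note pd = bcoeff_pD[OF uv]
  show "C pm (i + 1) = 0" if "i < m" for i
    using arg_cong[OF h(5), of "\<lambda>p. C p i"] that by (simp add: C_def pd bcoeff_linear del: of_nat_add of_nat_Suc)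
  show "of_nat (i + 1) * C p0 (i + 1) = C pm i" if "i < m" for i
    using arg_cong[OF h(6), of "\<lambda>p. C p i"] that by (simp add: C_def pd bcoeff_linear)
  show "C pm m = 0"
    using arg_cong[OF h(6), of "\<lambda>p. C p m"] by (simp add: C_def pd bcoeff_linear)
  show "of_nat (i + 1) * C p2 (i + 1) = - (2 * C p0 i)" if "i < m" for i
    using arg_cong[OF h(7), of "\<lambda>p. C p i"] that by (simp add: C_def pd bcoeff_linear)
  show "C p0 m = 0"
    using arg_cong[OF h(7), of "\<lambda>p. C p m"] by (simp add: C_def pd bcoeff_linear)
  show "(d - of_nat m - 4) * C p0 0 = C c 0"
    using arg_cong[OF h(1), of "\<lambda>p. C p 0"] by (simp add: C_def pd(3,4) h(7) bcoeff_linear algebra_simps)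
  show "(- d - of_nat m) * C p0 0 = C c 0"
    using arg_cong[OF h(2), of "\<lambda>p. C p 0"] by (simp add: C_def pd(2-4) bcoeff_linear algebra_simps)
  show "(2 + of_nat m) * C pm 0 = d * C pm 0"
    using arg_cong[OF h(3), of "\<lambda>p. C p 0"] by (simp add: C_def pd(3,4) h(6) bcoeff_linear algebra_simps)
  show "(of_nat m + d) * C p2 0 = 0"
    using arg_cong[OF h(4), of "\<lambda>p. C p 0"] by (simp add: C_def pd(2-4) bcoeff_linear algebra_simps)
qed

text \<open>Since e pm = 0, the form pm is a multiple of u^m. It determines p0 and p2 up to their
  coefficients at index 0, which measure the middle and the top component. Whether pm vanishes
  separates the top component from the bottom one.\<close>

lemma half_sys_solve:
  assumes uv: "u \<noteq> v" and B: "binary u v m p2" "binary u v m p0" "binary u v m pm"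
    and H: "pair_sys u v d 0 p2 p0 pm"
  shows "(p2 = 0 \<and> p0 = 0 \<and> pm = 0) \<or>
    (\<exists>k. k \<noteq> 0 \<and> d = - of_nat m \<and> p2 = k \<cdot> mono2 u v m 0 \<and> p0 = 0 \<and> pm = 0) \<or>
    (\<exists>k. k \<noteq> 0 \<and> m > 1 \<and> d = of_nat m + 2 \<and> p2 = - (k \<cdot> mono2 u v (m - 2) 2) \<and> p0 = k \<cdot> mono2 u v (m - 1) 1 \<and> pm = k \<cdot> mono2 u v m 0)"
proof -
  let ?C = "bcoeff u v m"
  note C = half_sys_coeffs[OF uv H, where m = m]
  have pm: "?C pm i = 0" if "0 < i" "i \<le> m" for i
    using C(2)[of "i - 1"] that by simp
  have p0: "of_nat i * ?C p0 i = ?C pm (i - 1)" if "0 < i" "i \<le> m" for i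
    using C(3)[of "i - 1"] that by (simp del: of_nat_Suc)
  have p2: "of_nat i * ?C p2 i = - (2 * ?C p0 (i - 1))" if "0 < i" "i \<le> m" for i
    using C(5)[of "i - 1"] that by (simp del: of_nat_Suc)
  \<comment> \<open>Adding the two equations with right-hand side c = 0 eliminates d. As 2m + 4 is
    nonzero, this excludes the middle component.\<close>
  have "(2 * of_nat m + 4) * ?C p0 0 = - ((d - of_nat m - 4) * ?C p0 0 + (- d - of_nat m) * ?C p0 0)"
    by (simp add: algebra_simps)
  also have "\<dots> = 0" unfolding C(6,7) by (simp add: bcoeff_linear)
  finally have "(2 * of_nat m + 4) * ?C p0 0 = 0" .
  moreover have "2 * of_nat m + 4 \<noteq> (0 :: complex)"
    by (simp add: complex_eq_iff)
  ultimately have b: "?C p0 0 = 0" by simp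
  note mono = bcoeff_mono2[OF uv, of m 0, simplified] bcoeff_mono2[OF uv]
  have top: "binary u v m (mono2 u v m 0)" using binary_closed(4)[of 0 m u v] by simp
  show ?thesis
  proof (cases "?C pm 0 = 0")
    case True
    then have pm0: "?C pm i = 0" if "i \<le> m" for i using pm that by (cases i) auto
    have p00: "?C p0 i = 0" if "i \<le> m" for i using p0[of i] pm0[of "i - 1"] b that by (cases "i = 0") auto
    have p20: "?C p2 i = 0" if "i \<le> m" "0 < i" for i using p2[of i] p00[of "i - 1"] that by auto
    have z: "p0 = 0" "pm = 0"
      using pm0 p00 by (auto intro!: binary_eqI B binary_closed simp: bcoeff_linear)
    have p2m: "p2 = ?C p2 0 \<cdot> mono2 u v m 0"
      using p20 by (intro binary_eqI[of u v m]) (auto simp: B bcoeff_linear mono intro!: binary_closed(2) top)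
    show ?thesis
    proof (cases "?C p2 0 = 0")
      case True
      then have "p2 = 0" using p2m cs.scale_zero_left by metis
      with z show ?thesis by blast
    next
      case False
      then have "d = - of_nat m" using C(9) by (simp add: add_eq_0_iff)
      with False p2m z show ?thesis by blast
    qed
  next
    case False
    \<comment> \<open>The coefficient of pm at index 0 is \<open>?C pm m\<close> if m = 0 and equals
      \<open>?C p0 m\<close> if m = 1; both are zero.\<close>
    have m: "m > 1"
    proof (rule ccontr)
      assume "\<not> m > 1"
      then have "m = 0 \<or> m = 1" by linarith
      then show False using False C(1,4) p0[of 1] by auto
    qed
    have d: "d = of_nat m + 2" using C(8) False by (simp add: add.commute)
    have "of_nat m + d \<noteq> 0" unfolding d by (simp add: complex_eq_iff)
    then have p20: "?C p2 0 = 0" using C(9) by simp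
    have p01: "?C p0 1 = ?C pm 0" using p0[of 1] m by simp
    have p0i: "?C p0 i = 0" if "i \<noteq> 1" "i \<le> m" for i
      using p0[of i] pm[of "i - 1"] b that by (cases "i = 0") auto
    have p22: "?C p2 2 = - ?C pm 0" using p2[of 2] p01 m by simp
    have p2i: "?C p2 i = 0" if "i \<noteq> 2" "i \<le> m" for i
      using p2[of i] p0i[of "i - 1"] p20 that by (cases "i = 0") auto
    have "pm = ?C pm 0 \<cdot> mono2 u v m 0"
      using pm by (intro binary_eqI[of u v m]) (auto simp: B bcoeff_linear mono intro!: binary_closed(2) top)
    moreover have "p0 = ?C pm 0 \<cdot> mono2 u v (m - 1) 1"
      using p01 p0i m by (intro binary_eqI[of u v m]) (auto simp: B bcoeff_linear mono intro!: binary_closed)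
    moreover have "p2 = - (?C pm 0 \<cdot> mono2 u v (m - 2) 2)"
      using p22 p2i m by (intro binary_eqI[of u v m]) (auto simp: B bcoeff_linear mono intro!: binary_closed)
    ultimately show ?thesis using False m d by blast
  qed
qed

text \<open>The situation in which both halves could be nonzero: c is arbitrary, but for m = 0 the
  forms p0 and pm vanish at once, and (m + d) p2 = 0 with d = 2.\<close>

lemma half_sys_trivial:
  assumes uv: "u \<noteq> v" and B: "binary u v 0 p2" "binary u v 0 p0" "binary u v 0 pm"
    and H: "pair_sys u v 2 c p2 p0 pm"
  shows "p2 = 0 \<and> p0 = 0 \<and> pm = 0"
  using half_sys_coeffs(1,4,9)[OF uv H, where m = 0]
  by (intro conjI; intro binary_eqI[of u v 0]) (auto simp: B binary_closed bcoeff_linear)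

lemma pD_mono2:
  assumes "u \<noteq> v"
  shows "pD u v (mono2 u v a b) = of_nat b \<cdot> mono2 u v (a + 1) (b - 1)"
    "pD v u (mono2 u v a b) = of_nat a \<cdot> mono2 u v (a - 1) (b + 1)"
    "pD u u (mono2 u v a b) = of_nat a \<cdot> mono2 u v a b" "pD v v (mono2 u v a b) = of_nat b \<cdot> mono2 u v a b"
    "w \<noteq> u \<Longrightarrow> w \<noteq> v \<Longrightarrow> pD x w (mono2 u v a b) = 0"
proof -
  have l: "lookup (sngl u a + sngl v b) u = a"
    "lookup (sngl u a + sngl v b) v = b"
    using assms by (simp_all add: lookup_add lookup_single)
  have "b \<noteq> 0 \<Longrightarrow> sngl u a + sngl v b - sngl v 1 + sngl u 1
      = sngl u (a + 1) + sngl v (b - 1)"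
    "a \<noteq> 0 \<Longrightarrow> sngl u a + sngl v b - sngl u 1 + sngl v 1
      = sngl u (a - 1) + sngl v (b + 1)"
    "b \<noteq> 0 \<Longrightarrow> sngl u a + sngl v b - sngl v 1 + sngl v 1
      = sngl u a + sngl v b"
    "a \<noteq> 0 \<Longrightarrow> sngl u a + sngl v b - sngl u 1 + sngl u 1
      = sngl u a + sngl v b"
    using assms by (auto intro!: poly_mapping_eqI simp: lookup_add lookup_minus lookup_single when_def)
  then show "pD u v (mono2 u v a b) = of_nat b \<cdot> mono2 u v (a + 1) (b - 1)"
    "pD v u (mono2 u v a b) = of_nat a \<cdot> mono2 u v (a - 1) (b + 1)"
    "pD u u (mono2 u v a b) = of_nat a \<cdot> mono2 u v a b" "pD v v (mono2 u v a b) = of_nat b \<cdot> mono2 u v a b"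
    unfolding mono2_def pD_bas l by (cases "a = 0"; cases "b = 0"; simp)+
  show "w \<noteq> u \<Longrightarrow> w \<noteq> v \<Longrightarrow> pD x w (mono2 u v a b) = 0"
    by (simp add: mono2_def pD_bas lookup_add lookup_single)
qed

lemma half_sys_solutions:
  assumes "u \<noteq> v"
  shows "pair_sys u v d 0 0 0 0"
    "pair_sys u v (- of_nat m) 0 (k \<cdot> mono2 u v m 0) 0 0"
    "m > 1 \<Longrightarrow> pair_sys u v (of_nat m + 2) 0
      (- (k \<cdot> mono2 u v (m - 2) 2)) (k \<cdot> mono2 u v (m - 1) 1) (k \<cdot> mono2 u v m 0)"
proof -
  show "pair_sys u v d 0 0 0 0"
    by (simp add: half_sys_def pD_linear)
  show "pair_sys u v (- of_nat m) 0 (k \<cdot> mono2 u v m 0) 0 0"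
    by (simp add: half_sys_def pD_linear pD_mono2 assms mult.commute)
  assume "m > 1"
  \<comment> \<open>Removes the truncated subtractions.\<close>
  define n where "n = m - 2"
  with \<open>m > 1\<close> have m: "m = n + 2" by simp
  show "pair_sys u v (of_nat m + 2) 0
      (- (k \<cdot> mono2 u v (m - 2) 2)) (k \<cdot> mono2 u v (m - 1) 1) (k \<cdot> mono2 u v m 0)"
    unfolding half_sys_def m
    by (simp add: pD_linear pD_mono2 assms numeral_2_eq_2)
      (auto simp: poly_all_eq lookup_add lookup_minus ring_distribs)
qed

section \<open>Classification\<close>

lemma binary_F_space:
  assumes "p \<in> F_space \<mu>"
  shows "fst (snd \<mu>) = 0 \<Longrightarrow> binary X1 X2 (fst \<mu>) p" "fst \<mu> = 0 \<Longrightarrow> binary Y1 Y2 (fst (snd \<mu>)) p"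
proof -
  have k: "lookup e X1 + lookup e X2 = fst \<mu>" "lookup e Y1 + lookup e Y2 = fst (snd \<mu>)" if "e \<in> keys p" for e
    using assms that by (auto simp: F_space_eq)
  have ext: "e = f" if "lookup e X1 = lookup f X1" "lookup e X2 = lookup f X2" "lookup e Y1 = lookup f Y1" "lookup e Y2 = lookup f Y2"
    for e f :: "pvar \<Rightarrow>\<^sub>0 nat"
  proof (rule poly_mapping_eqI)
    show "lookup e u = lookup f u" for u using that by (cases u) simp_all
  qed
  show "binary X1 X2 (fst \<mu>) p" if "fst (snd \<mu>) = 0"
    unfolding binary_def
  proof
    fix e assume "e \<in> keys p"
    from k[OF this] that
    show "\<exists>i\<le>fst \<mu>. e = sngl X1 (fst \<mu> - i) + sngl X2 i"
      by (intro exI[of _ "lookup e X2"] conjI ext) (auto simp: lookup_add lookup_single)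
  qed
  show "binary Y1 Y2 (fst (snd \<mu>)) p" if "fst \<mu> = 0"
    unfolding binary_def
  proof
    fix e assume "e \<in> keys p"
    from k[OF this] that
    show "\<exists>i\<le>fst (snd \<mu>). e = sngl Y1 (fst (snd \<mu>) - i) + sngl Y2 i"
      by (intro exI[of _ "lookup e Y2"] conjI ext) (auto simp: lookup_add lookup_single)
  qed
qed

text \<open>By \<open>invariant_exponents\<close> a monomial of p contains neither of the two
  variables, and F is homogeneous in them.\<close>

lemma invariant_degree:
  assumes "p \<in> F_space \<mu>" "p \<noteq> 0"
  shows "invariant eY fY hY s p \<Longrightarrow> fst (snd \<mu>) = 0 \<and> s = 2" "invariant eX fX hX s p \<Longrightarrow> fst \<mu> = 0 \<and> s = 2"
proof -
  obtain e where e: "e \<in> keys p" using assms(2) by (metis ex_in_conv keys_eq_empty)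
  then have k: "lookup e X1 + lookup e X2 = fst \<mu>" "lookup e Y1 + lookup e Y2 = fst (snd \<mu>)"
    using assms(1) by (auto simp: F_space_eq)
  have s: "s = 2" if "s \<cdot> p = 2 \<cdot> p" using that assms(2) by simp
  show "fst (snd \<mu>) = 0 \<and> s = 2" if "invariant eY fY hY s p"
    using that invariant_exponents[of Y1 Y2 p e] e k s by (simp add: invariant_def)
  show "fst \<mu> = 0 \<and> s = 2" if "invariant eX fX hX s p"
    using that invariant_exponents[of X1 X2 p e] e k s by (simp add: invariant_def)
qed

text \<open>The minus sign of b0 in the last family arises because the common system is solved for -
  b0.\<close>

definition solution :: "weight \<Rightarrow> poly4 \<Rightarrow> poly4 \<Rightarrow> poly4 \<Rightarrow> poly4 \<Rightarrow> poly4 \<Rightarrow> poly4 \<Rightarrow> bool" where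
  "solution \<mu> a2 a0 am b2 b0 bm \<longleftrightarrow> (\<exists>k m n. k \<noteq> 0 \<and>
     (\<mu> = (0, n, 1 - of_nat n / 2, - 1 - of_nat n / 2) \<and> a2 = 0 \<and> a0 = 0 \<and> am = 0 \<and> b2 = k \<cdot> mono2 Y1 Y2 n 0 \<and> b0 = 0 \<and> bm = 0 \<or>
      \<mu> = (m, 0, 1 - of_nat m / 2, 1 + of_nat m / 2) \<and> a2 = k \<cdot> mono2 X1 X2 m 0 \<and> a0 = 0 \<and> am = 0 \<and> b2 = 0 \<and> b0 = 0 \<and> bm = 0 \<or>
      m > 1 \<and> \<mu> = (m, 0, 2 + of_nat m / 2, - of_nat m / 2) \<and> a2 = - (k \<cdot> mono2 X1 X2 (m - 2) 2) \<and>
        a0 = k \<cdot> mono2 X1 X2 (m - 1) 1 \<and> am = k \<cdot> mono2 X1 X2 m 0 \<and> b2 = 0 \<and> b0 = 0 \<and> bm = 0 \<or>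
      n > 1 \<and> \<mu> = (0, n, 2 + of_nat n / 2, of_nat n / 2) \<and> a2 = 0 \<and> a0 = 0 \<and> am = 0 \<and>
        b2 = - (k \<cdot> mono2 Y1 Y2 (n - 2) 2) \<and> b0 = - (k \<cdot> mono2 Y1 Y2 (n - 1) 1) \<and> bm = k \<cdot> mono2 Y1 Y2 n 0))"

lemma weight_eqI:
  fixes \<mu> :: weight
  assumes "fst \<mu> = m" "fst (snd \<mu>) = n" "ws \<mu> = t + c" "wd \<mu> = t - c"
  shows "\<mu> = (m, n, t, c)"
proof -
  have "2 * wt \<mu> = 2 * t" "2 * wc \<mu> = 2 * c" using assms(3,4) by algebra+
  then show ?thesis using assms(1,2) by (cases \<mu>) auto
qed

text \<open>A nonzero half makes the other copy of sl_2 act trivially and fixes t + C or t - C as 2;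
  \<open>half_sys_solve\<close> for its own copy fixes the other number and the vector.\<close>

lemma sing_sys_solution:
  assumes F: "c \<in> F_space \<mu>" "a2 \<in> F_space \<mu>" "a0 \<in> F_space \<mu>" "am \<in> F_space \<mu>" "b2 \<in> F_space \<mu>" "b0 \<in> F_space \<mu>" "bm \<in> F_space \<mu>"
    and sys: "sing_sys \<mu> c a2 a0 am b2 b0 bm" and nz: "\<not> (c = 0 \<and> a2 = 0 \<and> a0 = 0 \<and> am = 0 \<and> b2 = 0 \<and> b0 = 0 \<and> bm = 0)"
  shows "c = 0 \<and> solution \<mu> a2 a0 am b2 b0 bm"
proof -
  let ?A = "a2 = 0 \<and> a0 = 0 \<and> am = 0" and ?B = "b2 = 0 \<and> b0 = 0 \<and> bm = 0"
  have X: "half_sys eX fX hX (wd \<mu>) c a2 a0 am" and Y: "half_sys eY fY hY (ws \<mu>) c b2 (- b0) bm"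
    and iY: "\<And>p. p \<in> {a2, a0, am} \<Longrightarrow> invariant eY fY hY (ws \<mu>) p" and iX: "\<And>p. p \<in> {b2, b0, bm} \<Longrightarrow> invariant eX fX hX (wd \<mu>) p"
    using sys unfolding sing_sys_def by blast+
  have A: "fst (snd \<mu>) = 0 \<and> ws \<mu> = 2" if "\<not> ?A"
    using that invariant_degree(1)[OF F(2) _ iY] invariant_degree(1)[OF F(3) _ iY] invariant_degree(1)[OF F(4) _ iY] by blast
  have B: "fst \<mu> = 0 \<and> wd \<mu> = 2" if "\<not> ?B"
    using that invariant_degree(2)[OF F(5) _ iX] invariant_degree(2)[OF F(6) _ iX] invariant_degree(2)[OF F(7) _ iX] by blast
  \<comment> \<open>For a vanishing half the first equation of its system reads 0 = c.\<close>
  have cA: "c = 0" if ?A using X that by (simp add: half_sys_def pD_linear)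
  have cB: "c = 0" if ?B using Y that by (simp add: half_sys_def pD_linear)
  note bX = binary_F_space(1)[OF F(2)] binary_F_space(1)[OF F(3)] binary_F_space(1)[OF F(4)]
  note bY = binary_F_space(2)[OF F(5)] binary_F_space(2)[OF F(6)] binary_F_space(2)[OF F(7)]
  \<comment> \<open>Two nonzero halves give m = n = 0 and t - C = 2, where
    \<open>half_sys_trivial\<close> makes the first half vanish.\<close>
  have AB: "?A \<or> ?B"
  proof (rule ccontr)
    assume n: "\<not> (?A \<or> ?B)"
    then have "fst \<mu> = 0" "fst (snd \<mu>) = 0" "wd \<mu> = 2" using A B by blast+
    then show False
      using n half_sys_trivial[of X1 X2 a2 a0 am c] bX X by simp
  qed
  then have c: "c = 0" using cA cB by blast
  from AB show ?thesis
  proof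
    assume a: ?A
    then have nb: "\<not> ?B" using nz c by blast
    have b: "(b2 = 0 \<and> - b0 = 0 \<and> bm = 0) \<or>
    (\<exists>k. k \<noteq> 0 \<and> ws \<mu> = - of_nat (fst (snd \<mu>)) \<and> b2 = k \<cdot> mono2 Y1 Y2 (fst (snd \<mu>)) 0 \<and> - b0 = 0 \<and> bm = 0) \<or>
    (\<exists>k. k \<noteq> 0 \<and> fst (snd \<mu>) > 1 \<and> ws \<mu> = of_nat (fst (snd \<mu>)) + 2 \<and> b2 = - (k \<cdot> mono2 Y1 Y2 (fst (snd \<mu>) - 2) 2) \<and>
       - b0 = k \<cdot> mono2 Y1 Y2 (fst (snd \<mu>) - 1) 1 \<and> bm = k \<cdot> mono2 Y1 Y2 (fst (snd \<mu>)) 0)"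
      using B[OF nb] Y c by (intro half_sys_solve bY binary_closed) simp_all
    then show ?thesis
    proof (elim disjE exE)
      assume "b2 = 0 \<and> - b0 = 0 \<and> bm = 0"
      then show ?thesis using nb by simp
    next
      fix k assume "k \<noteq> 0 \<and> ws \<mu> = - of_nat (fst (snd \<mu>)) \<and> b2 = k \<cdot> mono2 Y1 Y2 (fst (snd \<mu>)) 0 \<and> - b0 = 0 \<and> bm = 0"
      moreover from this have "\<mu> = (0, fst (snd \<mu>), 1 - of_nat (fst (snd \<mu>)) / 2, - 1 - of_nat (fst (snd \<mu>)) / 2)"
        using B[OF nb] by (intro weight_eqI) auto
      ultimately show ?thesis
        using a c unfolding solution_def by (metis neg_equal_0_iff_equal)
    next
      fix k assume "k \<noteq> 0 \<and> fst (snd \<mu>) > 1 \<and> ws \<mu> = of_nat (fst (snd \<mu>)) + 2 \<and> b2 = - (k \<cdot> mono2 Y1 Y2 (fst (snd \<mu>) - 2) 2) \<and>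
        - b0 = k \<cdot> mono2 Y1 Y2 (fst (snd \<mu>) - 1) 1 \<and> bm = k \<cdot> mono2 Y1 Y2 (fst (snd \<mu>)) 0"
      moreover from this have "\<mu> = (0, fst (snd \<mu>), 2 + of_nat (fst (snd \<mu>)) / 2, of_nat (fst (snd \<mu>)) / 2)"
        using B[OF nb] by (intro weight_eqI) auto
      ultimately show ?thesis
        using a c unfolding solution_def by (metis minus_equation_iff)
    qed
  next
    assume b: ?B
    then have na: "\<not> ?A" using nz c by blast
    have "(a2 = 0 \<and> a0 = 0 \<and> am = 0) \<or>
    (\<exists>k. k \<noteq> 0 \<and> wd \<mu> = - of_nat (fst \<mu>) \<and> a2 = k \<cdot> mono2 X1 X2 (fst \<mu>) 0 \<and> a0 = 0 \<and> am = 0) \<or>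
    (\<exists>k. k \<noteq> 0 \<and> fst \<mu> > 1 \<and> wd \<mu> = of_nat (fst \<mu>) + 2 \<and> a2 = - (k \<cdot> mono2 X1 X2 (fst \<mu> - 2) 2) \<and>
       a0 = k \<cdot> mono2 X1 X2 (fst \<mu> - 1) 1 \<and> am = k \<cdot> mono2 X1 X2 (fst \<mu>) 0)"
      using A[OF na] X c by (intro half_sys_solve bX) simp_all
    then show ?thesis
    proof (elim disjE exE)
      assume "a2 = 0 \<and> a0 = 0 \<and> am = 0"
      then show ?thesis using na by simp
    next
      fix k assume "k \<noteq> 0 \<and> wd \<mu> = - of_nat (fst \<mu>) \<and> a2 = k \<cdot> mono2 X1 X2 (fst \<mu>) 0 \<and> a0 = 0 \<and> am = 0"
      moreover from this have "\<mu> = (fst \<mu>, 0, 1 - of_nat (fst \<mu>) / 2, 1 + of_nat (fst \<mu>) / 2)"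
        using A[OF na] by (intro weight_eqI) auto
      ultimately show ?thesis
        using b c unfolding solution_def by metis
    next
      fix k assume "k \<noteq> 0 \<and> fst \<mu> > 1 \<and> wd \<mu> = of_nat (fst \<mu>) + 2 \<and> a2 = - (k \<cdot> mono2 X1 X2 (fst \<mu> - 2) 2) \<and>
       a0 = k \<cdot> mono2 X1 X2 (fst \<mu> - 1) 1 \<and> am = k \<cdot> mono2 X1 X2 (fst \<mu>) 0"
      moreover from this have "\<mu> = (fst \<mu>, 0, 2 + of_nat (fst \<mu>) / 2, - of_nat (fst \<mu>) / 2)"
        using A[OF na] by (intro weight_eqI) auto
      ultimately show ?thesis
        using b c unfolding solution_def by metis
    qed
  qed
qed

lemma mono2_F_space:
  "fst \<mu> = a + b \<Longrightarrow> fst (snd \<mu>) = 0 \<Longrightarrow> mono2 X1 X2 a b \<in> F_space \<mu>"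
  "fst \<mu> = 0 \<Longrightarrow> fst (snd \<mu>) = a + b \<Longrightarrow> mono2 Y1 Y2 a b \<in> F_space \<mu>"
  by (simp_all add: F_space_eq mono2_def lookup_add lookup_single)

lemma solution_sing_sys:
  assumes "solution \<mu> a2 a0 am b2 b0 bm"
  shows "sing_sys \<mu> 0 a2 a0 am b2 b0 bm" "a2 \<in> F_space \<mu>" "a0 \<in> F_space \<mu>" "am \<in> F_space \<mu>" "b2 \<in> F_space \<mu>" "b0 \<in> F_space \<mu>"
    "bm \<in> F_space \<mu>" "\<not> (a2 = 0 \<and> a0 = 0 \<and> am = 0 \<and> b2 = 0 \<and> b0 = 0 \<and> bm = 0)"
proof -
  have nz: "mono2 u v a b \<noteq> 0" for u v a b by (simp add: mono2_def)
  note FX = mono2_F_space(1) and FY = mono2_F_space(2)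
  note H = half_sys_solutions[of X1 X2] half_sys_solutions[of Y1 Y2]
  have "sing_sys \<mu> 0 a2 a0 am b2 b0 bm \<and> a2 \<in> F_space \<mu> \<and> a0 \<in> F_space \<mu> \<and> am \<in> F_space \<mu> \<and> b2 \<in> F_space \<mu> \<and>
    b0 \<in> F_space \<mu> \<and> bm \<in> F_space \<mu> \<and> \<not> (a2 = 0 \<and> a0 = 0 \<and> am = 0 \<and> b2 = 0 \<and> b0 = 0 \<and> bm = 0)"
    using assms unfolding solution_def
  proof (elim exE conjE disjE, goal_cases)
    case (1 k m n)
    have "ws \<mu> = - of_nat n" "wd \<mu> = 2" "fst \<mu> = 0" "fst (snd \<mu>) = n" by (simp_all add: 1(2))
    then show ?case
      using 1(1,3-) H(1,5) by (simp add: sing_sys_def invariant_def pD_linear pD_mono2 nz FY F_space_linear)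
  next
    case (2 k m n)
    have "ws \<mu> = 2" "wd \<mu> = - of_nat m" "fst \<mu> = m" "fst (snd \<mu>) = 0" by (simp_all add: 2(2))
    then show ?case
      using 2(1,3-) H(2,4) by (simp add: sing_sys_def invariant_def pD_linear pD_mono2 nz FX F_space_linear)
  next
    case (3 k m n)
    have "ws \<mu> = 2" "wd \<mu> = of_nat m + 2" "fst \<mu> = m" "fst (snd \<mu>) = 0" by (simp_all add: 3(3))
    then show ?case
      using 3(1,2,4-) H(3,4) by (simp add: sing_sys_def invariant_def pD_linear pD_mono2 nz FX F_space_linear)
  next
    case (4 k m n)
    have "ws \<mu> = of_nat n + 2" "wd \<mu> = 2" "fst \<mu> = 0" "fst (snd \<mu>) = n" by (simp_all add: 4(3))
    then show ?case
      using 4(1,2,4-) H(1,6) by (simp add: sing_sys_def invariant_def pD_linear pD_mono2 nz FY F_space_linear)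
  qed
  then show "sing_sys \<mu> 0 a2 a0 am b2 b0 bm" "a2 \<in> F_space \<mu>" "a0 \<in> F_space \<mu>" "am \<in> F_space \<mu>" "b2 \<in> F_space \<mu>" "b0 \<in> F_space \<mu>"
    "bm \<in> F_space \<mu>" "\<not> (a2 = 0 \<and> a0 = 0 \<and> am = 0 \<and> b2 = 0 \<and> b0 = 0 \<and> bm = 0)"
    by blast+
qed

section \<open>From solutions of the system to vectors of the induced module\<close>

lemma pv_power: "pv u ^ n = bas (sngl u n)"
proof (induction n)
  case (Suc n)
  then show ?case by (simp add: pv_bas single_add[symmetric])
qed simp

lemma pv_mono2: "pv u ^ a * pv v ^ b = mono2 u v a b"
  by (simp add: pv_power mult_single mono2_def)

lemma eta_U_neg: "\<eta> i * \<eta> j \<in> U_neg 2"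
proof -
  have "\<eta> i * \<eta> j = prod_list (map (gU \<circ> bas) [lt (Et i), lt (Et j)])"
    by (simp add: \<eta>_def mon_def)
  moreover have "(\<forall>b\<in>set [lt (Et i), lt (Et j)]. gdeg b < 0) \<and> sum_list (map gdeg [lt (Et i), lt (Et j)]) = - int 2" by simp
  ultimately show ?thesis unfolding U_neg_def by (intro us.span_base) blast
qed

lemma U_neg_closed:
  "u \<in> U_neg d \<Longrightarrow> u' \<in> U_neg d \<Longrightarrow> u + u' \<in> U_neg d" "u \<in> U_neg d \<Longrightarrow> u' \<in> U_neg d \<Longrightarrow> u - u' \<in> U_neg d"
  "u \<in> U_neg d \<Longrightarrow> uscale k u \<in> U_neg d" "u \<in> U_neg d \<Longrightarrow> - u \<in> U_neg d"
  by (simp_all add: U_neg_def us.span_add us.span_diff us.span_scale us.span_neg)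

lemma w_U_neg:
  "w \<in> {w11, w12, w21, w22} \<Longrightarrow> w' \<in> {w11, w12, w21, w22} \<Longrightarrow> w * w' \<in> U_neg 2"
  unfolding w11_def w12_def w21_def w22_def
  by (elim insertE emptyE)
    (simp_all add: distrib_left distrib_right left_diff_distrib right_diff_distrib uscale_mult_left uscale_mult_right
      U_neg_closed eta_U_neg)

text \<open>A representative without a \<Theta>-term, since all solutions have c = 0.\<close>

definition rep :: "poly4 \<Rightarrow> poly4 \<Rightarrow> poly4 \<Rightarrow> poly4 \<Rightarrow> poly4 \<Rightarrow> poly4 \<Rightarrow> preind" where
  "rep a2 a0 am b2 b0 bm = (w11 * w12) \<otimes> a2 + (w11 * w22 + w21 * w12) \<otimes> a0 + (w22 * w21) \<otimes> am
     + (w11 * w21) \<otimes> b2 + (w22 * w11 + w21 * w12) \<otimes> b0 + (w22 * w12) \<otimes> bm"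

lemma qm_rep:
  assumes "a2 \<in> F_space \<mu>" "a0 \<in> F_space \<mu>" "am \<in> F_space \<mu>" "b2 \<in> F_space \<mu>" "b0 \<in> F_space \<mu>" "bm \<in> F_space \<mu>"
  shows "qm \<mu> (pre_act u (rep a2 a0 am b2 b0 bm)) = vecl \<mu> u 0 a2 a0 am b2 b0 bm"
  by (simp add: rep_def pre_act_linear qm tn_def[symmetric] vecl_def tn_zero tn_linear assms distrib_left add.assoc)

lemma pre_act_one: "pre_act 1 s = s"
  by (induction s rule: pm_induct) (simp_all add: pre_act_linear, auto simp: pre_act_def pre_tens_def split_paired_all)

lemma ghom_gt0: "x \<in> ghom 1 \<Longrightarrow> x \<in> g_gt0"
  by (simp add: ghom_def g_gt0_def)

text \<open>The forward direction tests only the ten elements of \<open>sing_sys_iff\<close>. The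
  converse has to reach all of g_{>0}, which is \<open>vecl_pos\<close>, and rests on independence
  for being nonzero.\<close>

lemma nontrivial_iff_solution:
  "nontrivial_hw_singular \<mu> 2 v \<longleftrightarrow> (\<exists>a2 a0 am b2 b0 bm. solution \<mu> a2 a0 am b2 b0 bm \<and> v = ind_cls \<mu> (rep a2 a0 am b2 b0 bm))"
proof
  assume v: "nontrivial_hw_singular \<mu> 2 v"
  then obtain s where s: "s \<in> cs.span {u \<otimes> f | u f. u \<in> U_neg 2 \<and> f \<in> F_space \<mu>}" "v = ind_cls \<mu> s"
    unfolding nontrivial_hw_singular_def Ind_deg_def by blast
  from presented_degree_2[OF s(1)] show "\<exists>a2 a0 am b2 b0 bm. solution \<mu> a2 a0 am b2 b0 bm \<and> v = ind_cls \<mu> (rep a2 a0 am b2 b0 bm)"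
  proof (rule presentedE)
    fix c a2 a0 am b2 b0 bm
    assume F: "c \<in> F_space \<mu>" "a2 \<in> F_space \<mu>" "a0 \<in> F_space \<mu>" "am \<in> F_space \<mu>" "b2 \<in> F_space \<mu>" "b0 \<in> F_space \<mu>" "bm \<in> F_space \<mu>"
      and q: "\<And>u. qm \<mu> (pre_act u s) = vecl \<mu> u c a2 a0 am b2 b0 bm"
    have q1: "qm \<mu> s = vecl \<mu> 1 c a2 a0 am b2 b0 bm" using q[of 1] by (simp add: pre_act_one)
    have "vecl \<mu> (gU x) c a2 a0 am b2 b0 bm = 0" if "x \<in> g_gt0 \<or> x = e_x \<or> x = e_y" for x
      using v that unfolding nontrivial_hw_singular_def hw_singular_def singular_def s(2) ind_act_zero_iff q by blast
    then have sys: "sing_sys \<mu> c a2 a0 am b2 b0 bm"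
      unfolding sing_sys_iff[OF F] using ghom_facts(5-12)[THEN ghom_gt0] by blast
    have "v \<noteq> ind_cls \<mu> 0" using v by (simp add: nontrivial_hw_singular_def)
    then have "\<not> (c = 0 \<and> a2 = 0 \<and> a0 = 0 \<and> am = 0 \<and> b2 = 0 \<and> b0 = 0 \<and> bm = 0)"
      using vecl_zero_iff[OF F] by (auto simp: s(2) ind_cls_eq_iff qm_linear q1)
    then have "c = 0 \<and> solution \<mu> a2 a0 am b2 b0 bm" by (rule sing_sys_solution[OF F sys])
    moreover from this have "v = ind_cls \<mu> (rep a2 a0 am b2 b0 bm)"
      using qm_rep[OF F(2-7), of 1] by (simp add: s(2) ind_cls_eq_iff q1 pre_act_one)
    ultimately show ?thesis by blast
  qed
next
  assume "\<exists>a2 a0 am b2 b0 bm. solution \<mu> a2 a0 am b2 b0 bm \<and> v = ind_cls \<mu> (rep a2 a0 am b2 b0 bm)"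
  then obtain a2 a0 am b2 b0 bm where sol: "solution \<mu> a2 a0 am b2 b0 bm" and v: "v = ind_cls \<mu> (rep a2 a0 am b2 b0 bm)" by blast
  let ?s = "rep a2 a0 am b2 b0 bm"
  note S = solution_sing_sys[OF sol]
  note q = qm_rep[OF S(2-7)]
  note F0 = F_space_linear(4)[of \<mu>] S(2-7)
  let ?D = "{u \<otimes> f | u f. u \<in> U_neg 2 \<and> f \<in> F_space \<mu>}"
  have "u \<otimes> f \<in> cs.span ?D" if "u \<in> U_neg 2" "f \<in> F_space \<mu>" for u f
    using that by (intro cs.span_base) blast
  then have D: "?s \<in> cs.span ?D"
    unfolding rep_def by (intro cs.span_add) (simp_all add: S(2-7) w_U_neg U_neg_closed)
  moreover have "?D \<subseteq> {u \<otimes> f | u f. f \<in> F_space \<mu>}" by blast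
  ultimately have "?s \<in> pre_space \<mu>" unfolding pre_space_def using cs.span_mono by blast
  then have "v \<in> Ind \<mu>" by (simp add: v Ind_def)
  moreover have "v \<in> Ind_deg \<mu> 2" using D by (simp add: v Ind_deg_def)
  moreover have "v \<noteq> ind_cls \<mu> 0"
    using S(8) q[of 1] vecl_zero_iff[OF F0] by (auto simp: v ind_cls_eq_iff qm_linear pre_act_one)
  moreover have "ind_act \<mu> (gU x) v = ind_cls \<mu> 0" if "x \<in> g_gt0" for x
    unfolding v ind_act_zero_iff q by (rule vecl_pos[OF F0 q S(1) that])
  moreover have "ind_act \<mu> (gU e_x) v = ind_cls \<mu> 0" "ind_act \<mu> (gU e_y) v = ind_cls \<mu> 0"
    using S(1) unfolding v ind_act_zero_iff q sing_sys_iff[OF F0] by blast+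
  ultimately show "nontrivial_hw_singular \<mu> 2 v"
    by (simp add: nontrivial_hw_singular_def hw_singular_def singular_def)
qed

text \<open>\<otimes> forms bare pairs, so scalars and sums move across it only in the quotient, and
  there only for polynomials in F.\<close>

lemma rep_classes:
  assumes "p \<in> F_space \<mu>" "q \<in> F_space \<mu>" "r \<in> F_space \<mu>"
  shows "ind_cls \<mu> (rep 0 0 0 (k \<cdot> p) 0 0) = ind_cls \<mu> (k \<cdot> ((w11 * w21) \<otimes> p))"
    "ind_cls \<mu> (rep (k \<cdot> p) 0 0 0 0 0) = ind_cls \<mu> (k \<cdot> ((w11 * w12) \<otimes> p))"
    "ind_cls \<mu> (rep (- (k \<cdot> r)) (k \<cdot> q) (k \<cdot> p) 0 0 0) =
      ind_cls \<mu> (k \<cdot> ((w22 * w21) \<otimes> p + (w11 * w22 + w21 * w12) \<otimes> q - (w11 * w12) \<otimes> r))"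
    "ind_cls \<mu> (rep 0 0 0 (- (k \<cdot> r)) (- (k \<cdot> q)) (k \<cdot> p)) =
      ind_cls \<mu> (k \<cdot> ((w22 * w12) \<otimes> p - (w22 * w11 + w21 * w12) \<otimes> q - (w11 * w21) \<otimes> r))"
  by (simp_all add: ind_cls_eq_iff rep_def qm qm_linear tn_def[symmetric] tn_zero tn_linear tn_linear' assms F_space_linear
      cs.scale_right_distrib cs.scale_right_diff_distrib algebra_simps)

lemma pv_mono2_values:
  "pv u ^ m = mono2 u v m 0" "pv u ^ (m - 1) * pv v = mono2 u v (m - 1) 1" "pv u ^ (m - 2) * pv v ^ 2 = mono2 u v (m - 2) 2"
  using pv_mono2[of u m v 0] pv_mono2[of u "m - 1" v 1] pv_mono2[of u "m - 2" v 2] by simp_all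

theorem theorem6p7:
  fixes \<mu> :: weight and v :: indvec
  assumes "v \<in> Ind \<mu>"
  shows "nontrivial_hw_singular \<mu> 2 v \<longleftrightarrow>
    (\<exists>c::complex. c \<noteq> 0 \<and>
      ((\<exists>n::nat. \<mu> = (0, n, 1 - of_nat n / 2, - 1 - of_nat n / 2) \<and>
          v = ind_cls \<mu> (c \<cdot> ((w11 * w21) \<otimes> y1 ^ n))) \<or>
       (\<exists>m::nat. \<mu> = (m, 0, 1 - of_nat m / 2, 1 + of_nat m / 2) \<and>
          v = ind_cls \<mu> (c \<cdot> ((w11 * w12) \<otimes> x1 ^ m))) \<or>
       (\<exists>m::nat. m > 1 \<and> \<mu> = (m, 0, 2 + of_nat m / 2, - of_nat m / 2) \<and>
          v = ind_cls \<mu> (c \<cdot> ((w22 * w21) \<otimes> x1 ^ m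
                 + (w11 * w22 + w21 * w12) \<otimes> (x1 ^ (m - 1) * x2)
                 - (w11 * w12) \<otimes> (x1 ^ (m - 2) * x2 ^ 2)))) \<or>
       (\<exists>n::nat. n > 1 \<and> \<mu> = (0, n, 2 + of_nat n / 2, of_nat n / 2) \<and>
          v = ind_cls \<mu> (c \<cdot> ((w22 * w12) \<otimes> y1 ^ n
                 - (w22 * w11 + w21 * w12) \<otimes> (y1 ^ (n - 1) * y2)
                 - (w11 * w21) \<otimes> (y1 ^ (n - 2) * y2 ^ 2))))))"
proof -
  let ?a = "\<lambda>k n. \<mu> = (0, n, 1 - of_nat n / 2, - 1 - of_nat n / 2) \<and>
      v = ind_cls \<mu> (rep 0 0 0 (k \<cdot> mono2 Y1 Y2 n 0) 0 0)"
    and ?b = "\<lambda>k m. \<mu> = (m, 0, 1 - of_nat m / 2, 1 + of_nat m / 2) \<and>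
      v = ind_cls \<mu> (rep (k \<cdot> mono2 X1 X2 m 0) 0 0 0 0 0)"
    and ?c = "\<lambda>k m. m > 1 \<and> \<mu> = (m, 0, 2 + of_nat m / 2, - of_nat m / 2) \<and>
      v = ind_cls \<mu> (rep (- (k \<cdot> mono2 X1 X2 (m - 2) 2)) (k \<cdot> mono2 X1 X2 (m - 1) 1) (k \<cdot> mono2 X1 X2 m 0) 0 0 0)"
    and ?d = "\<lambda>k n. n > 1 \<and> \<mu> = (0, n, 2 + of_nat n / 2, of_nat n / 2) \<and>
      v = ind_cls \<mu> (rep 0 0 0 (- (k \<cdot> mono2 Y1 Y2 (n - 2) 2)) (- (k \<cdot> mono2 Y1 Y2 (n - 1) 1)) (k \<cdot> mono2 Y1 Y2 n 0))"
  \<comment> \<open>The families are first obtained in terms of \<open>rep\<close>; the four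
    equivalences below rewrite each of them as the displayed tensors, using that the weight puts the
    monomials into F.\<close>
  have "nontrivial_hw_singular \<mu> 2 v \<longleftrightarrow>
      (\<exists>k. k \<noteq> 0 \<and> ((\<exists>n. ?a k n) \<or> (\<exists>m. ?b k m) \<or> (\<exists>m. ?c k m) \<or> (\<exists>n. ?d k n)))"
    unfolding nontrivial_iff_solution solution_def by blast
  moreover have "?a k n \<longleftrightarrow> \<mu> = (0, n, 1 - of_nat n / 2, - 1 - of_nat n / 2) \<and>
          v = ind_cls \<mu> (k \<cdot> ((w11 * w21) \<otimes> y1 ^ n))" for k n
    using rep_classes(1)[of "mono2 Y1 Y2 n 0" \<mu> 0 0 k] mono2_F_space(2)[of \<mu> n 0] F_space_linear(4)[of \<mu>]
    by (auto simp: pv_mono2_values(1)[where v = Y2] simp del: F_space.simps)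
  moreover have "?b k m \<longleftrightarrow> \<mu> = (m, 0, 1 - of_nat m / 2, 1 + of_nat m / 2) \<and>
          v = ind_cls \<mu> (k \<cdot> ((w11 * w12) \<otimes> x1 ^ m))" for k m
    using rep_classes(2)[of "mono2 X1 X2 m 0" \<mu> 0 0 k] mono2_F_space(1)[of \<mu> m 0] F_space_linear(4)[of \<mu>]
    by (auto simp: pv_mono2_values(1)[where v = X2] simp del: F_space.simps)
  moreover have "?c k m \<longleftrightarrow> m > 1 \<and> \<mu> = (m, 0, 2 + of_nat m / 2, - of_nat m / 2) \<and>
          v = ind_cls \<mu> (k \<cdot> ((w22 * w21) \<otimes> x1 ^ m
                 + (w11 * w22 + w21 * w12) \<otimes> (x1 ^ (m - 1) * x2)
                 - (w11 * w12) \<otimes> (x1 ^ (m - 2) * x2 ^ 2)))" for k m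
    unfolding pv_mono2_values(2,3)
    unfolding pv_mono2_values(1)[where v = X2]
    using rep_classes(3)[of "mono2 X1 X2 m 0" \<mu> "mono2 X1 X2 (m - 1) 1" "mono2 X1 X2 (m - 2) 2" k]
      mono2_F_space(1)[of \<mu> m 0] mono2_F_space(1)[of \<mu> "m - 1" 1] mono2_F_space(1)[of \<mu> "m - 2" 2]
    by (auto simp del: F_space.simps)
  moreover have "?d k n \<longleftrightarrow> n > 1 \<and> \<mu> = (0, n, 2 + of_nat n / 2, of_nat n / 2) \<and>
          v = ind_cls \<mu> (k \<cdot> ((w22 * w12) \<otimes> y1 ^ n
                 - (w22 * w11 + w21 * w12) \<otimes> (y1 ^ (n - 1) * y2)
                 - (w11 * w21) \<otimes> (y1 ^ (n - 2) * y2 ^ 2)))" for k n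
    unfolding pv_mono2_values(2,3)
    unfolding pv_mono2_values(1)[where v = Y2]
    using rep_classes(4)[of "mono2 Y1 Y2 n 0" \<mu> "mono2 Y1 Y2 (n - 1) 1" "mono2 Y1 Y2 (n - 2) 2" k]
      mono2_F_space(2)[of \<mu> n 0] mono2_F_space(2)[of \<mu> "n - 1" 1] mono2_F_space(2)[of \<mu> "n - 2" 2]
    by (auto simp del: F_space.simps)
  ultimately show ?thesis by (simp only:)
qed

end
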